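(* Let $M$ be a complex manifold and let $PSH^{cb}(M)$ be the space of bounded continuous plurisubharmonic functions on $M$. The following statements are equivalent: (1) the functions from $PSH^{cb}(M)$ separate points of $M$; (2) for every point $w_0\in M$ there is a function $u\in PSH^{cb}(M)$ that is smooth and strictly plurisubharmonic near $w_0$ (i.e. on some neighborhood of $w_0$); (3) for every point $w_0\in M$ there are a negative continuous plurisubharmonic function $v$ on $M$ and constants $C_1$ and $C_2$ such that $\log|z-w_0|+C_1<v(z)<\log|z-w_0|+C_2$ for all $z\neq w_0$ near $w_0$.
   Context: Plurisubharmonic functions may take the value $-\infty$; in (3) continuity of $v$ means continuity as a map $M\to[-\infty,\infty)$ (so $v(w_0)=-\infty$). In (3), $|z-w_0|$ is computed in some local holomorphic coordinates near $w_0$ (the condition does not depend on the choice of coordinates, up to changing $C_1,C_2$). A family of functions separates points of $M$ if for all distinct $p,q\in M$ some member $u$ of the family satisfies $u(p)\ne u(q)$. *)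

theory Defs
  imports "HOL-Analysis.Analysis"
begin

section \<open>Holomorphic maps and derivatives in several complex variables\<close>

definition holomorphic_map_on :: "(complex^'n \<Rightarrow> complex^'m) \<Rightarrow> (complex^'n) set \<Rightarrow> bool" where
  "holomorphic_map_on f S \<longleftrightarrow>
    (\<forall>z\<in>S. \<exists>D. (f has_derivative D) (at z) \<and> (\<forall>c w. D (c *s w) = c *s D w))"

text \<open>Class \<open>C\<^sup>k\<close> in the real sense on an open set: all iterated directional derivatives up to
  order \<open>k\<close> exist and are continuous.\<close>

primrec Ck_on :: "nat \<Rightarrow> ('a::real_normed_vector \<Rightarrow> 'b::real_normed_vector) \<Rightarrow> 'a set \<Rightarrow> bool" where
  "Ck_on 0 f S \<longleftrightarrow> continuous_on S f"
| "Ck_on (Suc k) f S \<longleftrightarrow> (\<forall>x\<in>S. f differentiable (at x)) \<and>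
     (\<forall>v. Ck_on k (\<lambda>x. frechet_derivative f (at x) v) S)"

definition smooth_on :: "('a::real_normed_vector \<Rightarrow> 'b::real_normed_vector) \<Rightarrow> 'a set \<Rightarrow> bool" where
  "smooth_on f S \<longleftrightarrow> (\<forall>k. Ck_on k f S)"

text \<open>Wirtinger derivatives \<open>\<partial>/\<partial>z\<^sub>j = (\<partial>/\<partial>x\<^sub>j - i \<partial>/\<partial>y\<^sub>j) / 2\<close> and
  \<open>\<partial>/\<partial>cnj z\<^sub>j = (\<partial>/\<partial>x\<^sub>j + i \<partial>/\<partial>y\<^sub>j) / 2\<close>.\<close>

definition d_z :: "'n \<Rightarrow> (complex^'n \<Rightarrow> complex) \<Rightarrow> complex^'n \<Rightarrow> complex" where
  "d_z j f z = (frechet_derivative f (at z) (axis j 1)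
                - \<i> * frechet_derivative f (at z) (axis j \<i>)) / 2"

definition d_zbar :: "'n \<Rightarrow> (complex^'n \<Rightarrow> complex) \<Rightarrow> complex^'n \<Rightarrow> complex" where
  "d_zbar j f z = (frechet_derivative f (at z) (axis j 1)
                   + \<i> * frechet_derivative f (at z) (axis j \<i>)) / 2"

definition levi_form :: "(complex^'n \<Rightarrow> real) \<Rightarrow> complex^'n \<Rightarrow> complex^'n \<Rightarrow> complex" where
  "levi_form u z w =
    (\<Sum>j\<in>UNIV. \<Sum>k\<in>UNIV. d_z j (d_zbar k (\<lambda>z. complex_of_real (u z))) z * w $ j * cnj (w $ k))"

section \<open>Subharmonic and plurisubharmonic functions\<close>

definition usc_on :: "'a::topological_space set \<Rightarrow> ('a \<Rightarrow> ereal) \<Rightarrow> bool" where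
  "usc_on S u \<longleftrightarrow> (\<forall>x\<in>S. \<forall>c. u x < c \<longrightarrow> (\<forall>\<^sub>F y in at x within S. u y < c))"

text \<open>The mean of \<open>u\<close> over the circle of radius \<open>r\<close> about \<open>c\<close>. As \<open>e2ennreal\<close> maps negative
  arguments to 0, the two integrals are those of the positive and negative parts of \<open>u\<close>. For
  \<open>u < \<infinity>\<close> upper semicontinuous the first one is finite, so no \<open>\<infinity> - \<infinity>\<close> occurs and the mean may
  be \<open>-\<infinity>\<close>.\<close>

definition circle_mean :: "(complex \<Rightarrow> ereal) \<Rightarrow> complex \<Rightarrow> real \<Rightarrow> ereal" where
  "circle_mean u c r = ereal (1 / (2 * pi)) *
    (enn2ereal (\<integral>\<^sup>+\<theta>\<in>{0..2*pi}. e2ennreal (u (c + of_real r * cis \<theta>)) \<partial>lborel)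
     - enn2ereal (\<integral>\<^sup>+\<theta>\<in>{0..2*pi}. e2ennreal (- u (c + of_real r * cis \<theta>)) \<partial>lborel))"

text \<open>The constant \<open>-\<infinity>\<close> counts as subharmonic and plurisubharmonic.\<close>

definition subharmonic_on :: "complex set \<Rightarrow> (complex \<Rightarrow> ereal) \<Rightarrow> bool" where
  "subharmonic_on S u \<longleftrightarrow> usc_on S u \<and> (\<forall>z\<in>S. u z < \<infinity>) \<and>
    (\<forall>c r. 0 < r \<and> cball c r \<subseteq> S \<longrightarrow> u c \<le> circle_mean u c r)"

definition psh_on :: "(complex^'n) set \<Rightarrow> (complex^'n \<Rightarrow> ereal) \<Rightarrow> bool" where
  "psh_on S u \<longleftrightarrow> usc_on S u \<and> (\<forall>z\<in>S. u z < \<infinity>) \<and>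
    (\<forall>a b. subharmonic_on {\<zeta>. a + \<zeta> *s b \<in> S} (\<lambda>\<zeta>. u (a + \<zeta> *s b)))"

section \<open>Complex manifolds\<close>

text \<open>A chart is a pair of a domain \<open>U\<close> and a map \<open>\<phi>\<close> of which only the values on \<open>U\<close> matter.
  A manifold is an open subset \<open>M\<close> of a second countable Hausdorff type (possibly all of it)
  with a holomorphic atlas, of complex dimension \<open>CARD('n)\<close>; it need not be connected.\<close>

type_synonym ('a, 'n) chart = "'a set \<times> ('a \<Rightarrow> complex^'n)"

definition is_chart :: "'a::topological_space set \<Rightarrow> ('a, 'n::finite) chart \<Rightarrow> bool" where
  "is_chart M = (\<lambda>(U, \<phi>). open U \<and> U \<subseteq> M \<and> open (\<phi> ` U) \<and> (\<exists>\<psi>. homeomorphism U (\<phi> ` U) \<phi> \<psi>))"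

definition compatible :: "('a, 'n::finite) chart \<Rightarrow> ('a, 'n) chart \<Rightarrow> bool" where
  "compatible = (\<lambda>(U, \<phi>) (V, \<psi>).
    holomorphic_map_on (\<psi> \<circ> inv_into U \<phi>) (\<phi> ` (U \<inter> V)) \<and>
    holomorphic_map_on (\<phi> \<circ> inv_into V \<psi>) (\<psi> ` (U \<inter> V)))"

definition complex_manifold ::
    "'a::{t2_space, second_countable_topology} set \<Rightarrow> ('a, 'n::finite) chart set \<Rightarrow> bool" where
  "complex_manifold M A \<longleftrightarrow> (\<forall>c\<in>A. is_chart M c) \<and> (\<Union>c\<in>A. fst c) = M \<and>
    (\<forall>c\<in>A. \<forall>d\<in>A. compatible c d)"

text \<open>The local holomorphic coordinates of \<open>M\<close>, i.e. the maximal atlas generated by \<open>A\<close>.\<close>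

definition holomorphic_charts ::
    "'a::topological_space set \<Rightarrow> ('a, 'n::finite) chart set \<Rightarrow> ('a, 'n) chart set" where
  "holomorphic_charts M A = {c. is_chart M c \<and> (\<forall>d\<in>A. compatible c d)}"

definition psh_manifold ::
    "'a::topological_space set \<Rightarrow> ('a, 'n::finite) chart set \<Rightarrow> ('a \<Rightarrow> ereal) \<Rightarrow> bool" where
  "psh_manifold M A u \<longleftrightarrow>
    (\<forall>(U, \<phi>)\<in>holomorphic_charts M A. psh_on (\<phi> ` U) (\<lambda>z. u (inv_into U \<phi> z)))"

definition PSH_cb ::
    "'a::topological_space set \<Rightarrow> ('a, 'n::finite) chart set \<Rightarrow> ('a \<Rightarrow> real) set" where
  "PSH_cb M A = {u. continuous_on M u \<and> bounded (u ` M) \<and> psh_manifold M A (\<lambda>x. ereal (u x))}"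

definition separates_points :: "'a set \<Rightarrow> ('a \<Rightarrow> real) set \<Rightarrow> bool" where
  "separates_points M F \<longleftrightarrow> (\<forall>p\<in>M. \<forall>q\<in>M. p \<noteq> q \<longrightarrow> (\<exists>u\<in>F. u p \<noteq> u q))"

text \<open>Smooth with positive definite Levi form in all coordinates. The Levi form of a smooth
  real function is Hermitian, so \<open>Re\<close> below only changes the type.\<close>

definition smooth_strictly_psh_on ::
    "'a::topological_space set \<Rightarrow> ('a, 'n::finite) chart set \<Rightarrow> 'a set \<Rightarrow> ('a \<Rightarrow> real) \<Rightarrow> bool" where
  "smooth_strictly_psh_on M A N u \<longleftrightarrow>
    (\<forall>(U, \<phi>)\<in>holomorphic_charts M A.
      smooth_on (\<lambda>z. u (inv_into U \<phi> z)) (\<phi> ` (U \<inter> N)) \<and>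
      (\<forall>z\<in>\<phi> ` (U \<inter> N). \<forall>w. w \<noteq> 0 \<longrightarrow> 0 < Re (levi_form (\<lambda>z. u (inv_into U \<phi> z)) z w)))"

end

theory Submission
  imports Defs "HOL-Complex_Analysis.Complex_Analysis"
begin

text \<open>
  A continuous function is plurisubharmonic as soon as, at every point and in every chart, it
  satisfies the sub-mean value inequality for all sufficiently small circles in complex lines
  (theorem \<open>local_submean_imp_submean\<close>). In this local form the inequality needs only a lower
  support: if \<open>g \<le> G\<close> near \<open>p\<close>, \<open>g p = G p\<close> and \<open>g\<close> satisfies it at \<open>p\<close>, so does \<open>G\<close>. Hence
  it passes to maxima and to convex increasing functions, it holds for \<open>|z|\<^sup>2\<close> and \<open>log |z|\<close> in any
  coordinates, which are supported by real parts of holomorphic functions, and a local function \<open>\<rho>\<close> that lies below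
  a global one \<open>u\<close> on a coordinate sphere can be glued in as \<open>max u \<rho>\<close> on the ball
  (lemma \<open>PSH_cb_glue_ball\<close>). All the functions below are made by such gluings.

  The pivot of the equivalence is a function with a strict sphere minimum: a \<open>w\<close> in \<open>PSH_cb M A\<close>
  with \<open>w w0 = 0\<close> and \<open>w \<ge> m > 0\<close> on a coordinate sphere about \<open>w0\<close>. Such a \<open>w\<close> gives \<open>cond2\<close> by
  gluing in \<open>m/4 + \<epsilon> |z - w0|\<^sup>2\<close>, and \<open>cond3\<close> by gluing \<open>log |z - w0|\<close> into a large multiple of \<open>w\<close>
  minus a constant.

  To get \<open>w\<close> from \<open>cond1\<close>, let \<open>f\<close> run through finitely many functions that separate \<open>w0\<close> from the
  points of a coordinate sphere of radius \<open>r\<close>. As \<open>1 + t < exp t\<close> for \<open>t \<noteq> 0\<close>, the sum \<open>u\<close> of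
  \<open>exp (f - f w0)\<close> and the sum \<open>v\<close> of \<open>1 + f - f w0\<close> agree at \<open>w0\<close>, and \<open>v + c \<le> u\<close> on the
  sphere for some \<open>c > 0\<close>: inequality of values has become a one-sided comparison between two
  plurisubharmonic functions. There is now room to raise \<open>v\<close> by \<open>c/2 + \<delta> log (|z - w0| / r)\<close>,
  truncated near \<open>w0\<close>: on the sphere of radius \<open>r\<close> the result still lies below \<open>u\<close>, on a much
  smaller sphere it exceeds the common value at \<open>w0\<close>, and at \<open>w0\<close> itself the logarithm pulls it
  back to this value. Gluing it into \<open>u\<close> yields \<open>w\<close>.

  Conversely, \<open>cond2\<close> implies \<open>cond1\<close>: the Taylor expansion of a smooth strictly plurisubharmonic \<open>u\<close> gives
  \<open>u \<ge> u p + Re P + \<epsilon> |z - p|\<^sup>2\<close> near \<open>p\<close> with \<open>P\<close> holomorphic and \<open>P p = 0\<close>; gluing in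
  \<open>u p + Re P\<close> plus a small constant changes the value at \<open>p\<close> but not at a given point \<open>q\<close>. And \<open>cond3\<close>
  implies \<open>cond1\<close>: truncations of \<open>v\<close> from below are bounded, and one of them, raised near \<open>p\<close>
  by gluing in a constant if \<open>v q = - \<infinity>\<close> too, separates \<open>p\<close> from \<open>q\<close>.

  Smoothness and the Levi form are required in every holomorphic chart, so two facts from several
  complex variables are needed: holomorphic functions are smooth
  (\<open>complex_diff_on_directional_derivative\<close>), and \<open>4 Re (levi_form u z w)\<close> is the sum of the second
  derivatives of \<open>u\<close> in the directions \<open>w\<close> and \<open>\<i> w\<close>
  (\<open>levi_form_second_derivative\<close>).
\<close>

section \<open>Sub-mean value inequalities in one variable\<close>

definition cmean :: "(complex \<Rightarrow> real) \<Rightarrow> complex \<Rightarrow> real \<Rightarrow> real" where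
  "cmean f c r = integral {0..2*pi} (\<lambda>\<theta>. f (c + of_real r * cis \<theta>)) / (2 * pi)"

lemma circle_point_in_sphere:
  "0 \<le> r \<Longrightarrow> c + of_real r * cis \<theta> \<in> sphere c r"
  by (simp add: dist_norm norm_mult)

lemma continuous_on_circle:
  fixes f :: "complex \<Rightarrow> 'b::topological_space"
  assumes "continuous_on (sphere c r) f" "0 \<le> r"
  shows "continuous_on T (\<lambda>\<theta>. f (c + of_real r * cis \<theta>))"
proof (rule continuous_on_compose2[OF assms(1)])
  show "continuous_on T (\<lambda>\<theta>. c + complex_of_real r * cis \<theta>)"
    by (intro continuous_intros)
qed (use circle_point_in_sphere[OF assms(2)] in blast)

lemma circle_integrable:
  fixes f :: "complex \<Rightarrow> real"
  assumes "continuous_on (sphere c r) f" "0 \<le> r"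
  shows "(\<lambda>\<theta>. f (c + of_real r * cis \<theta>)) integrable_on {0..2*pi}"
  by (intro integrable_continuous_real continuous_on_circle assms)

lemma cmean_add:
  assumes "continuous_on (sphere c r) f" "continuous_on (sphere c r) g" "0 \<le> r"
  shows "cmean (\<lambda>x. f x + g x) c r = cmean f c r + cmean g c r"
  by (simp add: cmean_def integral_add circle_integrable assms add_divide_distrib)

lemma cmean_diff:
  assumes "continuous_on (sphere c r) f" "continuous_on (sphere c r) g" "0 \<le> r"
  shows "cmean (\<lambda>x. f x - g x) c r = cmean f c r - cmean g c r"
  by (simp add: cmean_def integral_diff circle_integrable assms diff_divide_distrib)

lemma cmean_scale: "cmean (\<lambda>x. k * f x) c r = k * cmean f c r"
  by (simp add: cmean_def)

lemma cmean_const [simp]: "cmean (\<lambda>x. k) c r = k"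
  by (simp add: cmean_def)

lemma cmean_mono:
  assumes "continuous_on (sphere c r) f" "continuous_on (sphere c r) g" "0 \<le> r"
    "\<And>x. x \<in> sphere c r \<Longrightarrow> f x \<le> g x"
  shows "cmean f c r \<le> cmean g c r"
  unfolding cmean_def
  by (intro divide_right_mono integral_le circle_integrable assms circle_point_in_sphere) auto

lemma cmean_translate: "cmean (\<lambda>x. f (a + x)) c r = cmean f (a + c) r"
  by (simp add: cmean_def add.assoc)

lemma cmean_norm_squared:
  assumes "0 \<le> r"
  shows "cmean (\<lambda>x. (norm (x - a))\<^sup>2) c r = (norm (c - a))\<^sup>2 + r\<^sup>2"
proof -
  define p q where "p = Re (c - a)" and "q = Im (c - a)"
  have e: "(norm (c + of_real r * cis \<theta> - a))\<^sup>2 = p\<^sup>2 + q\<^sup>2 + r\<^sup>2 + 2*r*p * cos \<theta> + 2*r*q * sin \<theta>" for \<theta>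
  proof -
    have "(norm (c + of_real r * cis \<theta> - a))\<^sup>2 = (p + r * cos \<theta>)\<^sup>2 + (q + r * sin \<theta>)\<^sup>2"
      by (simp add: cmod_power2 p_def q_def algebra_simps)
    also have "\<dots> = p\<^sup>2 + q\<^sup>2 + r\<^sup>2 * ((cos \<theta>)\<^sup>2 + (sin \<theta>)\<^sup>2) + 2*r*p * cos \<theta> + 2*r*q * sin \<theta>"
      by algebra
    finally show ?thesis by simp
  qed
  have "((\<lambda>\<theta>. p\<^sup>2 + q\<^sup>2 + r\<^sup>2 + 2*r*p * cos \<theta> + 2*r*q * sin \<theta>) has_integral
      ((p\<^sup>2 + q\<^sup>2 + r\<^sup>2) * (2*pi) + 2*r*p * sin (2*pi) - 2*r*q * cos (2*pi)) -
      ((p\<^sup>2 + q\<^sup>2 + r\<^sup>2) * 0 + 2*r*p * sin 0 - 2*r*q * cos 0)) {0..2*pi}"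
    by (rule fundamental_theorem_of_calculus)
      (auto intro!: derivative_eq_intros simp flip: has_real_derivative_iff_has_vector_derivative)
  then have "integral {0..2*pi} (\<lambda>\<theta>. p\<^sup>2 + q\<^sup>2 + r\<^sup>2 + 2*r*p * cos \<theta> + 2*r*q * sin \<theta>) =
      (p\<^sup>2 + q\<^sup>2 + r\<^sup>2) * (2*pi)"
    by (simp add: integral_unique)
  then show ?thesis
    unfolding cmean_def e by (simp add: cmod_power2 p_def q_def)
qed

lemma cmean_Re_holomorphic:
  assumes "f holomorphic_on S" "open S" "cball c r \<subseteq> S" "0 < r"
  shows "cmean (\<lambda>x. Re (f x)) c r = Re (f c)"
proof -
  have "((\<lambda>u. f u/(u-c)) has_contour_integral (2 * of_real pi * \<i> * f c)) (circlepath c r)"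
    by (rule Cauchy_integral_circlepath_simple) (use assms holomorphic_on_subset in auto)
  then have "((\<lambda>t. f (c + r * cis t) / (r * cis t) * r * \<i> * cis t) has_integral (2 * of_real pi * \<i> * f c)) {0..2*pi}"
    by (simp add: circlepath_def has_contour_integral_part_circlepath_iff)
  then have "((\<lambda>t. f (c + r * cis t) * \<i>) has_integral (2 * of_real pi * \<i> * f c)) {0..2*pi}"
    by (rule has_integral_eq[rotated]) (use \<open>0 < r\<close> in auto)
  from has_integral_mult_left[OF this, of "-\<i>"]
  have "((\<lambda>t. f (c + r * cis t)) has_integral (2 * of_real pi * f c)) {0..2*pi}"
    by (simp add: mult_ac)
  from has_integral_Re[OF this] show ?thesis
    by (simp add: cmean_def integral_unique)
qed

text \<open>The functions \<open>Re p\<close> form an algebra on the unit circle, because there \<open>cnj z = 1 / z\<close>: a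
  product of two of them is half the sum of \<open>Re (p q)\<close> and \<open>Re (p cnj q)\<close>, and the latter is again
  the real part of a polynomial. By the Stone-Weierstrass theorem, continuous boundary values
  are then approximated by those of functions harmonic in the whole plane.\<close>

lemma circle_trig_poly_dense:
  fixes f :: "complex \<Rightarrow> real"
  assumes "continuous_on (sphere 0 1) f" "0 < e"
  shows "\<exists>p. \<forall>z\<in>sphere 0 1. \<bar>f z - Re (poly p z)\<bar> < e"
proof -
  define R where "R = {g. \<exists>p. \<forall>z\<in>sphere 0 1. g z = Re (poly p z)}"
  have conj_prod: "\<exists>s. \<forall>z\<in>sphere 0 1. Re (poly p z * cnj (poly q z)) = Re (poly s z)" for p q
  proof (induction p arbitrary: q)
    case 0
    show ?case by (rule exI[of _ 0]) auto
  next
    case (pCons a p)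
    obtain b q' where q: "q = pCons b q'" by (cases q)
    obtain s where s: "\<And>z. z \<in> sphere 0 1 \<Longrightarrow> Re (poly p z * cnj (poly q' z)) = Re (poly s z)"
      using pCons.IH by blast
    have "Re (poly (pCons a p) z * cnj (poly q z)) =
        Re (poly (smult (cnj a) q + smult (cnj b) (pCons 0 p) + s) z)" if z: "z \<in> sphere 0 1" for z
    proof -
      have zz: "z * cnj z = 1"
        using z by (simp add: complex_norm_square[symmetric])
      have "poly (pCons a p) z * cnj (poly q z) =
          a * cnj (poly q z) + cnj b * (z * poly p z) + (z * cnj z) * (poly p z * cnj (poly q' z))"
        by (simp add: q algebra_simps)
      then have "Re (poly (pCons a p) z * cnj (poly q z)) =
          Re (a * cnj (poly q z)) + Re (cnj b * (z * poly p z)) + Re (poly p z * cnj (poly q' z))"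
        by (simp only: zz plus_complex.sel mult_1)
      also have "Re (a * cnj (poly q z)) = Re (cnj a * poly q z)" by simp
      finally show ?thesis by (simp only: s[OF z] poly_add poly_smult poly_pCons plus_complex.sel add_0 zero_complex.sel)
    qed
    then show ?case by blast
  qed
  interpret function_ring_on R "sphere 0 1"
  proof
    show "compact (sphere 0 1 :: complex set)" by simp
    show "continuous_on (sphere 0 1) f" if fR: "f \<in> R" for f
    proof -
      obtain p where p: "\<And>z. z \<in> sphere 0 1 \<Longrightarrow> f z = Re (poly p z)"
        using fR by (auto simp: R_def)
      have "continuous_on (sphere 0 1) (\<lambda>z. Re (poly p z))" by (intro continuous_intros)
      then show ?thesis by (rule continuous_on_eq) (simp add: p)
    qed
    show "(\<lambda>x. f x + g x) \<in> R" if fg: "f \<in> R" "g \<in> R" for f g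
    proof -
      obtain p q where "\<forall>z\<in>sphere 0 1. f z = Re (poly p z)" "\<forall>z\<in>sphere 0 1. g z = Re (poly q z)"
        using fg by (auto simp: R_def)
      then have "\<forall>z\<in>sphere 0 1. f z + g z = Re (poly (p + q) z)" by simp
      then show ?thesis unfolding R_def by blast
    qed
    show "(\<lambda>x. f x * g x) \<in> R" if fg: "f \<in> R" "g \<in> R" for f g
    proof -
      obtain p q where pq: "\<And>z. z\<in>sphere 0 1 \<Longrightarrow> f z = Re (poly p z)" "\<And>z. z\<in>sphere 0 1 \<Longrightarrow> g z = Re (poly q z)"
        using fg by (auto simp: R_def)
      obtain s where s: "\<And>z. z \<in> sphere 0 1 \<Longrightarrow> Re (poly p z * cnj (poly q z)) = Re (poly s z)"
        using conj_prod by blast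
      have "f z * g z = Re (poly (smult (1/2) (p * q + s)) z)" if z: "z \<in> sphere 0 1" for z
      proof -
        have "f z * g z = (Re (poly p z * poly q z) + Re (poly p z * cnj (poly q z))) / 2"
          by (simp add: pq[OF z])
        also have "\<dots> = (Re (poly p z * poly q z) + Re (poly s z)) / 2"
          by (simp only: s[OF z])
        also have "\<dots> = Re ((poly p z * poly q z + poly s z) / 2)" by (simp only: plus_complex.sel Re_divide_numeral)
        also have "(poly p z * poly q z + poly s z) / 2 = poly (smult (1/2) (p * q + s)) z" by simp
        finally show ?thesis .
      qed
      then show ?thesis unfolding R_def by blast
    qed
    show "(\<lambda>_. c) \<in> R" for c
    proof -
      have "\<forall>z\<in>sphere 0 1. c = Re (poly [:complex_of_real c:] z)" by simp
      then show ?thesis unfolding R_def by blast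
    qed
    show "\<exists>f\<in>R. f x \<noteq> f y" if "x \<noteq> y" for x y :: complex
    proof -
      have "\<forall>z\<in>sphere 0 1. Re z = Re (poly [:0, 1:] z)" "\<forall>z\<in>sphere 0 1. Im z = Re (poly [:0, -\<i>:] z)"
        by auto
      then have "Re \<in> R" "Im \<in> R" unfolding R_def by blast+
      moreover have "Re x \<noteq> Re y \<or> Im x \<noteq> Im y" using that complex_eqI by blast
      ultimately show ?thesis by blast
    qed
  qed
  obtain g where "g \<in> R" and g: "\<And>z. z \<in> sphere 0 1 \<Longrightarrow> \<bar>f z - g z\<bar> < e"
    using Stone_Weierstrass_basic[OF assms] by blast
  then obtain p where "\<And>z. z \<in> sphere 0 1 \<Longrightarrow> g z = Re (poly p z)"
    unfolding R_def by blast
  then have "\<forall>z\<in>sphere 0 1. \<bar>f z - Re (poly p z)\<bar> < e" using g by simp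
  then show ?thesis by blast
qed

text \<open>Adding \<open>\<eta> |x - c|\<^sup>2\<close> makes the sub-mean inequality strict, which excludes an interior
  maximum; \<open>\<eta>\<close> is so small that the boundary values stay below \<open>f c\<close> if \<open>f c > B\<close>.\<close>

lemma submean_max_principle:
  fixes f :: "complex \<Rightarrow> real"
  assumes cont: "continuous_on (cball c r) f" and "0 < r"
    and sub: "\<And>x. x \<in> ball c r \<Longrightarrow> \<forall>\<^sub>F t in at_right 0. f x \<le> cmean f x t"
    and bd: "\<And>x. x \<in> sphere c r \<Longrightarrow> f x \<le> B"
  shows "f c \<le> B"
proof (rule ccontr)
  assume "\<not> f c \<le> B"
  define \<eta> where "\<eta> = (f c - B) / (2 * r\<^sup>2)"
  have \<eta>: "\<eta> > 0" using \<open>\<not> f c \<le> B\<close> \<open>0 < r\<close> by (simp add: \<eta>_def)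
  define g where "g x = f x + \<eta> * (norm (x - c))\<^sup>2" for x
  have contg: "continuous_on (cball c r) g"
    unfolding g_def by (intro continuous_intros cont)
  have "cball c r \<noteq> {}" using \<open>0 < r\<close> by simp
  then obtain x where x: "x \<in> cball c r" and max: "\<And>y. y \<in> cball c r \<Longrightarrow> g y \<le> g x"
    using continuous_attains_sup[OF compact_cball _ contg] by metis
  have "x \<in> ball c r"
  proof (rule ccontr)
    assume "x \<notin> ball c r"
    then have s: "x \<in> sphere c r" using x by auto
    then have "g x \<le> B + \<eta> * r\<^sup>2" using bd[OF s] by (simp add: g_def dist_norm norm_minus_commute)
    also have "\<dots> < f c" using \<open>0 < r\<close> \<open>\<not> f c \<le> B\<close> by (simp add: \<eta>_def field_simps)
    also have "\<dots> = g c" by (simp add: g_def)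
    also have "\<dots> \<le> g x" using max \<open>0 < r\<close> by simp
    finally show False by simp
  qed
  then obtain d where d: "d > 0" "ball x d \<subseteq> ball c r"
    using open_ball openE by blast
  have "\<forall>\<^sub>F t in at_right 0. t < d \<and> 0 < t"
    using d(1) by (auto simp: eventually_at_right_field)
  with sub[OF \<open>x \<in> ball c r\<close>] have "\<forall>\<^sub>F t in at_right 0. f x \<le> cmean f x t \<and> t < d \<and> 0 < t"
    by eventually_elim auto
  then obtain t where t: "f x \<le> cmean f x t" "t < d" "0 < t"
    using eventually_happens'[OF trivial_limit_at_right_real] by blast
  have sp: "sphere x t \<subseteq> cball c r" using d t by fastforce
  have cf: "continuous_on (sphere x t) f" "continuous_on (sphere x t) g"
    using cont contg sp continuous_on_subset by blast+
  have "cmean g x t = cmean f x t + \<eta> * ((norm (x - c))\<^sup>2 + t\<^sup>2)"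
  proof -
    have "cmean g x t = cmean f x t + cmean (\<lambda>x. \<eta> * (norm (x - c))\<^sup>2) x t"
      unfolding g_def using t by (intro cmean_add cf continuous_intros) auto
    then show ?thesis using t by (simp add: cmean_scale cmean_norm_squared)
  qed
  moreover have "\<eta> * t\<^sup>2 > 0" using t \<eta> by simp
  ultimately have "g x < cmean g x t" using t(1) by (simp add: g_def distrib_left)
  also have "\<dots> \<le> cmean (\<lambda>_. g x) x t"
    using cf t sp by (intro cmean_mono max) auto
  finally show False by simp
qed

text \<open>A harmonic function that approximates \<open>f\<close> on the circle dominates \<open>f\<close> in the disc, up to the
  error, by the maximum principle, and it satisfies the mean value equality.\<close>

theorem local_submean_imp_submean:
  fixes f :: "complex \<Rightarrow> real"
  assumes cont: "continuous_on (cball c r) f" and "0 < r"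
    and sub: "\<And>x. x \<in> ball c r \<Longrightarrow> \<forall>\<^sub>F t in at_right 0. f x \<le> cmean f x t"
  shows "f c \<le> cmean f c r"
proof (rule field_le_epsilon)
  fix e :: real assume "e > 0"
  have "continuous_on (sphere 0 1) (\<lambda>z. f (c + of_real r * z))"
    by (rule continuous_on_compose2[OF cont]) (use \<open>0 < r\<close> in \<open>auto intro!: continuous_intros simp: dist_norm norm_mult\<close>)
  then obtain p where p: "\<And>z. z \<in> sphere 0 1 \<Longrightarrow> \<bar>f (c + of_real r * z) - Re (poly p z)\<bar> < e/2"
    using circle_trig_poly_dense[of _ "e/2"] \<open>e > 0\<close> by (metis half_gt_zero)
  define P where "P w = poly p ((w - c) / of_real r)" for w
  have holP: "P holomorphic_on UNIV" unfolding P_def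
    using \<open>0 < r\<close> by (intro holomorphic_intros) auto
  have close: "\<bar>f w - Re (P w)\<bar> < e/2" if "w \<in> sphere c r" for w
  proof -
    have "(w - c) / of_real r \<in> sphere 0 1"
      using that \<open>0 < r\<close> by (simp add: dist_norm norm_divide norm_minus_commute)
    from p[OF this] show ?thesis using \<open>0 < r\<close> by (simp add: P_def)
  qed
  have meanP: "cmean (\<lambda>x. Re (P x)) x t = Re (P x)" if "0 < t" for x t
    by (rule cmean_Re_holomorphic[OF holP]) (use that in auto)
  have contP: "continuous_on S (\<lambda>x. Re (P x))" for S
    using holomorphic_on_imp_continuous_on[OF holP] continuous_on_subset by (intro continuous_intros) blast
  have "f c - Re (P c) \<le> e/2"
  proof (rule submean_max_principle[of c r "\<lambda>x. f x - Re (P x)"])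
    show "continuous_on (cball c r) (\<lambda>x. f x - Re (P x))"
      by (intro continuous_intros cont contP)
    show "f x - Re (P x) \<le> e / 2" if "x \<in> sphere c r" for x
      using close[OF that] by linarith
    fix x assume x: "x \<in> ball c r"
    then obtain d where d: "d > 0" "ball x d \<subseteq> ball c r"
      using open_ball openE by blast
    have "\<forall>\<^sub>F t in at_right 0. t < d \<and> 0 < t"
      using d(1) by (auto simp: eventually_at_right_field)
    with sub[OF x] show "\<forall>\<^sub>F t in at_right 0. f x - Re (P x) \<le> cmean (\<lambda>x. f x - Re (P x)) x t"
    proof eventually_elim
      case (elim t)
      then have "sphere x t \<subseteq> cball c r" using d by fastforce
      then have "cmean (\<lambda>x. f x - Re (P x)) x t = cmean f x t - Re (P x)"
        using elim by (subst cmean_diff) (auto intro: contP continuous_on_subset[OF cont] simp: meanP)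
      then show ?case using elim by simp
    qed
  qed fact
  then have "f c \<le> cmean (\<lambda>x. Re (P x)) c r + e/2" using meanP \<open>0 < r\<close> by simp
  also have "cmean (\<lambda>x. Re (P x)) c r \<le> cmean (\<lambda>x. f x + e/2) c r"
  proof (rule cmean_mono)
    show "continuous_on (sphere c r) (\<lambda>x. f x + e/2)"
      by (intro continuous_intros continuous_on_subset[OF cont]) auto
    show "Re (P x) \<le> f x + e/2" if "x \<in> sphere c r" for x using close[OF that] by linarith
  qed (use contP \<open>0 < r\<close> in auto)
  also have "cmean (\<lambda>x. f x + e/2) c r = cmean f c r + e/2"
    using \<open>0 < r\<close> by (subst cmean_add) (auto intro: continuous_on_subset[OF cont])
  finally show "f c \<le> cmean f c r + e" by simp
qed

text \<open>The next lemmas translate between the mean \<open>circle_mean\<close>, defined by two Lebesgue integrals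
  with values in the extended reals, and \<open>cmean\<close>.\<close>

lemma set_nn_integral_ereal_circle:
  assumes "continuous_on (sphere c r) f" "0 \<le> r"
  shows "(\<integral>\<^sup>+\<theta>\<in>{0..2*pi}. e2ennreal (ereal (f (c + of_real r * cis \<theta>))) \<partial>lborel) =
    ennreal (integral {0..2*pi} (\<lambda>\<theta>. max 0 (f (c + of_real r * cis \<theta>))))"
proof -
  let ?g = "\<lambda>\<theta>. max 0 (f (c + of_real r * cis \<theta>))"
  have "?g integrable_on {0..2*pi}"
    by (intro integrable_continuous_real continuous_intros continuous_on_circle assms)
  then have "integral\<^sup>N lborel (\<lambda>\<theta>. ennreal (indicator {0..2*pi} \<theta> * ?g \<theta>)) = ennreal (integral {0..2*pi} ?g)"
    by (intro nn_integral_has_integral_lebesgue integrable_integral) auto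
  moreover have "ennreal (indicator {0..2*pi} \<theta> * ?g \<theta>) =
      e2ennreal (ereal (f (c + of_real r * cis \<theta>))) * indicator {0..2*pi} \<theta>" for \<theta>
    by (simp add: indicator_def e2ennreal_ereal max_def ennreal_neg)
  ultimately show ?thesis by simp
qed

lemma circle_mean_eq_cmean:
  assumes "continuous_on (sphere c r) f" "0 \<le> r"
  shows "circle_mean (\<lambda>x. ereal (f x)) c r = ereal (cmean f c r)"
proof -
  let ?p = "\<lambda>\<theta>. max 0 (f (c + of_real r * cis \<theta>))" and ?n = "\<lambda>\<theta>. max 0 (- f (c + of_real r * cis \<theta>))"
  have neg: "continuous_on (sphere c r) (\<lambda>x. - f x)" by (intro continuous_intros assms)
  have i: "?p integrable_on {0..2*pi}" "?n integrable_on {0..2*pi}"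
    by (intro integrable_continuous_real continuous_intros continuous_on_circle assms neg)+
  have "integral {0..2*pi} ?p \<ge> 0" "integral {0..2*pi} ?n \<ge> 0"
    by (intro integral_nonneg i; simp)+
  moreover have "integral {0..2*pi} ?p - integral {0..2*pi} ?n = integral {0..2*pi} (\<lambda>\<theta>. f (c + of_real r * cis \<theta>))"
    by (subst integral_diff[OF i, symmetric]) (auto intro!: integral_cong)
  ultimately show ?thesis
    using set_nn_integral_ereal_circle[OF assms] set_nn_integral_ereal_circle[OF neg assms(2)]
    by (simp add: circle_mean_def cmean_def enn2ereal_ennreal)
qed

lemma circle_mean_mono:
  assumes "\<And>\<theta>. u (c + of_real r * cis \<theta>) \<le> v (c + of_real r * cis \<theta>)"
  shows "circle_mean u c r \<le> circle_mean v c r"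
  unfolding circle_mean_def
  by (intro ereal_mult_left_mono ereal_minus_mono)
    (auto intro!: nn_integral_mono mult_right_mono e2ennreal_mono simp: assms less_eq_ennreal.rep_eq[symmetric])

lemma continuous_on_imp_usc_on: "continuous_on S f \<Longrightarrow> usc_on S f"
  unfolding usc_on_def continuous_on_def by (blast intro: order_tendstoD(2))

text \<open>The truncations \<open>max f (-k)\<close> are real-valued, so the local-to-global principle applies to each
  of them. The integrals of their negative parts increase to that of \<open>f\<close> by monotone
  convergence, while the positive parts do not depend on \<open>k\<close>.\<close>

lemma subharmonic_on_if_truncations:
  fixes f :: "complex \<Rightarrow> ereal"
  assumes cont: "continuous_on S f" and fin: "\<And>z. z \<in> S \<Longrightarrow> f z < \<infinity>"
    and sub: "\<And>k c. c \<in> S \<Longrightarrow> \<forall>\<^sub>F t in at_right 0. 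
        real_of_ereal (max (f c) (ereal (- real k))) \<le> cmean (\<lambda>x. real_of_ereal (max (f x) (ereal (- real k)))) c t"
  shows "subharmonic_on S f"
  unfolding subharmonic_on_def
proof (intro conjI allI impI ballI fin)
  show "usc_on S f"
    by (rule continuous_on_imp_usc_on[OF cont])
next
  fix c r assume cr: "0 < r \<and> cball c r \<subseteq> S"
  let ?z = "\<lambda>\<theta>. c + of_real r * cis \<theta>"
  have zS: "?z \<theta> \<in> S" for \<theta> using cr circle_point_in_sphere[of r c \<theta>] by auto
  have cS: "c \<in> S" using cr by (meson centre_in_cball less_imp_le subsetD)
  have sph: "sphere c r \<subseteq> S" using cr by auto
  define g where "g k x = real_of_ereal (max (f x) (ereal (- real k)))" for k x
  have g: "ereal (g k x) = max (f x) (ereal (- real k))" if "x \<in> S" for k x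
    unfolding g_def using fin[OF that] by (cases "f x") (auto simp: max_def)
  have contg: "continuous_on S (g k)" for k
  proof -
    have "continuous_on S (\<lambda>x. ereal (g k x))"
      by (rule continuous_on_eq[of S "\<lambda>x. max (f x) (ereal (- real k))"])
        (auto intro!: continuous_intros cont simp: g)
    then show ?thesis by (simp add: continuous_on_def)
  qed
  have mean: "f c \<le> circle_mean (\<lambda>x. ereal (g k x)) c r" for k
  proof -
    have "g k c \<le> cmean (g k) c r"
    proof (rule local_submean_imp_submean)
      show "continuous_on (cball c r) (g k)" using contg cr continuous_on_subset by blast
      show "\<forall>\<^sub>F t in at_right 0. g k x \<le> cmean (g k) x t" if "x \<in> ball c r" for x
      proof -
        have "x \<in> S" using that cr by auto
        from sub[OF this] show ?thesis unfolding g_def .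
      qed
    qed (use cr in auto)
    then have "ereal (g k c) \<le> circle_mean (\<lambda>x. ereal (g k x)) c r"
      using cr by (subst circle_mean_eq_cmean) (auto intro: continuous_on_subset[OF contg sph])
    moreover have "f c \<le> ereal (g k c)" using g[OF cS] by simp
    ultimately show ?thesis by simp
  qed
  define N where "N k \<theta> = e2ennreal (- ereal (g k (?z \<theta>))) * indicator {0..2*pi} \<theta>" for k \<theta>
  \<comment> \<open>\<open>e2ennreal\<close> sends the truncation level \<open>- k\<close>, as all negative numbers, to \<open>0\<close>.\<close>
  have P: "e2ennreal (ereal (g k (?z \<theta>))) = e2ennreal (f (?z \<theta>))" for k \<theta>
  proof (cases "f (?z \<theta>) \<le> ereal (- real k)")
    case True
    then have "f (?z \<theta>) \<le> 0" using order_trans by fastforce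
    then show ?thesis using True by (simp add: g[OF zS] max_def e2ennreal_neg ennreal_neg)
  qed (simp add: g[OF zS] max_def)
  have incN: "incseq N"
    unfolding N_def incseq_def le_fun_def
  proof (intro allI impI mult_right_mono e2ennreal_mono)
    fix k l :: nat and \<theta> assume "k \<le> l"
    then have "max (f (?z \<theta>)) (ereal (- real l)) \<le> max (f (?z \<theta>)) (ereal (- real k))"
      by (intro max.mono) auto
    then show "- ereal (g k (?z \<theta>)) \<le> - ereal (g l (?z \<theta>))"
      unfolding ereal_minus_le_minus g[OF zS] .
  qed simp
  have contz: "continuous_on UNIV (\<lambda>\<theta>. g k (?z \<theta>))" for k
    using cr by (intro continuous_on_circle continuous_on_subset[OF contg sph]) auto
  have measN: "N k \<in> borel_measurable lborel" for k
  proof -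
    have "(\<lambda>\<theta>. g k (?z \<theta>)) \<in> borel_measurable borel"
      by (rule borel_measurable_continuous_onI[OF contz])
    then show ?thesis unfolding N_def by measurable
  qed
  have sup: "(SUP k. N k \<theta>) = e2ennreal (- f (?z \<theta>)) * indicator {0..2*pi} \<theta>" for \<theta>
  proof (rule antisym)
    show "(SUP k. N k \<theta>) \<le> e2ennreal (- f (?z \<theta>)) * indicator {0..2*pi} \<theta>"
      unfolding N_def
    proof (intro SUP_least mult_right_mono e2ennreal_mono)
      show "- ereal (g k (?z \<theta>)) \<le> - f (?z \<theta>)" for k
        unfolding ereal_minus_le_minus g[OF zS] by simp
    qed simp
    show "e2ennreal (- f (?z \<theta>)) * indicator {0..2*pi} \<theta> \<le> (SUP k. N k \<theta>)"
    proof (cases "f (?z \<theta>)")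
      case (real a)
      obtain k where "real k \<ge> - a" using real_arch_simple by blast
      then have "ereal (g k (?z \<theta>)) = f (?z \<theta>)" by (simp add: g[OF zS] real)
      then have "e2ennreal (- f (?z \<theta>)) * indicator {0..2*pi} \<theta> = N k \<theta>" by (simp add: N_def)
      then show ?thesis by (metis SUP_upper UNIV_I)
    next
      case PInf
      then show ?thesis using fin[OF zS] by simp
    next
      case MInf
      show ?thesis
      proof (cases "\<theta> \<in> {0..2*pi}")
        case True
        have "N k \<theta> = of_nat k" for k
          using True by (simp add: N_def g[OF zS] MInf max_def e2ennreal_ereal ennreal_of_nat_eq_real_of_nat)
        then show ?thesis by (simp add: ennreal_SUP_of_nat_eq_top)
      qed simp
    qed
  qed
  define p where "p = (\<integral>\<^sup>+\<theta>\<in>{0..2*pi}. e2ennreal (f (?z \<theta>)) \<partial>lborel)"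
  define n where "n = (\<integral>\<^sup>+\<theta>\<in>{0..2*pi}. e2ennreal (- f (?z \<theta>)) \<partial>lborel)"
  have n: "n = (SUP k. integral\<^sup>N lborel (N k))"
    unfolding n_def sup[symmetric] using measN incN by (intro nn_integral_monotone_convergence_SUP) auto
  have pfin: "p \<noteq> \<infinity>"
  proof -
    have "continuous_on (sphere c r) (g 0)" by (rule continuous_on_subset[OF contg sph])
    from set_nn_integral_ereal_circle[OF this] cr show ?thesis
      unfolding p_def P[of 0, symmetric] by auto
  qed
  have mean': "f c \<le> ereal (1 / (2*pi)) * (enn2ereal p - enn2ereal (integral\<^sup>N lborel (N k)))" for k
    using mean[of k] unfolding circle_mean_def p_def N_def P .
  show "f c \<le> circle_mean f c r"
  proof (cases "f c")
    case (real a)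
    obtain q where q: "q \<ge> 0" "p = ennreal q" using pfin by (cases p) auto
    have "integral\<^sup>N lborel (N k) \<le> ennreal (q - 2 * pi * a)" for k
    proof (cases "integral\<^sup>N lborel (N k)")
      case (real m)
      then have "a \<le> (q - m) / (2*pi)" using mean'[of k] \<open>f c = ereal a\<close> q by (simp add: enn2ereal_ennreal)
      then have "m \<le> q - 2 * pi * a" by (simp add: field_simps)
      then show ?thesis using real by (simp add: ennreal_leI)
    next
      case top
      then show ?thesis using mean'[of k] \<open>f c = ereal a\<close> q by (simp add: enn2ereal_ennreal)
    qed
    then have nle: "n \<le> ennreal (q - 2 * pi * a)" unfolding n by (rule SUP_least)
    then obtain m where m: "m \<ge> 0" "n = ennreal m" by (cases n) (auto simp: top_unique)
    have "m \<le> q - 2 * pi * a"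
    proof (cases "q - 2 * pi * a \<ge> 0")
      case True then show ?thesis using nle m by simp
    next
      case False
      have "integral\<^sup>N lborel (N 0) = 0" using nle False unfolding n
        by (metis SUP_upper UNIV_I ennreal_neg le_zero_eq nle n linorder_le_cases order_trans)
      then have "a \<le> q / (2*pi)" using mean'[of 0] \<open>f c = ereal a\<close> q by (simp add: enn2ereal_ennreal zero_ennreal.rep_eq)
      then show ?thesis using False by (simp add: field_simps)
    qed
    then have "a \<le> (q - m) / (2*pi)" by (simp add: field_simps)
    then show ?thesis using \<open>f c = ereal a\<close> q m
      unfolding circle_mean_def p_def[symmetric] n_def[symmetric] by (simp add: enn2ereal_ennreal)
  next
    case PInf then show ?thesis using fin[OF cS] by simp
  qed simp
qed

section \<open>Smoothness of holomorphic functions of several variables\<close>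

text \<open>The scalar-valued counterpart of \<open>holomorphic_map_on\<close>.\<close>

definition complex_diff_on :: "(complex^'n \<Rightarrow> complex) \<Rightarrow> (complex^'n) set \<Rightarrow> bool" where
  "complex_diff_on f S \<longleftrightarrow>
    (\<forall>z\<in>S. \<exists>D. (f has_derivative D) (at z) \<and> (\<forall>c w. D (c *s w) = c * D w))"

lemma norm_vector_smult: "norm (c *s (v :: complex^'n)) = norm c * norm v"
  by (simp add: norm_vec_def norm_mult L2_set_right_distrib)

lemma of_real_vector_smult: "complex_of_real c *s (v :: complex^'n) = c *\<^sub>R v"
  by (simp add: vec_eq_iff scaleR_conv_of_real[where 'a=complex])

lemma bounded_linear_vector_smult: "bounded_linear (\<lambda>\<zeta>. \<zeta> *s (b :: complex^'n))"
proof (rule bounded_linear_intro)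
  show "(r *\<^sub>R x) *s b = r *\<^sub>R (x *s b)" for r x by (simp add: vec_eq_iff)
  show "norm (x *s b) \<le> norm x * norm b" for x by (simp add: norm_vector_smult)
qed (simp add: vector_sadd_rdistrib)

lemma continuous_on_complex_line: "continuous_on T (\<lambda>\<zeta>. a + \<zeta> *s (b :: complex^'n))"
  by (intro continuous_intros bounded_linear.continuous_on[OF bounded_linear_vector_smult])

lemma has_derivative_complex_line:
  "((\<lambda>\<zeta>. a + \<zeta> *s (b :: complex^'n)) has_derivative (\<lambda>h. h *s b)) (at \<zeta>)"
  by (auto intro!: derivative_eq_intros bounded_linear.has_derivative[OF bounded_linear_vector_smult])

lemma complex_diff_on_frechet:
  assumes "complex_diff_on f S" "z \<in> S"
  shows "(f has_derivative frechet_derivative f (at z)) (at z)"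
    and "frechet_derivative f (at z) (c *s w) = c * frechet_derivative f (at z) w"
proof -
  obtain D where D: "(f has_derivative D) (at z)" "\<And>c w. D (c *s w) = c * D w"
    using assms by (auto simp: complex_diff_on_def)
  have e: "frechet_derivative f (at z) = D" using frechet_derivative_at[OF D(1)] by simp
  show "(f has_derivative frechet_derivative f (at z)) (at z)"
    "frechet_derivative f (at z) (c *s w) = c * frechet_derivative f (at z) w" using D by (simp_all add: e)
qed

lemma complex_diff_on_imp_continuous_on: "complex_diff_on f S \<Longrightarrow> continuous_on S f"
  by (meson complex_diff_on_frechet(1) continuous_at_imp_continuous_on has_derivative_continuous)

lemma complex_diff_on_line_derivative:
  assumes f: "complex_diff_on f S" and "a + \<zeta> *s b \<in> S"
  shows "((\<lambda>\<zeta>. f (a + \<zeta> *s b)) has_field_derivative frechet_derivative f (at (a + \<zeta> *s b)) b) (at \<zeta>)"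
proof -
  have "((\<lambda>\<zeta>. f (a + \<zeta> *s b)) has_derivative (\<lambda>h. frechet_derivative f (at (a + \<zeta> *s b)) (h *s b))) (at \<zeta>)"
    using has_derivative_compose[OF has_derivative_complex_line complex_diff_on_frechet(1)[OF assms]] .
  then show ?thesis
    by (simp add: has_field_derivative_def complex_diff_on_frechet(2)[OF assms] mult.commute[of _ "frechet_derivative f _ b"])
qed

lemma complex_diff_on_line_holomorphic:
  assumes "complex_diff_on f S" "\<And>\<zeta>. \<zeta> \<in> T \<Longrightarrow> a + \<zeta> *s b \<in> S"
  shows "(\<lambda>\<zeta>. f (a + \<zeta> *s b)) holomorphic_on T"
  unfolding holomorphic_on_def field_differentiable_def
  using complex_diff_on_line_derivative[OF assms(1)] assms(2) has_field_derivative_at_within by blast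

lemma deriv_line:
  assumes "complex_diff_on f S" "a \<in> S"
  shows "deriv (\<lambda>\<zeta>. f (a + \<zeta> *s b)) 0 = frechet_derivative f (at a) b"
  using complex_diff_on_line_derivative[OF assms(1), of a 0 b] assms(2) by (simp add: DERIV_imp_deriv)

text \<open>The second order Taylor remainder, with \<open>u''\<close> estimated by Cauchy's inequality on discs of
  radius \<open>R/4\<close>; these stay in \<open>ball 0 R\<close> since their centres have modulus at most \<open>1 \<le> R/2\<close>.\<close>

lemma holomorphic_linear_remainder:
  assumes hol: "u holomorphic_on ball 0 R" and "2 \<le> R" and bd: "\<And>s. s \<in> ball 0 R \<Longrightarrow> norm (u s) \<le> B"
  shows "norm (u 1 - u 0 - deriv u 0) \<le> 32 * B / R\<^sup>2"
proof -
  have sub: "cball x (R/4) \<subseteq> ball 0 R" if "x \<in> cball 0 1" for x :: complex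
  proof
    fix y assume "y \<in> cball x (R/4)"
    then have "norm y \<le> norm x + R/4" using norm_triangle_sub[of y x] by (simp add: dist_norm norm_minus_commute)
    then show "y \<in> ball 0 R" using that \<open>2 \<le> R\<close> by simp
  qed
  have "norm ((deriv ^^ 0) u 1 - (\<Sum>i\<le>1. (deriv ^^ i) u 0 * (1 - 0) ^ i / (fact i)))
      \<le> (32 * B / R\<^sup>2) * norm (1 - 0 :: complex)^(Suc 1) / fact 1"
  proof (rule complex_Taylor[of "cball 0 1"])
    fix i :: nat and x :: complex assume x: "x \<in> cball 0 1" "i \<le> 1"
    have "x \<in> ball 0 R" using x \<open>2 \<le> R\<close> by auto
    then have "((deriv ^^ i) u has_field_derivative deriv ((deriv ^^ i) u) x) (at x)"
      using holomorphic_higher_deriv[OF hol open_ball] holomorphic_derivI open_ball by blast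
    then show "((deriv ^^ i) u has_field_derivative (deriv ^^ Suc i) u x) (at x within cball 0 1)"
      using has_field_derivative_at_within by auto
  next
    fix x :: complex assume x: "x \<in> cball 0 1"
    have "norm ((deriv ^^ 2) u x) \<le> fact 2 * B / (R/4)^2"
    proof (rule Cauchy_inequality)
      show "u holomorphic_on ball x (R/4)"
        using hol sub[OF x] ball_subset_cball holomorphic_on_subset by (meson order_trans)
      show "continuous_on (cball x (R/4)) u"
        using hol sub[OF x] holomorphic_on_imp_continuous_on holomorphic_on_subset by blast
      show "norm (u y) \<le> B" if "norm (x - y) = R/4" for y
        using bd sub[OF x] that by (metis dist_norm mem_cball order_refl subsetD)
    qed (use \<open>2 \<le> R\<close> in auto)
    then show "norm ((deriv ^^ Suc 1) u x) \<le> 32 * B / R\<^sup>2"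
      by (simp add: numeral_2_eq_2 power_divide)
  qed auto
  then show ?thesis by (simp add: algebra_simps)
qed

text \<open>Restricting to the complex line in direction \<open>h\<close> makes the error of the first order expansion
  quadratic in \<open>h\<close> with a constant that depends only on a bound for \<open>f\<close>, hence locally
  uniform in the point.\<close>

lemma complex_diff_on_linear_remainder:
  assumes f: "complex_diff_on f S" and sub: "ball x \<rho> \<subseteq> S" and bd: "\<And>y. y \<in> ball x \<rho> \<Longrightarrow> norm (f y) \<le> B"
    and h: "norm h \<le> \<rho> / 2" and "\<rho> > 0"
  shows "norm (f (x + h) - f x - frechet_derivative f (at x) h) \<le> 32 * B / \<rho>\<^sup>2 * (norm h)\<^sup>2"
proof (cases "h = 0")
  case True
  have "x \<in> S" using sub \<open>\<rho> > 0\<close> by auto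
  from complex_diff_on_frechet(2)[OF f this, of 0 0] show ?thesis using True by simp
next
  case False
  have xS: "x \<in> S" using sub \<open>\<rho> > 0\<close> by auto
  define R where "R = \<rho> / norm h"
  have "2 \<le> R" using h False by (simp add: R_def field_simps)
  have in_ball: "x + s *s h \<in> ball x \<rho>" if "s \<in> ball 0 R" for s
    using that False by (simp add: R_def dist_norm norm_vector_smult field_simps)
  have "norm (f (x + 1 *s h) - f (x + 0 *s h) - deriv (\<lambda>s. f (x + s *s h)) 0) \<le> 32 * B / R\<^sup>2"
  proof (rule holomorphic_linear_remainder[OF _ \<open>2 \<le> R\<close>])
    show "(\<lambda>s. f (x + s *s h)) holomorphic_on ball 0 R"
      by (rule complex_diff_on_line_holomorphic[OF f]) (use in_ball sub in auto)
    show "norm (f (x + s *s h)) \<le> B" if "s \<in> ball 0 R" for s using bd in_ball[OF that] by blast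
  qed
  then show ?thesis using False by (simp add: deriv_line[OF f xS] R_def power_divide)
qed

text \<open>The derivative of \<open>x \<mapsto> D f x v\<close> at \<open>z\<close> in direction \<open>h\<close> has to be the derivative at
  \<open>t = 0\<close> of \<open>t \<mapsto> D f (z + t v) h\<close>. The latter function is holomorphic as a uniform limit of
  difference quotients. The first order remainder \<open>f (x + h) - f x - D f x h\<close> is quadratic in
  \<open>h\<close>, uniformly for \<open>x = z + t v\<close>, and holomorphic in \<open>t\<close>, so by Cauchy's inequality its
  derivative in \<open>t\<close>, which is the error to be estimated, is quadratic in \<open>h\<close> as well.\<close>

theorem complex_diff_on_directional_derivative:
  fixes f :: "complex^'n \<Rightarrow> complex"
  assumes f: "complex_diff_on f S" and "open S"
  shows "complex_diff_on (\<lambda>x. frechet_derivative f (at x) v) S"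
  unfolding complex_diff_on_def
proof
  fix z assume "z \<in> S"
  let ?D = "\<lambda>x. frechet_derivative f (at x)"
  obtain e where e: "e > 0" "cball z e \<subseteq> S" using \<open>open S\<close> \<open>z \<in> S\<close> open_contains_cball by blast
  define \<rho> where "\<rho> = e / 3"
  have "\<rho> > 0" using e by (simp add: \<rho>_def)
  have "compact (f ` cball z e)"
    using complex_diff_on_imp_continuous_on[OF f] e(2) continuous_on_subset by (intro compact_continuous_image) auto
  then obtain B where B: "\<And>y. y \<in> cball z e \<Longrightarrow> norm (f y) \<le> B"
    using compact_imp_bounded bounded_iff by (metis imageI)
  have ball_in: "ball x \<rho> \<subseteq> cball z e" if "dist z x \<le> 2 * \<rho>" for x
  proof
    fix y assume "y \<in> ball x \<rho>"
    then show "y \<in> cball z e" using dist_triangle[of z y x] that \<open>\<rho> > 0\<close> by (simp add: \<rho>_def)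
  qed
  define K where "K = 32 * B / \<rho>\<^sup>2"
  have rem: "norm (f (x + h) - f x - ?D x h) \<le> K * (norm h)\<^sup>2" if "dist z x \<le> 2 * \<rho>" "norm h \<le> \<rho> / 2" for x h
    unfolding K_def using ball_in[OF that(1)] e B that(2) \<open>\<rho> > 0\<close>
    by (intro complex_diff_on_linear_remainder[OF f]) auto
  define \<tau> where "\<tau> = \<rho> / (norm v + 1)"
  have "\<tau> > 0" using \<open>\<rho> > 0\<close> by (simp add: \<tau>_def add_nonneg_pos)
  have line: "dist z (z + t *s v) \<le> \<rho>" if "norm t \<le> \<tau>" for t
  proof -
    have "norm t * norm v \<le> \<tau> * (norm v + 1)" using that \<open>\<tau> > 0\<close> by (intro mult_mono) auto
    also have "\<dots> = \<rho>" unfolding \<tau>_def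
      by (rule nonzero_eq_divide_eq[THEN iffD1, OF _ refl]) (smt (verit) norm_ge_zero)
    finally show ?thesis by (simp add: dist_norm norm_vector_smult)
  qed
  have line_in: "z + t *s v + h \<in> S" if "norm t \<le> \<tau>" "norm h \<le> \<rho>" for t h
  proof -
    have "dist z (z + t *s v + h) \<le> dist z (z + t *s v) + norm h"
      using norm_triangle_ineq[of "t *s v" h] by (simp add: dist_norm add.assoc norm_minus_commute add.commute[of h])
    then show ?thesis using line[OF that(1)] that(2) e(2) \<open>\<rho> > 0\<close> by (auto simp: \<rho>_def subset_iff)
  qed
  have hol: "(\<lambda>t. f (z + t *s v + h)) holomorphic_on ball 0 \<tau>" if "norm h \<le> \<rho>" for h
  proof -
    have "(\<lambda>t. f ((z + h) + t *s v)) holomorphic_on ball 0 \<tau>"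
      by (rule complex_diff_on_line_holomorphic[OF f]) (use line_in that in \<open>auto simp: add_ac\<close>)
    then show ?thesis by (simp add: add_ac)
  qed
  have D_in: "z + t *s v \<in> S" if "norm t \<le> \<tau>" for t using line_in[OF that, of 0] \<open>\<rho> > 0\<close> by simp
  have Dadd: "?D x (h + k) = ?D x h + ?D x k" if "x \<in> S" for x h k
    using complex_diff_on_frechet(1)[OF f that] has_derivative_bounded_linear bounded_linear.linear linear_add by blast
  have Dsm: "?D x (c *s h) = c * ?D x h" if "x \<in> S" for x h c
    using complex_diff_on_frechet(2)[OF f that] .
  have holD_small: "(\<lambda>t. ?D (z + t *s v) h) holomorphic_on ball 0 \<tau>" if h: "norm h \<le> \<rho> / 2" for h
  proof (rule holomorphic_uniform_sequence[OF open_ball])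
    let ?q = "\<lambda>n t. of_nat (Suc n) * (f (z + t *s v + (1 / of_nat (Suc n)) *s h) - f (z + t *s v + 0))"
    have hn: "norm ((1 / of_nat (Suc n) :: complex) *s h) = norm h / real (Suc n)" for n
      by (simp add: norm_vector_smult norm_divide del: of_nat_Suc)
    have hn': "norm h / real (Suc n) \<le> norm h" for n by (simp add: field_simps mult_left_le)
    show "?q n holomorphic_on ball 0 \<tau>" for n
      using h hn hn'[of n] \<open>\<rho> > 0\<close> by (intro holomorphic_intros hol) auto
    fix t assume "t \<in> ball (0::complex) \<tau>"
    then obtain d where d: "d > 0" "cball t d \<subseteq> ball 0 \<tau>" using open_ball open_contains_cball by blast
    have bound: "norm (?q n s - ?D (z + s *s v) h) \<le> K * (norm h)\<^sup>2 / real (Suc n)" if "s \<in> cball t d" for n s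
    proof -
      have s: "norm s \<le> \<tau>" using that d by (auto simp: subset_iff less_imp_le)
      let ?h = "(1 / of_nat (Suc n) :: complex) *s h"
      have small: "norm ?h \<le> \<rho> / 2" using h hn'[of n] hn[of n] by linarith
      have "?q n s - ?D (z + s *s v) h = of_nat (Suc n) * (f (z + s *s v + ?h) - f (z + s *s v) - ?D (z + s *s v) ?h)"
        using D_in[OF s] by (simp add: Dsm right_diff_distrib del: of_nat_Suc)
      also have "norm \<dots> \<le> real (Suc n) * (K * (norm ?h)\<^sup>2)"
        unfolding norm_mult norm_of_nat
        using line[OF s] \<open>\<rho> > 0\<close> small by (intro mult_left_mono rem) (linarith | simp)+
      also have "\<dots> = K * (norm h)\<^sup>2 / real (Suc n)"
        unfolding hn by (simp add: power2_eq_square field_simps del: of_nat_Suc)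
      finally show ?thesis .
    qed
    have "uniform_limit (cball t d) ?q (\<lambda>t. ?D (z + t *s v) h) sequentially"
    proof (rule uniform_limitI)
      fix \<epsilon> :: real assume "\<epsilon> > 0"
      have "(\<lambda>n. K * (norm h)\<^sup>2 / real (Suc n)) \<longlonglongrightarrow> 0"
        using LIMSEQ_Suc[OF lim_const_over_n] by blast
      then have "\<forall>\<^sub>F n in sequentially. K * (norm h)\<^sup>2 / real (Suc n) < \<epsilon>"
        using \<open>\<epsilon> > 0\<close> order_tendstoD(2) by blast
      then show "\<forall>\<^sub>F n in sequentially. \<forall>s\<in>cball t d. dist (?q n s) (?D (z + s *s v) h) < \<epsilon>"
        by eventually_elim (use bound in \<open>fastforce simp only: dist_norm intro: le_less_trans\<close>)
    qed
    then show "\<exists>d>0. cball t d \<subseteq> ball 0 \<tau> \<and> uniform_limit (cball t d) ?q (\<lambda>t. ?D (z + t *s v) h) sequentially"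
      using d by blast
  qed
  \<comment> \<open>By homogeneity, the bound on the size of \<open>h\<close> can be dropped.\<close>
  have holD: "(\<lambda>t. ?D (z + t *s v) h) holomorphic_on ball 0 \<tau>" for h
  proof -
    define c where "c = (\<rho> / 2) / (norm h + 1)"
    have c: "c > 0" using \<open>\<rho> > 0\<close> by (simp add: c_def add_nonneg_pos)
    have "norm (of_real c *s h) \<le> \<rho> / 2"
    proof -
      have "c * norm h \<le> c * (norm h + 1)" using c by simp
      also have "\<dots> = \<rho> / 2" unfolding c_def
        by (rule nonzero_eq_divide_eq[THEN iffD1, OF _ refl]) (smt (verit) norm_ge_zero)
      finally show ?thesis using c by (simp add: norm_vector_smult)
    qed
    from holomorphic_on_mult[OF holomorphic_on_const[of "1 / of_real c"] holD_small[OF this]]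
    show ?thesis
      by (rule holomorphic_transform) (use c D_in in \<open>simp add: Dsm\<close>)
  qed
  define L where "L h = deriv (\<lambda>t. ?D (z + t *s v) h) 0" for h
  have diff: "(\<lambda>t. ?D (z + t *s v) h) field_differentiable at 0" for h
    using holD \<open>\<tau> > 0\<close> holomorphic_on_imp_differentiable_at open_ball by (metis centre_in_ball)
  have L_cong: "deriv F 0 = deriv G 0" if "\<And>t. t \<in> ball (0::complex) \<tau> \<Longrightarrow> F t = G t" for F G :: "complex \<Rightarrow> complex"
  proof (rule deriv_cong_ev)
    show "\<forall>\<^sub>F x in nhds 0. F x = G x"
      using eventually_nhds_in_open[OF open_ball, of "0::complex" 0 \<tau>] \<open>\<tau> > 0\<close>
      by (auto elim!: eventually_mono intro: that)
  qed simp
  have L_smult: "L (c *s h) = c * L h" for c h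
  proof -
    have "L (c *s h) = deriv (\<lambda>t. c * ?D (z + t *s v) h) 0"
      unfolding L_def by (rule L_cong) (use D_in Dsm in auto)
    then show ?thesis using diff by (simp add: L_def)
  qed
  have L_add: "L (h + k) = L h + L k" for h k
  proof -
    have "L (h + k) = deriv (\<lambda>t. ?D (z + t *s v) h + ?D (z + t *s v) k) 0"
      unfolding L_def by (rule L_cong) (use D_in Dadd in auto)
    then show ?thesis using diff by (simp add: L_def)
  qed
  have L_bl: "bounded_linear L"
  proof (subst linear_conv_bounded_linear[symmetric], rule linearI)
    show "L (r *\<^sub>R h) = r *\<^sub>R L h" for r h
      using L_smult[of "of_real r" h] by (simp add: of_real_vector_smult scaleR_conv_of_real)
  qed (rule L_add)
  have main: "norm (?D (z + h) v - ?D z v - L h) \<le> (K * (norm h)\<^sup>2) / \<tau> * 2" if h: "norm h < \<rho> / 2" for h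
  proof -
    define E where "E t = f (z + t *s v + h) - f (z + t *s v + 0) - ?D (z + t *s v) h" for t
    have holE: "E holomorphic_on ball 0 \<tau>"
      unfolding E_def using h \<open>\<rho> > 0\<close> by (intro holomorphic_intros hol holD) auto
    have "norm (E t) \<le> K * (norm h)\<^sup>2" if "norm t \<le> \<tau>" for t
      unfolding E_def using rem[of "z + t *s v" h] line[OF that] h \<open>\<rho> > 0\<close> by simp
    then have "norm ((deriv ^^ 1) E 0) \<le> fact 1 * (K * (norm h)\<^sup>2) / (\<tau>/2) ^ 1"
      using holE \<open>\<tau> > 0\<close>
      by (intro Cauchy_inequality)
        (auto intro: holomorphic_on_subset intro!: holomorphic_on_imp_continuous_on simp: subset_iff)
    moreover have "deriv E 0 = ?D (z + h) v - ?D z v - L h"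
    proof -
      have z: "z + 0 \<in> S" "z + h \<in> S" using D_in[of 0] line_in[of 0 h] \<open>\<tau> > 0\<close> h \<open>\<rho> > 0\<close> by auto
      have der: "((\<lambda>t. f (z + t *s v + k)) has_field_derivative ?D (z + k) v) (at 0)" if "z + k \<in> S" for k
        using complex_diff_on_line_derivative[OF f, of "z + k" 0 v] that by (simp add: add_ac)
      then have "(E has_field_derivative (?D (z + h) v - ?D (z + 0) v - L h)) (at 0)"
        unfolding E_def L_def by (intro DERIV_diff der z DERIV_deriv_iff_field_differentiable[THEN iffD2] diff)
      then show ?thesis by (simp add: DERIV_imp_deriv)
    qed
    ultimately show ?thesis by (simp add: field_simps)
  qed
  have "((\<lambda>x. ?D x v) has_derivative L) (at z)"
  proof (rule has_derivativeI_sandwich[of "\<rho> / 2" _ _ _ _ "\<lambda>y. K / \<tau> * 2 * norm (y - z)"])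
    fix y assume y: "y \<noteq> z" "dist y z < \<rho> / 2"
    have "norm (?D y v - ?D z v - L (y - z)) \<le> (K * (norm (y - z))\<^sup>2) / \<tau> * 2"
      using main[of "y - z"] y(2) by (simp add: dist_norm)
    then show "norm (?D y v - ?D z v - L (y - z)) / norm (y - z) \<le> K / \<tau> * 2 * norm (y - z)"
      using y(1) by (simp add: divide_le_eq power2_eq_square mult_ac)
  next
    show "((\<lambda>y. K / \<tau> * 2 * norm (y - z)) \<longlongrightarrow> 0) (at z)"
      using \<open>\<tau> > 0\<close> by (auto intro!: tendsto_eq_intros)
  qed (use \<open>\<rho> > 0\<close> \<open>\<tau> > 0\<close> L_bl in auto)
  then show "\<exists>D. ((\<lambda>x. ?D x v) has_derivative D) (at z) \<and> (\<forall>c w. D (c *s w) = c * D w)"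
    using L_smult by blast
qed

section \<open>Closure properties of smooth functions and the Levi form\<close>

lemma has_derivative_cong_open:
  assumes "open S" "x \<in> S" "\<And>y. y \<in> S \<Longrightarrow> f y = g y"
  shows "(f has_derivative D) (at x) \<longleftrightarrow> (g has_derivative D) (at x)"
  using has_derivative_transform_within_open[OF _ assms(1,2)] assms(3) by metis

lemma frechet_derivative_cong_open:
  assumes "open S" "x \<in> S" "\<And>y. y \<in> S \<Longrightarrow> f y = g y"
  shows "frechet_derivative f (at x) = frechet_derivative g (at x)"
  unfolding frechet_derivative_def using has_derivative_cong_open[OF assms] by presburger

lemma differentiable_cong_open:
  assumes "open S" "x \<in> S" "\<And>y. y \<in> S \<Longrightarrow> f y = g y"
  shows "f differentiable (at x) \<longleftrightarrow> g differentiable (at x)"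
  unfolding differentiable_def using has_derivative_cong_open[OF assms] by simp

lemma Ck_on_cong:
  assumes "open S" "\<And>x. x \<in> S \<Longrightarrow> f x = g x"
  shows "Ck_on k f S \<longleftrightarrow> Ck_on k g S"
  using assms(2)
proof (induction k arbitrary: f g)
  case 0
  then show ?case by (simp cong: continuous_on_cong)
next
  case (Suc k)
  have "Ck_on k (\<lambda>x. frechet_derivative f (at x) v) S \<longleftrightarrow> Ck_on k (\<lambda>x. frechet_derivative g (at x) v) S" for v
    by (rule Suc.IH) (use frechet_derivative_cong_open[OF assms(1) _ Suc.prems] in simp)
  then show ?case
    using differentiable_cong_open[OF assms(1) _ Suc.prems] by simp
qed

lemma Ck_on_Suc_imp: "Ck_on (Suc k) f S \<Longrightarrow> Ck_on k f S"
proof (induction k arbitrary: f)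
  case 0
  then show ?case
    by (auto intro!: continuous_at_imp_continuous_on differentiable_imp_continuous_within)
qed auto

lemma Ck_on_const [simp]: "Ck_on k (\<lambda>x. c) S"
proof (induction k arbitrary: c)
  case (Suc k)
  have "frechet_derivative (\<lambda>x. c) (at x) v = 0" for x v :: 'a
    by (simp add: frechet_derivative_const)
  then show ?case using Suc by (simp del: frechet_derivative_const)
qed simp

lemma Ck_on_add:
  assumes "open S" shows "Ck_on k f S \<Longrightarrow> Ck_on k g S \<Longrightarrow> Ck_on k (\<lambda>x. f x + g x) S"
proof (induction k arbitrary: f g)
  case (Suc k)
  have d: "((\<lambda>x. f x + g x) has_derivative
      (\<lambda>v. frechet_derivative f (at x) v + frechet_derivative g (at x) v)) (at x)" if "x \<in> S" for x
    using Suc.prems that by (intro has_derivative_add) (auto simp: frechet_derivative_works[symmetric])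
  have e: "frechet_derivative (\<lambda>x. f x + g x) (at x) v =
      frechet_derivative f (at x) v + frechet_derivative g (at x) v" if "x \<in> S" for x v
    using frechet_derivative_at[OF d[OF that]] by metis
  have "Ck_on k (\<lambda>x. frechet_derivative (\<lambda>x. f x + g x) (at x) v) S" for v
    using Suc by (subst Ck_on_cong[OF assms e]) auto
  then show ?case using Suc.prems by auto
qed (auto intro: continuous_intros)

lemma Ck_on_bounded_linear:
  assumes "open S" and l: "bounded_linear l" shows "Ck_on k f S \<Longrightarrow> Ck_on k (\<lambda>x. l (f x)) S"
proof (induction k arbitrary: f)
  case 0
  then show ?case using bounded_linear.continuous_on[OF l] by simp
next
  case (Suc k)
  have d: "((\<lambda>x. l (f x)) has_derivative (\<lambda>v. l (frechet_derivative f (at x) v))) (at x)" if "x \<in> S" for x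
    using Suc.prems that
    by (intro bounded_linear.has_derivative[OF l]) (auto simp: frechet_derivative_works[symmetric])
  have e: "frechet_derivative (\<lambda>x. l (f x)) (at x) v = l (frechet_derivative f (at x) v)" if "x \<in> S" for x v
    using frechet_derivative_at[OF d[OF that]] by metis
  have "Ck_on k (\<lambda>x. frechet_derivative (\<lambda>x. l (f x)) (at x) v) S" for v
    using Suc by (subst Ck_on_cong[OF assms(1) e]) auto
  then show ?case using d by (auto simp: differentiable_def)
qed

lemma Ck_on_mult:
  fixes f g :: "'a::real_normed_vector \<Rightarrow> 'b::real_normed_algebra"
  assumes "open S" shows "Ck_on k f S \<Longrightarrow> Ck_on k g S \<Longrightarrow> Ck_on k (\<lambda>x. f x * g x) S"
proof (induction k arbitrary: f g)
  case (Suc k)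
  have d: "((\<lambda>x. f x * g x) has_derivative
      (\<lambda>v. f x * frechet_derivative g (at x) v + frechet_derivative f (at x) v * g x)) (at x)" if "x \<in> S" for x
    using Suc.prems that by (intro has_derivative_mult) (auto simp: frechet_derivative_works[symmetric])
  have e: "frechet_derivative (\<lambda>x. f x * g x) (at x) v =
      f x * frechet_derivative g (at x) v + frechet_derivative f (at x) v * g x" if "x \<in> S" for x v
    using frechet_derivative_at[OF d[OF that]] by metis
  have "Ck_on k (\<lambda>x. frechet_derivative (\<lambda>x. f x * g x) (at x) v) S" for v
    using Suc Ck_on_Suc_imp[OF Suc.prems(1)] Ck_on_Suc_imp[OF Suc.prems(2)]
    by (subst Ck_on_cong[OF assms e]) (auto intro!: Ck_on_add assms)
  then show ?case using d by (auto simp: differentiable_def)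
qed (auto intro: continuous_intros)

lemma Ck_on_sum:
  assumes "open S" "\<And>i. i \<in> I \<Longrightarrow> Ck_on k (f i) S"
  shows "Ck_on k (\<lambda>x. \<Sum>i\<in>I. f i x) S"
  using assms(2)
  by (induction I rule: infinite_finite_induct) (auto intro!: Ck_on_add assms(1))

lemma complex_diff_on_imp_smooth:
  assumes "open S" "complex_diff_on f S"
  shows "Ck_on k f S"
  using assms(2)
proof (induction k arbitrary: f)
  case 0
  then show ?case by (simp add: complex_diff_on_imp_continuous_on)
next
  case (Suc k)
  then show ?case
    using complex_diff_on_directional_derivative[OF Suc.prems assms(1)] complex_diff_on_frechet(1)[OF Suc.prems]
    by (auto simp: differentiable_def)
qed

lemma vector_real_basis_expansion:
  "(w::complex^'n) = (\<Sum>j\<in>UNIV. Re (w $ j) *\<^sub>R axis j 1 + Im (w $ j) *\<^sub>R axis j \<i>)"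
proof -
  have "(\<Sum>j\<in>UNIV. (Re (w $ j) *\<^sub>R axis j 1 + Im (w $ j) *\<^sub>R axis j \<i> :: complex^'n) $ i) = w $ i" for i
  proof -
    have "(Re (w $ j) *\<^sub>R axis j 1 + Im (w $ j) *\<^sub>R axis j \<i> :: complex^'n) $ i = (if j = i then w $ i else 0)" for j
      by (auto simp: axis_def complex_eq_iff)
    then show ?thesis by simp
  qed
  then show ?thesis by (simp add: vec_eq_iff)
qed

lemma linear_basis_expansion:
  fixes l :: "complex^'n \<Rightarrow> real"
  assumes "linear l"
  shows "l w = (\<Sum>j\<in>UNIV. Re (w $ j) * l (axis j 1) + Im (w $ j) * l (axis j \<i>))"
proof -
  have "l w = l (\<Sum>j\<in>UNIV. Re (w $ j) *\<^sub>R axis j 1 + Im (w $ j) *\<^sub>R axis j \<i>)"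
    by (subst vector_real_basis_expansion[of w]) (rule refl)
  then show ?thesis
    by (simp add: linear_sum[OF assms] linear_add[OF assms] linear_scale[OF assms])
qed

definition second_derivative :: "('a::real_normed_vector \<Rightarrow> real) \<Rightarrow> 'a \<Rightarrow> 'a \<Rightarrow> 'a \<Rightarrow> real" where
  "second_derivative u z v w = frechet_derivative (\<lambda>x. frechet_derivative u (at x) v) (at z) w"

lemma linear_second_derivative_right:
  assumes "(\<lambda>x. frechet_derivative u (at x) v) differentiable (at z)"
  shows "linear (second_derivative u z v)"
  unfolding second_derivative_def by (rule linear_frechet_derivative[OF assms])

lemma linear_second_derivative_left:
  assumes "open S" "z \<in> S" and u: "\<And>x. x \<in> S \<Longrightarrow> u differentiable (at x)"
    and u2: "\<And>v. (\<lambda>x. frechet_derivative u (at x) v) differentiable (at z)"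
  shows "linear (\<lambda>v. second_derivative u z v w)"
proof (rule linearI)
  have lin: "linear (frechet_derivative u (at x))" if "x \<in> S" for x
    by (rule linear_frechet_derivative[OF u[OF that]])
  have D: "((\<lambda>x. frechet_derivative u (at x) v) has_derivative second_derivative u z v) (at z)" for v
    unfolding second_derivative_def using u2 frechet_derivative_works by (metis (no_types, lifting) ext)
  show "second_derivative u z (v + v') w = second_derivative u z v w + second_derivative u z v' w" for v v'
  proof -
    have "((\<lambda>x. frechet_derivative u (at x) (v + v')) has_derivative
        (\<lambda>w. second_derivative u z v w + second_derivative u z v' w)) (at z)"
      by (subst has_derivative_cong_open[OF assms(1,2) linear_add[OF lin]]) (auto intro: has_derivative_add D)
    then show ?thesis using has_derivative_unique[OF D] by metis
  qed
  show "second_derivative u z (r *\<^sub>R v) w = r *\<^sub>R second_derivative u z v w" for r v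
  proof -
    have "((\<lambda>x. frechet_derivative u (at x) (r *\<^sub>R v)) has_derivative
        (\<lambda>w. r *\<^sub>R second_derivative u z v w)) (at z)"
      by (subst has_derivative_cong_open[OF assms(1,2) linear_scale[OF lin]])
        (auto intro: has_derivative_scaleR_right[OF D] simp del: real_scaleR_def)
    then show ?thesis using has_derivative_unique[OF D] by metis
  qed
qed

text \<open>Both sides are expanded in the real basis of the vectors \<open>axis j 1\<close> and \<open>axis j \<i>\<close>. The
  coefficients of the resulting double sums agree term by term.\<close>

theorem levi_form_second_derivative:
  fixes u :: "complex^'n \<Rightarrow> real"
  assumes "open S" "z \<in> S" and u: "\<And>x. x \<in> S \<Longrightarrow> u differentiable (at x)"
    and u2: "\<And>v. (\<lambda>x. frechet_derivative u (at x) v) differentiable (at z)"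
  shows "4 * Re (levi_form u z w) = second_derivative u z w w + second_derivative u z (\<i> *s w) (\<i> *s w)"
proof -
  let ?B = "second_derivative u z"
  let ?U = "\<lambda>z. complex_of_real (u z)"
  define e f :: "'n \<Rightarrow> complex^'n" where "e j = axis j 1" and "f j = axis j \<i>" for j
  have D: "((\<lambda>x. frechet_derivative u (at x) v) has_derivative ?B v) (at z)" for v
    unfolding second_derivative_def using u2 frechet_derivative_works by (metis (no_types, lifting) ext)
  have U: "frechet_derivative ?U (at x) v = complex_of_real (frechet_derivative u (at x) v)" if "x \<in> S" for x v
  proof -
    have "(?U has_derivative (\<lambda>v. complex_of_real (frechet_derivative u (at x) v))) (at x)"
      using u[OF that] frechet_derivative_works by (intro has_derivative_of_real) blast
    from frechet_derivative_at[OF this] show ?thesis by metis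
  qed
  have zbar: "d_zbar k ?U x = (of_real (frechet_derivative u (at x) (e k)) + \<i> * of_real (frechet_derivative u (at x) (f k))) / 2"
    if "x \<in> S" for x k
    by (simp add: d_zbar_def U[OF that] e_def f_def)
  have "(d_zbar k ?U has_derivative (\<lambda>h. (of_real (?B (e k) h) + \<i> * of_real (?B (f k) h)) / 2)) (at z)" for k
    by (subst has_derivative_cong_open[OF assms(1,2) zbar], assumption,
      intro bounded_linear.has_derivative[OF bounded_linear_divide] has_derivative_add
        has_derivative_mult_right has_derivative_of_real D)
  from frechet_derivative_at[OF this, symmetric]
  have dd: "d_z j (d_zbar k ?U) z = ((of_real (?B (e k) (e j)) + \<i> * of_real (?B (f k) (e j))) -
      \<i> * (of_real (?B (e k) (f j)) + \<i> * of_real (?B (f k) (f j)))) / 4" for j k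
    by (simp add: d_z_def e_def f_def diff_divide_distrib)
  have exp2: "?B v w = (\<Sum>k\<in>UNIV. \<Sum>j\<in>UNIV. Re (v $ k) * Re (w $ j) * ?B (e k) (e j) + Re (v $ k) * Im (w $ j) * ?B (e k) (f j)
      + Im (v $ k) * Re (w $ j) * ?B (f k) (e j) + Im (v $ k) * Im (w $ j) * ?B (f k) (f j))" for v w
  proof -
    have r: "?B v' w = (\<Sum>j\<in>UNIV. Re (w $ j) * ?B v' (e j) + Im (w $ j) * ?B v' (f j))" for v'
      unfolding e_def f_def by (rule linear_basis_expansion[OF linear_second_derivative_right[OF u2]])
    have "?B v w = (\<Sum>k\<in>UNIV. Re (v $ k) * ?B (e k) w + Im (v $ k) * ?B (f k) w)"
      unfolding e_def f_def by (rule linear_basis_expansion[OF linear_second_derivative_left[OF assms]])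
    also have "\<dots> = (\<Sum>k\<in>UNIV. \<Sum>j\<in>UNIV. Re (v $ k) * Re (w $ j) * ?B (e k) (e j) + Re (v $ k) * Im (w $ j) * ?B (e k) (f j)
      + Im (v $ k) * Re (w $ j) * ?B (f k) (e j) + Im (v $ k) * Im (w $ j) * ?B (f k) (f j))"
    proof (intro sum.cong refl)
      fix k
      show "Re (v $ k) * ?B (e k) w + Im (v $ k) * ?B (f k) w =
        (\<Sum>j\<in>UNIV. Re (v $ k) * Re (w $ j) * ?B (e k) (e j) + Re (v $ k) * Im (w $ j) * ?B (e k) (f j)
      + Im (v $ k) * Re (w $ j) * ?B (f k) (e j) + Im (v $ k) * Im (w $ j) * ?B (f k) (f j))"
        unfolding r[of "e k"] r[of "f k"] sum_distrib_left sum.distrib[symmetric]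
        by (intro sum.cong refl) (simp add: algebra_simps)
    qed
    finally show ?thesis .
  qed
  have "4 * Re (levi_form u z w) = (\<Sum>j\<in>UNIV. \<Sum>k\<in>UNIV. 4 * Re (d_z j (d_zbar k ?U) z * w $ j * cnj (w $ k)))"
    by (simp add: levi_form_def sum_distrib_left)
  also have "\<dots> = (\<Sum>k\<in>UNIV. \<Sum>j\<in>UNIV. 4 * Re (d_z j (d_zbar k ?U) z * w $ j * cnj (w $ k)))"
    by (rule sum.swap)
  also have "\<dots> = ?B w w + ?B (\<i> *s w) (\<i> *s w)"
    unfolding exp2[of w w] exp2[of "\<i> *s w" "\<i> *s w"] sum.distrib[symmetric]
    by (intro sum.cong refl) (simp add: dd field_simps)
  finally show ?thesis .
qed

section \<open>Pluriharmonic minorants of smooth strictly plurisubharmonic functions\<close>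

text \<open>Every real linear form is the real part of a complex linear one.\<close>

lemma linear_complexify:
  fixes l :: "complex^'n \<Rightarrow> real"
  assumes "linear l"
  shows "of_real (l (c *s h)) - \<i> * of_real (l (\<i> *s (c *s h))) = c * (complex_of_real (l h) - \<i> * of_real (l (\<i> *s h)))"
proof -
  have 1: "c *s h = Re c *\<^sub>R h + Im c *\<^sub>R (\<i> *s h)"
    by (simp add: vec_eq_iff complex_eq_iff)
  have 2: "\<i> *s (c *s h) = Re c *\<^sub>R (\<i> *s h) + (- Im c) *\<^sub>R h"
    by (simp add: vec_eq_iff complex_eq_iff)
  show ?thesis
    unfolding 2 unfolding 1 linear_add[OF assms] linear_scale[OF assms] by (simp add: complex_eq_iff algebra_simps)
qed

text \<open>The part \<open>s v w = b v w - b (\<i> v) (\<i> w)\<close> of a real bilinear form satisfies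
  \<open>s (\<i> v) w = s v (\<i> w)\<close>. Therefore \<open>s v w - \<i> s v (\<i> w)\<close> is complex bilinear, and on the diagonal
  it is a holomorphic quadratic polynomial with real part \<open>s h h\<close>.\<close>

lemma pluriharmonic_quadratic_eq_Re:
  fixes l :: "complex^'n \<Rightarrow> real" and b :: "complex^'n \<Rightarrow> complex^'n \<Rightarrow> real"
  assumes l: "linear l" and b: "bilinear b"
  obtains P where "complex_diff_on P UNIV" "P z = 0"
    "\<And>h. Re (P (z + h)) = l h + (b h h - b (\<i> *s h) (\<i> *s h)) / 4"
proof -
  define s where "s v w = b v w - b (\<i> *s v) (\<i> *s w)" for v w
  define \<sigma> where "\<sigma> v w = complex_of_real (s v w) - \<i> * of_real (s v (\<i> *s w))" for v w
  define \<Lambda> where "\<Lambda> h = complex_of_real (l h) - \<i> * of_real (l (\<i> *s h))" for h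
  have ii: "\<i> *s (\<i> *s v) = - v" for v :: "complex^'n" by (simp add: vec_eq_iff)
  have i_add: "\<i> *s (v + w) = \<i> *s v + \<i> *s w" and i_sc: "\<i> *s (r *\<^sub>R v) = r *\<^sub>R (\<i> *s v)"
    for v w :: "complex^'n" and r by (simp_all add: vec_eq_iff algebra_simps)
  note bil = bilinear_ladd[OF b] bilinear_radd[OF b] bilinear_lmul[OF b] bilinear_rmul[OF b]
    bilinear_lneg[OF b] bilinear_rneg[OF b]
  have s_right: "linear (s v)" and s_left: "linear (\<lambda>v. s v w)" for v w
    by (rule linearI; simp add: s_def bil i_add i_sc algebra_simps)+
  have s_ii: "s (\<i> *s v) w = s v (\<i> *s w)" for v w by (simp add: s_def ii bil)
  have bil_\<sigma>: "bounded_bilinear \<sigma>"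
    unfolding bilinear_conv_bounded_bilinear[symmetric] bilinear_def
    by (intro conjI allI linearI; simp add: \<sigma>_def i_add i_sc linear_add[OF s_right] linear_add[OF s_left]
        linear_scale[OF s_right] linear_scale[OF s_left]  algebra_simps; simp add: scaleR_conv_of_real algebra_simps)
  have \<sigma>_right: "\<sigma> v (c *s w) = c * \<sigma> v w" for v w c
    unfolding \<sigma>_def by (rule linear_complexify[OF s_right])
  have \<sigma>_left: "\<sigma> (c *s v) w = c * \<sigma> v w" for v w c
    using linear_complexify[OF s_left, of c v w] by (simp add: \<sigma>_def s_ii[symmetric])
  have \<Lambda>_mul: "\<Lambda> (c *s h) = c * \<Lambda> h" for c h
    unfolding \<Lambda>_def by (rule linear_complexify[OF l])
  have \<Lambda>_bl: "bounded_linear \<Lambda>"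
    unfolding linear_conv_bounded_linear[symmetric]
    by (intro linearI; simp add: \<Lambda>_def i_add i_sc linear_add[OF l] linear_scale[OF l] algebra_simps;
        simp add: scaleR_conv_of_real algebra_simps)
  define P where "P x = \<Lambda> (x - z) + \<sigma> (x - z) (x - z) / 4" for x
  show ?thesis
  proof
    show "complex_diff_on P UNIV"
      unfolding complex_diff_on_def
    proof
      fix x
      have "(P has_derivative (\<lambda>h. \<Lambda> h + (\<sigma> (x - z) h + \<sigma> h (x - z)) / 4)) (at x)"
        unfolding P_def
        by (rule derivative_eq_intros bounded_linear.has_derivative[OF \<Lambda>_bl] bounded_bilinear.FDERIV[OF bil_\<sigma>]
            bounded_linear.has_derivative[OF bounded_linear_divide] refl | simp)+
      then show "\<exists>D. (P has_derivative D) (at x) \<and> (\<forall>c w. D (c *s w) = c * D w)"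
        by (intro exI conjI, assumption) (simp add: \<sigma>_left \<sigma>_right \<Lambda>_mul algebra_simps add_divide_distrib)
    qed
    show "P z = 0"
      using bounded_bilinear.zero_left[OF bil_\<sigma>] linear_0[OF bounded_linear.linear[OF \<Lambda>_bl]] by (simp add: P_def)
    show "Re (P (z + h)) = l h + (b h h - b (\<i> *s h) (\<i> *s h)) / 4" for h
      by (simp add: P_def \<Lambda>_def \<sigma>_def s_def)
  qed
qed

lemma linear_Basis_expansion:
  fixes l :: "'a::euclidean_space \<Rightarrow> real"
  assumes "linear l" shows "l h = (\<Sum>i\<in>Basis. (h \<bullet> i) * l i)"
proof -
  have "l h = l (\<Sum>i\<in>Basis. (h \<bullet> i) *\<^sub>R i)" by (simp add: euclidean_representation)
  then show ?thesis by (simp only: linear_sum[OF assms] linear_scale[OF assms] real_scaleR_def)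
qed

lemma second_derivative_uniformly_close:
  fixes u :: "'a::euclidean_space \<Rightarrow> real"
  assumes "open S" "z \<in> S" and lin: "\<And>x v. x \<in> S \<Longrightarrow> linear (second_derivative u x v)" "\<And>x w. x \<in> S \<Longrightarrow> linear (\<lambda>v. second_derivative u x v w)"
    and cont: "\<And>v w. continuous_on S (\<lambda>x. second_derivative u x v w)" and "0 < \<eta>"
  shows "\<forall>\<^sub>F x in nhds z. \<forall>h. \<bar>second_derivative u x h h - second_derivative u z h h\<bar> \<le> \<eta> * (norm h)\<^sup>2"
proof -
  let ?N = "real (card (Basis :: 'a set))"
  define \<delta> where "\<delta> = \<eta> / (?N * ?N)"
  have N: "?N > 0" by simp
  then have "\<delta> > 0" using \<open>0 < \<eta>\<close> by (simp add: \<delta>_def)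
  let ?d = "\<lambda>x i j. second_derivative u x i j - second_derivative u z i j"
  have "\<forall>\<^sub>F x in nhds z. \<forall>i\<in>Basis. \<forall>j\<in>Basis. \<bar>?d x i j\<bar> < \<delta>"
  proof (intro eventually_ball_finite ballI finite_Basis)
    fix i j :: 'a
    have "isCont (\<lambda>x. second_derivative u x i j) z"
      using cont assms(1,2) continuous_on_eq_continuous_at by blast
    then have "((\<lambda>x. second_derivative u x i j) \<longlongrightarrow> second_derivative u z i j) (nhds z)"
      using tendsto_at_iff_tendsto_nhds[of "\<lambda>x. second_derivative u x i j" z] by (simp add: isCont_def)
    from tendstoD[OF this \<open>\<delta> > 0\<close>] show "\<forall>\<^sub>F x in nhds z. \<bar>?d x i j\<bar> < \<delta>"
      by (simp add: dist_real_def)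
  qed
  moreover have "\<forall>\<^sub>F x in nhds z. x \<in> S" using assms(1,2) by (rule eventually_nhds_in_open)
  ultimately show ?thesis
  proof eventually_elim
    case (elim x)
    have exp: "second_derivative u y h h = (\<Sum>i\<in>Basis. \<Sum>j\<in>Basis. (h \<bullet> i) * ((h \<bullet> j) * second_derivative u y i j))" if "y \<in> S" for y h
    proof -
      have "second_derivative u y h h = (\<Sum>i\<in>Basis. (h \<bullet> i) * second_derivative u y i h)"
        by (rule linear_Basis_expansion[OF lin(2)[OF that]])
      also have "\<dots> = (\<Sum>i\<in>Basis. (h \<bullet> i) * (\<Sum>j\<in>Basis. (h \<bullet> j) * second_derivative u y i j))"
        by (intro sum.cong refl arg_cong2[where f="(*)"] linear_Basis_expansion[OF lin(1)[OF that]])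
      finally show ?thesis by (simp add: sum_distrib_left)
    qed
    show ?case
    proof
      fix h
      have "second_derivative u x h h - second_derivative u z h h = (\<Sum>i\<in>Basis. \<Sum>j\<in>Basis. (h \<bullet> i) * ((h \<bullet> j) * ?d x i j))"
        unfolding exp[OF elim(2)] exp[OF assms(2)] sum_subtractf[symmetric]
        by (intro sum.cong refl) (simp add: algebra_simps)
      also have "\<bar>\<dots>\<bar> \<le> (\<Sum>i\<in>(Basis::'a set). \<Sum>j\<in>(Basis::'a set). norm h * (norm h * \<delta>))"
      proof (rule order_trans[OF sum_abs], rule sum_mono, rule order_trans[OF sum_abs], rule sum_mono)
        fix i j :: 'a assume ij: "i \<in> Basis" "j \<in> Basis"
        show "\<bar>(h \<bullet> i) * ((h \<bullet> j) * ?d x i j)\<bar> \<le> norm h * (norm h * \<delta>)"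
          unfolding abs_mult using ij elim(1) Basis_le_norm
          by (intro mult_mono) (auto simp: less_imp_le)
      qed
      also have "\<dots> = \<eta> * (norm h)\<^sup>2" using N by (simp add: \<delta>_def power2_eq_square)
      finally show "\<bar>second_derivative u x h h - second_derivative u z h h\<bar> \<le> \<eta> * (norm h)\<^sup>2" .
    qed
  qed
qed

text \<open>Write \<open>B\<close> for the second derivative at \<open>z\<close>. The quadratic term \<open>B h h / 2\<close> of the Taylor
  expansion is the sum of \<open>(B h h - B (\<i> h) (\<i> h)) / 4\<close>, which is the real part of a holomorphic
  polynomial, and of \<open>(B h h + B (\<i> h) (\<i> h)) / 4\<close>, which is the Levi form and hence at least a
  multiple of \<open>|h|\<^sup>2\<close>. The continuity of the second derivative takes care of the remainder.\<close>

theorem strictly_psh_pluriharmonic_minorant: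
  fixes u :: "complex^'n \<Rightarrow> real"
  assumes "open S" "z \<in> S" and smooth: "smooth_on u S" and levi: "\<And>w. w \<noteq> 0 \<Longrightarrow> 0 < Re (levi_form u z w)"
  obtains P \<epsilon> r where "complex_diff_on P UNIV" "P z = 0" "\<epsilon> > 0" "r > 0" "ball z r \<subseteq> S"
    "\<forall>h. norm h < r \<longrightarrow> u z + Re (P (z + h)) + \<epsilon> * (norm h)\<^sup>2 \<le> u (z + h)"
proof -
  let ?B = "second_derivative u"
  have "Ck_on (Suc (Suc 0)) u S" using smooth unfolding smooth_on_def by blast
  then have u1: "\<And>x. x \<in> S \<Longrightarrow> u differentiable (at x)"
    and u2: "\<And>x v. x \<in> S \<Longrightarrow> (\<lambda>x. frechet_derivative u (at x) v) differentiable (at x)"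
    and cont: "\<And>v w. continuous_on S (\<lambda>x. ?B x v w)"
    by (auto simp: second_derivative_def)
  have lin: "linear (?B x v)" "linear (\<lambda>v. ?B x v w)" if "x \<in> S" for x v w
    using linear_second_derivative_right[OF u2[OF that]] linear_second_derivative_left[OF assms(1) that u1 u2[OF that]] by auto
  have bil: "bilinear (?B z)" using lin[OF \<open>z \<in> S\<close>] by (simp add: bilinear_def)
  define Q where "Q h = ?B z h h + ?B z (\<i> *s h) (\<i> *s h)" for h
  have Q_levi: "Q h = 4 * Re (levi_form u z h)" for h
    unfolding Q_def by (rule levi_form_second_derivative[OF assms(1,2) u1 u2[OF assms(2)], symmetric])
  have "continuous_on (sphere 0 1) Q"
    unfolding Q_levi levi_form_def by (intro continuous_intros)
  moreover have "sphere 0 1 \<noteq> ({} :: (complex^'n) set)" by simp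
  ultimately obtain h0 where h0: "h0 \<in> sphere 0 1" "\<And>h. h \<in> sphere 0 1 \<Longrightarrow> Q h0 \<le> Q h"
    using continuous_attains_inf[OF compact_sphere] by metis
  define m where "m = Q h0"
  have "h0 \<noteq> 0" using h0(1) by auto
  then have "m > 0" using levi[of h0] by (simp add: m_def Q_levi)
  have Q: "m * (norm h)\<^sup>2 \<le> Q h" for h
  proof (cases "h = 0")
    case True
    then show ?thesis by (simp add: Q_levi levi_form_def)
  next
    case False
    have i_sc: "\<i> *s (r *\<^sub>R v) = r *\<^sub>R (\<i> *s v)" for v :: "complex^'n" and r by (simp add: vec_eq_iff)
    have "Q ((1 / norm h) *\<^sub>R h) = Q h / (norm h)\<^sup>2"
      unfolding Q_def i_sc bilinear_lmul[OF bil] bilinear_rmul[OF bil]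
      by (simp add: power2_eq_square add_divide_distrib)
    moreover have "m \<le> Q ((1 / norm h) *\<^sub>R h)" unfolding m_def by (rule h0(2)) (use False in simp)
    ultimately show ?thesis using False by (simp add: pos_le_divide_eq)
  qed
  have "\<forall>\<^sub>F x in nhds z. \<forall>h. \<bar>?B x h h - ?B z h h\<bar> \<le> (m/4) * (norm h)\<^sup>2"
    by (rule second_derivative_uniformly_close[OF assms(1,2) lin cont]) (use \<open>m > 0\<close> in auto)
  then obtain r1 where r1: "r1 > 0" "\<And>x h. dist x z < r1 \<Longrightarrow> \<bar>?B x h h - ?B z h h\<bar> \<le> (m/4) * (norm h)\<^sup>2"
    unfolding eventually_nhds_metric by blast
  obtain r2 where r2: "r2 > 0" "ball z r2 \<subseteq> S" using assms(1,2) openE by blast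
  define r where "r = min r1 r2"
  have r: "r > 0" "ball z r \<subseteq> S" using r1 r2 by (auto simp: r_def)
  obtain P where P: "complex_diff_on P UNIV" "P z = 0"
    "\<And>h. Re (P (z + h)) = frechet_derivative u (at z) h + (?B z h h - ?B z (\<i> *s h) (\<i> *s h)) / 4"
    using pluriharmonic_quadratic_eq_Re[OF linear_frechet_derivative[OF u1[OF assms(2)]] bil] by metis
  have "u z + Re (P (z + h)) + (m/8) * (norm h)\<^sup>2 \<le> u (z + h)" if h: "norm h < r" for h
  proof -
    have seg: "dist (z + t *\<^sub>R h) z < r" if "0 \<le> t" "t \<le> 1" for t
    proof -
      have "t * norm h \<le> norm h" using that by (simp add: mult_left_le_one_le)
      then show ?thesis using h that by (simp add: dist_norm)
    qed
    have segS: "z + t *\<^sub>R h \<in> S" if "0 \<le> t" "t \<le> 1" for t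
      using seg[OF that] r(2) by (auto simp: dist_commute)
    \<comment> \<open>The derivatives of \<open>t \<mapsto> u (z + t h)\<close>, in the form required by the Maclaurin formula.\<close>
    define g where "g m t = (if m = (0::nat) then u (z + t *\<^sub>R h)
      else if m = 1 then frechet_derivative u (at (z + t *\<^sub>R h)) h else ?B (z + t *\<^sub>R h) h h)" for m t
    have line: "((\<lambda>t. z + t *\<^sub>R h) has_derivative (\<lambda>s. s *\<^sub>R h)) (at t)" for t
      by (auto intro!: derivative_eq_intros)
    have d0: "DERIV (g 0) t :> g 1 t" if "0 \<le> t" "t \<le> 1" for t
    proof -
      have "((\<lambda>t. u (z + t *\<^sub>R h)) has_derivative (\<lambda>s. frechet_derivative u (at (z + t *\<^sub>R h)) (s *\<^sub>R h))) (at t)"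
        using has_derivative_compose[OF line] u1[OF segS[OF that]] frechet_derivative_works by blast
      then show ?thesis
        using linear_scale[OF linear_frechet_derivative[OF u1[OF segS[OF that]]]]
        by (simp add: has_field_derivative_def g_def[abs_def] mult_commute_abs)
    qed
    have d1: "DERIV (g 1) t :> g 2 t" if "0 \<le> t" "t \<le> 1" for t
    proof -
      have "((\<lambda>x. frechet_derivative u (at x) h) has_derivative ?B (z + t *\<^sub>R h) h) (at (z + t *\<^sub>R h))"
        unfolding second_derivative_def
        using u2[OF segS[OF that]] frechet_derivative_works by (metis (no_types, lifting) ext)
      from has_derivative_compose[OF line this]
      have "((\<lambda>t. frechet_derivative u (at (z + t *\<^sub>R h)) h) has_derivative (\<lambda>s. ?B (z + t *\<^sub>R h) h (s *\<^sub>R h))) (at t)" .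
      then show ?thesis
        using linear_scale[OF lin(1)[OF segS[OF that]]]
        by (simp add: has_field_derivative_def g_def[abs_def] mult_commute_abs)
    qed
    have "\<forall>m t. m < 2 \<and> 0 \<le> t \<and> t \<le> 1 \<longrightarrow> DERIV (g m) t :> g (Suc m) t"
      using d0 d1 by (auto simp: numeral_2_eq_2 less_Suc_eq)
    then obtain t where t: "0 < t" "t < 1" "g 0 1 = (\<Sum>m<2. g m 0 / fact m * 1 ^ m) + g 2 t / fact 2 * 1 ^ 2"
      using Maclaurin[of 1 2 g "g 0"] by auto
    then have eq: "u (z + h) = u z + frechet_derivative u (at z) h + ?B (z + t *\<^sub>R h) h h / 2"
      by (simp add: g_def numeral_2_eq_2)
    have "\<bar>?B (z + t *\<^sub>R h) h h - ?B z h h\<bar> \<le> (m/4) * (norm h)\<^sup>2"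
      using r1(2) seg[of t] t by (simp add: r_def)
    then have "?B (z + t *\<^sub>R h) h h \<ge> ?B z h h - (m/4) * (norm h)\<^sup>2" by linarith
    moreover have "?B z h h = (?B z h h - ?B z (\<i> *s h) (\<i> *s h)) / 2 + Q h / 2" by (simp add: Q_def field_simps)
    moreover note Q[of h]
    ultimately show ?thesis unfolding eq P(3) by (simp add: field_simps)
  qed
  then show ?thesis using that[OF P(1,2) _ r, of "m/8"] \<open>m > 0\<close> by simp
qed

section \<open>Charts of a complex manifold\<close>

lemma complex_diff_on_compose_holomorphic_map:
  assumes P: "complex_diff_on P Q" and T: "holomorphic_map_on T S" and sub: "T ` S \<subseteq> Q"
  shows "complex_diff_on (\<lambda>z. P (T z)) S"
  unfolding complex_diff_on_def
proof
  fix z assume z: "z \<in> S"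
  obtain D where D: "(T has_derivative D) (at z)" "\<And>c w. D (c *s w) = c *s D w"
    using T z by (auto simp: holomorphic_map_on_def)
  have "T z \<in> Q" using sub z by auto
  from has_derivative_compose[OF D(1) complex_diff_on_frechet(1)[OF P this]]
  show "\<exists>D. ((\<lambda>z. P (T z)) has_derivative D) (at z) \<and> (\<forall>c w. D (c *s w) = c * D w)"
    using D(2) complex_diff_on_frechet(2)[OF P \<open>T z \<in> Q\<close>] by auto
qed

lemma holomorphic_map_on_subset: "holomorphic_map_on f S \<Longrightarrow> T \<subseteq> S \<Longrightarrow> holomorphic_map_on f T"
  by (auto simp: holomorphic_map_on_def)

lemma holomorphic_map_on_cong_open:
  assumes "open S" "\<And>z. z \<in> S \<Longrightarrow> f z = g z" "holomorphic_map_on g S"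
  shows "holomorphic_map_on f S"
  using assms(3) has_derivative_cong_open[OF assms(1) _ assms(2)] unfolding holomorphic_map_on_def by simp

lemma holomorphic_map_on_compose:
  assumes "holomorphic_map_on f S" "holomorphic_map_on g T" "f ` S \<subseteq> T"
  shows "holomorphic_map_on (\<lambda>z. g (f z)) S"
  unfolding holomorphic_map_on_def
proof
  fix z assume z: "z \<in> S"
  obtain D where D: "(f has_derivative D) (at z)" "\<And>c w. D (c *s w) = c *s D w"
    using assms(1) z by (auto simp: holomorphic_map_on_def)
  have "f z \<in> T" using z assms(3) by auto
  then obtain E where E: "(g has_derivative E) (at (f z))" "\<And>c w. E (c *s w) = c *s E w"
    using assms(2) by (auto simp: holomorphic_map_on_def)
  show "\<exists>D. ((\<lambda>z. g (f z)) has_derivative D) (at z) \<and> (\<forall>c w. D (c *s w) = c *s D w)"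
    using has_derivative_compose[OF D(1) E(1)] D(2) E(2) by auto
qed

locale complex_mfd =
  fixes M :: "'a::{t2_space, second_countable_topology} set" and A :: "('a, 'n::finite) chart set"
  assumes mfd: "complex_manifold M A"
begin

abbreviation charts where "charts \<equiv> holomorphic_charts M A"

lemma atlas_subset_charts: "A \<subseteq> charts"
  using mfd by (auto simp: complex_manifold_def holomorphic_charts_def)

lemma chart_at:
  assumes "p \<in> M" obtains U \<phi> where "(U, \<phi>) \<in> A" "p \<in> U"
  using mfd assms unfolding complex_manifold_def by fastforce

lemma chartD:
  assumes "(U, \<phi>) \<in> charts"
  shows "open U" "U \<subseteq> M" "open (\<phi> ` U)" "inj_on \<phi> U" "continuous_on U \<phi>" "continuous_on (\<phi> ` U) (inv_into U \<phi>)"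
proof -
  obtain \<psi> where c: "open U" "U \<subseteq> M" "open (\<phi> ` U)" and h: "homeomorphism U (\<phi> ` U) \<phi> \<psi>"
    using assms by (auto simp: holomorphic_charts_def is_chart_def)
  show "open U" "U \<subseteq> M" "open (\<phi> ` U)" by fact+
  show inj: "inj_on \<phi> U" using h by (metis homeomorphism_def inj_on_inverseI)
  show "continuous_on U \<phi>" using h by (simp add: homeomorphism_def)
  have "continuous_on (\<phi> ` U) \<psi>" using h by (simp add: homeomorphism_def)
  moreover have "\<psi> z = inv_into U \<phi> z" if "z \<in> \<phi> ` U" for z
    using that h inj by (auto simp: homeomorphism_def)
  ultimately show "continuous_on (\<phi> ` U) (inv_into U \<phi>)" by (rule continuous_on_eq)
qed

lemma open_M: "open M"
proof -
  have "M = (\<Union>c\<in>A. fst c)" using mfd by (simp add: complex_manifold_def)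
  moreover have "open (fst c)" if "c \<in> A" for c
    using chartD(1)[of "fst c" "snd c"] atlas_subset_charts that by auto
  ultimately show ?thesis by auto
qed

lemma chart_inverse:
  assumes "(U, \<phi>) \<in> charts"
  shows "x \<in> U \<Longrightarrow> inv_into U \<phi> (\<phi> x) = x" "z \<in> \<phi> ` U \<Longrightarrow> \<phi> (inv_into U \<phi> z) = z" "z \<in> \<phi> ` U \<Longrightarrow> inv_into U \<phi> z \<in> U"
  using chartD(4)[OF assms] by (auto simp: f_inv_into_f)

lemma open_chart_image:
  assumes c: "(U, \<phi>) \<in> charts" and "open N"
  shows "open (\<phi> ` (U \<inter> N))"
proof -
  have "open (inv_into U \<phi> -` N \<inter> \<phi> ` U)"
    using chartD[OF c] \<open>open N\<close> continuous_on_open_vimage by blast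
  moreover have "inv_into U \<phi> -` N \<inter> \<phi> ` U = \<phi> ` (U \<inter> N)"
    using chart_inverse[OF c] by force
  ultimately show ?thesis by simp
qed

lemma open_chart_preimage:
  assumes c: "(U, \<phi>) \<in> charts" and "open W"
  shows "open {x \<in> U. \<phi> x \<in> W}"
proof -
  have "open (\<phi> -` W \<inter> U)"
    using chartD[OF c] \<open>open W\<close> continuous_on_open_vimage by blast
  moreover have "\<phi> -` W \<inter> U = {x \<in> U. \<phi> x \<in> W}" by auto
  ultimately show ?thesis by simp
qed

lemma compact_chart_preimage:
  assumes c: "(U, \<phi>) \<in> charts" and "compact K" "K \<subseteq> \<phi> ` U"
  shows "compact {x \<in> U. \<phi> x \<in> K}"
proof -
  have "compact (inv_into U \<phi> ` K)"
    using chartD(6)[OF c] assms(2,3) compact_continuous_image continuous_on_subset by blast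
  moreover have "inv_into U \<phi> ` K = {x \<in> U. \<phi> x \<in> K}"
  proof (intro set_eqI iffI)
    fix x assume "x \<in> inv_into U \<phi> ` K"
    then show "x \<in> {x \<in> U. \<phi> x \<in> K}" using chart_inverse[OF c] assms(3) by auto
  next
    fix x assume "x \<in> {x \<in> U. \<phi> x \<in> K}"
    then show "x \<in> inv_into U \<phi> ` K" using chart_inverse(1)[OF c, of x] by (auto intro!: image_eqI[of _ _ "\<phi> x"])
  qed
  ultimately show ?thesis by simp
qed

text \<open>Two charts of the maximal atlas are by definition only compatible with the charts of \<open>A\<close>; near
  each point the transition map factors through one of these.\<close>

theorem transition_holomorphic:
  assumes c: "(U, \<phi>) \<in> charts" and d: "(V, \<psi>) \<in> charts"
  shows "holomorphic_map_on (\<lambda>z. \<psi> (inv_into U \<phi> z)) (\<phi> ` (U \<inter> V))"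
proof -
  have "\<exists>D. ((\<lambda>z. \<psi> (inv_into U \<phi> z)) has_derivative D) (at z) \<and> (\<forall>c w. D (c *s w) = c *s D w)"
    if z: "z \<in> \<phi> ` (U \<inter> V)" for z
  proof -
    obtain p where p: "p \<in> U" "p \<in> V" "z = \<phi> p" using z by auto
    then obtain W \<alpha> where a: "(W, \<alpha>) \<in> A" "p \<in> W" using chart_at chartD(2)[OF c] by blast
    have aC: "(W, \<alpha>) \<in> charts" using a atlas_subset_charts by auto
    have h1: "holomorphic_map_on (\<lambda>z. \<alpha> (inv_into U \<phi> z)) (\<phi> ` (U \<inter> W))"
      and h2: "holomorphic_map_on (\<lambda>z. \<psi> (inv_into W \<alpha> z)) (\<alpha> ` (V \<inter> W))"
      using c d a(1) by (auto simp: holomorphic_charts_def compatible_def comp_def)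
    let ?S = "\<phi> ` (U \<inter> (V \<inter> W))"
    have S: "open ?S" using open_chart_image[OF c] chartD(1)[OF d] chartD(1)[OF aC] by auto
    have "holomorphic_map_on (\<lambda>z. \<psi> (inv_into W \<alpha> (\<alpha> (inv_into U \<phi> z)))) ?S"
    proof (rule holomorphic_map_on_compose[OF holomorphic_map_on_subset[OF h1] h2])
      show "(\<lambda>z. \<alpha> (inv_into U \<phi> z)) ` ?S \<subseteq> \<alpha> ` (V \<inter> W)"
        using chart_inverse(1)[OF c] by auto
    qed auto
    then have "holomorphic_map_on (\<lambda>z. \<psi> (inv_into U \<phi> z)) ?S"
      by (rule holomorphic_map_on_cong_open[OF S, rotated]) (use chart_inverse(1)[OF c] chart_inverse(1)[OF aC] in auto)
    moreover have "z \<in> ?S" using p a by auto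
    ultimately show ?thesis by (auto simp: holomorphic_map_on_def)
  qed
  then show ?thesis by (auto simp: holomorphic_map_on_def)
qed

section \<open>The local sub-mean value property on a manifold\<close>

lemma chart_slice:
  assumes c: "(U, \<phi>) \<in> charts" and "p \<in> U" "open N" "p \<in> N"
  obtains d where "d > 0" "\<And>\<zeta>. \<zeta> \<in> ball 0 d \<Longrightarrow> \<phi> p + \<zeta> *s b \<in> \<phi> ` (U \<inter> N)"
    "\<And>\<zeta>. \<zeta> \<in> ball 0 d \<Longrightarrow> inv_into U \<phi> (\<phi> p + \<zeta> *s b) \<in> U \<inter> N"
    "continuous_on (ball 0 d) (\<lambda>\<zeta>. inv_into U \<phi> (\<phi> p + \<zeta> *s b))"
proof -
  have "open ((\<lambda>\<zeta>. \<phi> p + \<zeta> *s b) -` (\<phi> ` (U \<inter> N)))"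
    by (rule open_vimage[OF open_chart_image[OF c \<open>open N\<close>] continuous_on_complex_line])
  moreover have "0 \<in> (\<lambda>\<zeta>. \<phi> p + \<zeta> *s b) -` (\<phi> ` (U \<inter> N))" using assms by simp
  ultimately obtain d where d: "d > 0" "ball 0 d \<subseteq> (\<lambda>\<zeta>. \<phi> p + \<zeta> *s b) -` (\<phi> ` (U \<inter> N))"
    using openE by blast
  have i: "\<phi> p + \<zeta> *s b \<in> \<phi> ` (U \<inter> N)" if "\<zeta> \<in> ball 0 d" for \<zeta> using d that by auto
  have "inv_into U \<phi> (\<phi> p + \<zeta> *s b) \<in> U \<inter> N" if "\<zeta> \<in> ball 0 d" for \<zeta>
    using i[OF that] chart_inverse(1)[OF c] by auto
  moreover have "continuous_on (ball 0 d) (\<lambda>\<zeta>. inv_into U \<phi> (\<phi> p + \<zeta> *s b))"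
    by (rule continuous_on_compose2[OF chartD(6)[OF c] continuous_on_complex_line]) (use i in blast)
  ultimately show ?thesis using that d(1) i by blast
qed

text \<open>The range of admissible radii may depend on the chart and on the direction.\<close>

definition locally_submean :: "('a \<Rightarrow> real) \<Rightarrow> 'a \<Rightarrow> bool" where
  "locally_submean g p \<longleftrightarrow> (\<forall>(U, \<phi>)\<in>charts. p \<in> U \<longrightarrow>
    (\<forall>b. \<forall>\<^sub>F r in at_right 0. g p \<le> cmean (\<lambda>\<zeta>. g (inv_into U \<phi> (\<phi> p + \<zeta> *s b))) 0 r))"

text \<open>The radii tend to \<open>0\<close>, so the discs may be assumed to be mapped into any given neighbourhood
  \<open>N\<close> of \<open>p\<close>. The converse direction \<open>locally_submeanD\<close> also transports continuity on \<open>N\<close> to the circles.\<close>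

lemma locally_submeanI:
  assumes "open N" "p \<in> N"
    "\<And>U \<phi> b d r. \<lbrakk>(U, \<phi>) \<in> charts; p \<in> U; 0 < r; r < d;
      \<And>\<zeta>. \<zeta> \<in> ball 0 d \<Longrightarrow> \<phi> p + \<zeta> *s b \<in> \<phi> ` (U \<inter> N);
      \<And>\<zeta>. \<zeta> \<in> ball 0 d \<Longrightarrow> inv_into U \<phi> (\<phi> p + \<zeta> *s b) \<in> U \<inter> N;
      continuous_on (ball 0 d) (\<lambda>\<zeta>. inv_into U \<phi> (\<phi> p + \<zeta> *s b))\<rbrakk>
      \<Longrightarrow> g p \<le> cmean (\<lambda>\<zeta>. g (inv_into U \<phi> (\<phi> p + \<zeta> *s b))) 0 r"
  shows "locally_submean g p"
  unfolding locally_submean_def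
proof (clarify)
  fix U \<phi> b assume c: "(U, \<phi>) \<in> charts" "p \<in> U"
  obtain d where d: "d > 0" "\<And>\<zeta>. \<zeta> \<in> ball 0 d \<Longrightarrow> \<phi> p + \<zeta> *s b \<in> \<phi> ` (U \<inter> N)"
    "\<And>\<zeta>. \<zeta> \<in> ball 0 d \<Longrightarrow> inv_into U \<phi> (\<phi> p + \<zeta> *s b) \<in> U \<inter> N"
    "continuous_on (ball 0 d) (\<lambda>\<zeta>. inv_into U \<phi> (\<phi> p + \<zeta> *s b))"
    using chart_slice[OF c assms(1,2)] by metis
  have "\<forall>\<^sub>F r in at_right 0. 0 < r \<and> r < d"
    using d(1) by (auto simp: eventually_at_right_field)
  then show "\<forall>\<^sub>F r in at_right 0. g p \<le> cmean (\<lambda>\<zeta>. g (inv_into U \<phi> (\<phi> p + \<zeta> *s b))) 0 r"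
    by eventually_elim (use assms(3)[OF c _ _ d(2-4)] in blast)
qed

lemma locally_submeanD:
  assumes g: "locally_submean g p" and c: "(U, \<phi>) \<in> charts" "p \<in> U" and N: "open N" "p \<in> N"
  shows "\<forall>\<^sub>F r in at_right 0. 0 < r \<and> g p \<le> cmean (\<lambda>\<zeta>. g (inv_into U \<phi> (\<phi> p + \<zeta> *s b))) 0 r \<and>
    (\<forall>\<zeta>\<in>sphere 0 r. inv_into U \<phi> (\<phi> p + \<zeta> *s b) \<in> U \<inter> N) \<and>
    (\<forall>f :: 'a \<Rightarrow> real. continuous_on N f \<longrightarrow> continuous_on (sphere 0 r) (\<lambda>\<zeta>. f (inv_into U \<phi> (\<phi> p + \<zeta> *s b))))"
proof -
  obtain d where d: "d > 0" "\<And>\<zeta>. \<zeta> \<in> ball 0 d \<Longrightarrow> inv_into U \<phi> (\<phi> p + \<zeta> *s b) \<in> U \<inter> N"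
    "continuous_on (ball 0 d) (\<lambda>\<zeta>. inv_into U \<phi> (\<phi> p + \<zeta> *s b))"
    using chart_slice[OF c N] by metis
  have "\<forall>\<^sub>F r in at_right 0. 0 < r \<and> r < d"
    using d(1) by (auto simp: eventually_at_right_field)
  moreover have "\<forall>\<^sub>F r in at_right 0. g p \<le> cmean (\<lambda>\<zeta>. g (inv_into U \<phi> (\<phi> p + \<zeta> *s b))) 0 r"
    using g c by (auto simp: locally_submean_def)
  ultimately show ?thesis
  proof eventually_elim
    case (elim r)
    then have sub: "sphere 0 r \<subseteq> ball (0::complex) d" by auto
    have "continuous_on (sphere 0 r) (\<lambda>\<zeta>. f (inv_into U \<phi> (\<phi> p + \<zeta> *s b)))"
      if "continuous_on N f" for f :: "'a \<Rightarrow> real"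
      by (rule continuous_on_compose2[OF that continuous_on_subset[OF d(3) sub]]) (use d(2) sub in blast)
    then show ?case using elim d(2) sub by blast
  qed
qed

lemma locally_submean_const: "locally_submean (\<lambda>_. k) p"
  by (simp add: locally_submean_def)

lemma locally_submean_scale:
  assumes "locally_submean g p" "0 \<le> k" shows "locally_submean (\<lambda>x. k * g x) p"
  using assms unfolding locally_submean_def cmean_scale
  by (fastforce elim!: eventually_mono intro: mult_left_mono)

text \<open>The circle means of \<open>G\<close> are at least those of \<open>g\<close>. All later examples of the property are
  found by exhibiting a support \<open>g\<close>.\<close>

lemma locally_submean_lower_support:
  assumes g: "locally_submean g p" and N: "open N" "p \<in> N" and cont: "continuous_on N g" "continuous_on N G"
    and le: "\<And>x. x \<in> N \<Longrightarrow> g x \<le> G x" and eq: "G p \<le> g p"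
  shows "locally_submean G p"
  unfolding locally_submean_def
proof clarify
  fix U \<phi> b assume c: "(U, \<phi>) \<in> charts" "p \<in> U"
  from locally_submeanD[OF g c N, of b]
  show "\<forall>\<^sub>F r in at_right 0. G p \<le> cmean (\<lambda>\<zeta>. G (inv_into U \<phi> (\<phi> p + \<zeta> *s b))) 0 r"
  proof eventually_elim
    case (elim r)
    have "cmean (\<lambda>\<zeta>. g (inv_into U \<phi> (\<phi> p + \<zeta> *s b))) 0 r \<le> cmean (\<lambda>\<zeta>. G (inv_into U \<phi> (\<phi> p + \<zeta> *s b))) 0 r"
      using elim cont le by (intro cmean_mono) auto
    then show ?case using elim eq by linarith
  qed
qed

lemma locally_submean_cong:
  assumes "locally_submean g p" "open N" "p \<in> N" "continuous_on N g" "\<And>x. x \<in> N \<Longrightarrow> G x = g x"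
  shows "locally_submean G p"
proof (rule locally_submean_lower_support[OF assms(1-4)])
  show "continuous_on N G" using assms(4) by (rule continuous_on_eq) (simp add: assms(5))
qed (use assms in auto)

lemma locally_submean_add:
  assumes f: "locally_submean f p" and g: "locally_submean g p" and N: "open N" "p \<in> N"
    and cont: "continuous_on N f" "continuous_on N g"
  shows "locally_submean (\<lambda>x. f x + g x) p"
  unfolding locally_submean_def
proof clarify
  fix U \<phi> b assume c: "(U, \<phi>) \<in> charts" "p \<in> U"
  from locally_submeanD[OF g c N, of b] locally_submeanD[OF f c N, of b]
  show "\<forall>\<^sub>F r in at_right 0. f p + g p \<le> cmean (\<lambda>\<zeta>. f (inv_into U \<phi> (\<phi> p + \<zeta> *s b)) + g (inv_into U \<phi> (\<phi> p + \<zeta> *s b))) 0 r"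
  proof eventually_elim
    case (elim r)
    then show ?case using cont by (subst cmean_add) auto
  qed
qed

lemma locally_submean_max:
  assumes f: "locally_submean f p" and g: "locally_submean g p" and N: "open N" "p \<in> N"
    and cont: "continuous_on N f" "continuous_on N g"
  shows "locally_submean (\<lambda>x. max (f x) (g x)) p"
proof (cases "f p \<le> g p")
  case True
  show ?thesis
    by (rule locally_submean_lower_support[OF g N cont(2)]) (use True in \<open>auto intro: continuous_intros cont\<close>)
next
  case False
  show ?thesis
    by (rule locally_submean_lower_support[OF f N cont(1)]) (use False in \<open>auto intro: continuous_intros cont\<close>)
qed

text \<open>The tangent line of the exponential function at \<open>g p\<close> is a support.\<close>

lemma locally_submean_exp:
  assumes g: "locally_submean g p" and N: "open N" "p \<in> N" and cont: "continuous_on N g"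
  shows "locally_submean (\<lambda>x. exp (g x)) p"
proof (rule locally_submean_lower_support[of "\<lambda>x. exp (g p) * (1 - g p + g x)" p N])
  show "locally_submean (\<lambda>x. exp (g p) * (1 - g p + g x)) p"
    by (intro locally_submean_scale locally_submean_add[OF locally_submean_const g N] cont continuous_intros) auto
  show "exp (g p) * (1 - g p + g x) \<le> exp (g x)" for x
  proof -
    have "exp (g p) * (1 + (g x - g p)) \<le> exp (g p) * exp (g x - g p)"
      by (intro mult_left_mono exp_ge_add_one_self) auto
    then show ?thesis by (simp add: exp_diff algebra_simps)
  qed
  show "continuous_on N (\<lambda>x. exp (g p) * (1 - g p + g x))" "continuous_on N (\<lambda>x. exp (g x))"
    by (intro continuous_intros cont)+
qed (use N in auto)

lemma locally_submean_Re_holomorphic: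
  assumes d: "(V, \<psi>) \<in> charts" "p \<in> V" and P: "complex_diff_on P W" "open W" "\<psi> p \<in> W"
  shows "locally_submean (\<lambda>x. Re (P (\<psi> x))) p"
proof (rule locally_submeanI)
  let ?N = "{x \<in> V. \<psi> x \<in> W}"
  show "open ?N" "p \<in> ?N" using open_chart_preimage[OF d(1) P(2)] d(2) P(3) by auto
  fix U \<phi> b e and r :: real
  assume c: "(U, \<phi>) \<in> charts" "p \<in> U" and r: "0 < r" "r < e"
    and i: "\<And>\<zeta>. \<zeta> \<in> ball 0 e \<Longrightarrow> \<phi> p + \<zeta> *s b \<in> \<phi> ` (U \<inter> ?N)"
  have "holomorphic_map_on (\<lambda>z. \<psi> (inv_into U \<phi> z)) (\<phi> ` (U \<inter> ?N))"
    by (rule holomorphic_map_on_subset[OF transition_holomorphic[OF c(1) d(1)]]) auto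
  then have "complex_diff_on (\<lambda>z. P (\<psi> (inv_into U \<phi> z))) (\<phi> ` (U \<inter> ?N))"
    by (rule complex_diff_on_compose_holomorphic_map[OF P(1)]) (use chart_inverse(1)[OF c(1)] in auto)
  then have "(\<lambda>\<zeta>. P (\<psi> (inv_into U \<phi> (\<phi> p + \<zeta> *s b)))) holomorphic_on ball 0 e"
    by (rule complex_diff_on_line_holomorphic) (rule i)
  from cmean_Re_holomorphic[OF this open_ball _ r(1)] r
  show "Re (P (\<psi> p)) \<le> cmean (\<lambda>\<zeta>. Re (P (\<psi> (inv_into U \<phi> (\<phi> p + \<zeta> *s b))))) 0 r"
    using chart_inverse(1)[OF c] by (simp add: cball_subset_ball_iff)
qed

section \<open>Bounded continuous plurisubharmonic functions\<close>

lemma psh_manifoldI: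
  assumes cont: "continuous_on M v" and fin: "\<And>x. x \<in> M \<Longrightarrow> v x < \<infinity>"
    and sub: "\<And>k p. p \<in> M \<Longrightarrow> locally_submean (\<lambda>x. real_of_ereal (max (v x) (ereal (- real k)))) p"
  shows "psh_manifold M A v"
  unfolding psh_manifold_def
proof clarify
  fix U \<phi> assume c: "(U, \<phi>) \<in> charts"
  let ?w = "\<lambda>z. v (inv_into U \<phi> z)"
  have inU: "inv_into U \<phi> z \<in> U" if "z \<in> \<phi> ` U" for z using chart_inverse(3)[OF c that] .
  have contw: "continuous_on (\<phi> ` U) ?w"
    by (rule continuous_on_compose2[OF cont chartD(6)[OF c]]) (use inU chartD(2)[OF c] in blast)
  show "psh_on (\<phi> ` U) ?w"
    unfolding psh_on_def
  proof (intro conjI allI)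
    show "usc_on (\<phi> ` U) ?w"
      by (rule continuous_on_imp_usc_on[OF contw])
    show "\<forall>z\<in>\<phi> ` U. ?w z < \<infinity>"
      using inU chartD(2)[OF c] fin by blast
    fix a b
    let ?S = "{\<zeta>. a + \<zeta> *s b \<in> \<phi> ` U}"
    show "subharmonic_on ?S (\<lambda>\<zeta>. ?w (a + \<zeta> *s b))"
    proof (rule subharmonic_on_if_truncations)
      show "continuous_on ?S (\<lambda>\<zeta>. ?w (a + \<zeta> *s b))"
        by (rule continuous_on_compose2[OF contw continuous_on_complex_line]) auto
      show "?w (a + \<zeta> *s b) < \<infinity>" if "\<zeta> \<in> ?S" for \<zeta>
        using that inU chartD(2)[OF c] fin by blast
      fix k \<zeta> assume \<zeta>: "\<zeta> \<in> ?S"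
      define p where "p = inv_into U \<phi> (a + \<zeta> *s b)"
      have p: "p \<in> U" "\<phi> p = a + \<zeta> *s b" using \<zeta> chart_inverse[OF c] by (auto simp: p_def)
      let ?g = "\<lambda>x. real_of_ereal (max (v x) (ereal (- real k)))"
      have "\<forall>\<^sub>F r in at_right 0. ?g p \<le> cmean (\<lambda>\<xi>. ?g (inv_into U \<phi> (\<phi> p + \<xi> *s b))) 0 r"
        using sub[of p k] p(1) chartD(2)[OF c] c unfolding locally_submean_def by fastforce
      moreover have "cmean (\<lambda>\<xi>. ?g (inv_into U \<phi> (\<phi> p + \<xi> *s b))) 0 r =
          cmean (\<lambda>\<xi>. ?g (inv_into U \<phi> (a + \<xi> *s b))) \<zeta> r" for r
        using cmean_translate[of "\<lambda>\<xi>. ?g (inv_into U \<phi> (a + \<xi> *s b))" \<zeta> 0 r]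
        by (simp add: p(2) vector_sadd_rdistrib add.assoc)
      ultimately show "\<forall>\<^sub>F r in at_right 0. ?g (inv_into U \<phi> (a + \<zeta> *s b)) \<le> cmean (\<lambda>\<xi>. ?g (inv_into U \<phi> (a + \<xi> *s b))) \<zeta> r"
        by (simp add: p_def)
    qed
  qed
qed

lemma PSH_cb_continuous: "u \<in> PSH_cb M A \<Longrightarrow> continuous_on M u"
  by (simp add: PSH_cb_def)

lemma PSH_cbI:
  assumes cont: "continuous_on M u" and "bounded (u ` M)" and sub: "\<And>p. p \<in> M \<Longrightarrow> locally_submean u p"
  shows "u \<in> PSH_cb M A"
proof -
  have "psh_manifold M A (\<lambda>x. ereal (u x))"
  proof (rule psh_manifoldI)
    show "continuous_on M (\<lambda>x. ereal (u x))" using cont by (intro continuous_intros)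
    fix k p assume p: "p \<in> M"
    have "locally_submean (\<lambda>x. max (u x) (- real k)) p"
      by (intro locally_submean_max[OF sub[OF p] locally_submean_const open_M p] cont continuous_intros)
    then show "locally_submean (\<lambda>x. real_of_ereal (max (ereal (u x)) (ereal (- real k)))) p"
      by (simp add: ereal_max[symmetric] del: ereal_max)
  qed simp
  then show ?thesis using assms by (simp add: PSH_cb_def)
qed

lemma PSH_cb_locally_submean:
  assumes u: "u \<in> PSH_cb M A" and p: "p \<in> M"
  shows "locally_submean u p"
proof (rule locally_submeanI[OF open_M p])
  fix U \<phi> b d and r :: real
  assume c: "(U, \<phi>) \<in> charts" "p \<in> U" and r: "0 < r" "r < d"
    and i: "\<And>\<zeta>. \<zeta> \<in> ball 0 d \<Longrightarrow> \<phi> p + \<zeta> *s b \<in> \<phi> ` (U \<inter> M)"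
      "\<And>\<zeta>. \<zeta> \<in> ball 0 d \<Longrightarrow> inv_into U \<phi> (\<phi> p + \<zeta> *s b) \<in> U \<inter> M"
    and cont: "continuous_on (ball 0 d) (\<lambda>\<zeta>. inv_into U \<phi> (\<phi> p + \<zeta> *s b))"
  let ?f = "\<lambda>\<zeta>. u (inv_into U \<phi> (\<phi> p + \<zeta> *s b))"
  have "psh_on (\<phi> ` U) (\<lambda>z. ereal (u (inv_into U \<phi> z)))"
    using u c by (auto simp: PSH_cb_def psh_manifold_def)
  then have "subharmonic_on {\<zeta>. \<phi> p + \<zeta> *s b \<in> \<phi> ` U} (\<lambda>\<zeta>. ereal (?f \<zeta>))"
    by (simp add: psh_on_def)
  moreover have "cball 0 r \<subseteq> {\<zeta>. \<phi> p + \<zeta> *s b \<in> \<phi> ` U}" 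
  proof
    fix \<zeta> :: complex assume "\<zeta> \<in> cball 0 r"
    then have "\<zeta> \<in> ball 0 d" using r by simp
    from i(1)[OF this] show "\<zeta> \<in> {\<zeta>. \<phi> p + \<zeta> *s b \<in> \<phi> ` U}" by auto
  qed
  ultimately have "ereal (?f 0) \<le> circle_mean (\<lambda>\<zeta>. ereal (?f \<zeta>)) 0 r"
    using r(1) unfolding subharmonic_on_def by blast
  moreover have "continuous_on (sphere 0 r) ?f"
    by (rule continuous_on_compose2[OF PSH_cb_continuous[OF u] continuous_on_subset[OF cont]]) (use r i(2) in auto)
  ultimately show "u p \<le> cmean ?f 0 r"
    using r(1) chart_inverse(1)[OF c] by (simp add: circle_mean_eq_cmean)
qed

lemma PSH_cb_bounded:
  assumes "u \<in> PSH_cb M A" obtains B where "B > 0" "\<And>x. x \<in> M \<Longrightarrow> \<bar>u x\<bar> \<le> B"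
  using assms unfolding PSH_cb_def bounded_pos by auto

lemma PSH_cb_const: "(\<lambda>_. k) \<in> PSH_cb M A"
  by (rule PSH_cbI[OF continuous_on_const _ locally_submean_const]) (auto simp: image_constant_conv)

lemma PSH_cb_add:
  assumes u: "u \<in> PSH_cb M A" and v: "v \<in> PSH_cb M A" shows "(\<lambda>x. u x + v x) \<in> PSH_cb M A"
proof (rule PSH_cbI)
  show "continuous_on M (\<lambda>x. u x + v x)" by (intro continuous_intros PSH_cb_continuous[OF u] PSH_cb_continuous[OF v])
  show "bounded ((\<lambda>x. u x + v x) ` M)" using u v by (intro bounded_plus_comp) (auto simp: PSH_cb_def)
qed (intro locally_submean_add[OF _ _ open_M] PSH_cb_locally_submean PSH_cb_continuous u v)

lemma PSH_cb_sum:
  assumes "\<And>i. i \<in> I \<Longrightarrow> u i \<in> PSH_cb M A" shows "(\<lambda>x. \<Sum>i\<in>I. u i x) \<in> PSH_cb M A"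
  using assms by (induction I rule: infinite_finite_induct) (auto intro: PSH_cb_const PSH_cb_add)

lemma PSH_cb_scale:
  assumes u: "u \<in> PSH_cb M A" and "0 \<le> k" shows "(\<lambda>x. k * u x) \<in> PSH_cb M A"
proof (rule PSH_cbI)
  show "bounded ((\<lambda>x. k * u x) ` M)"
    using u bounded_scaling[of "u ` M" k] by (simp add: PSH_cb_def image_image)
  show "continuous_on M (\<lambda>x. k * u x)" by (intro continuous_intros PSH_cb_continuous[OF u])
qed (intro locally_submean_scale PSH_cb_locally_submean u assms(2))

lemma PSH_cb_max:
  assumes u: "u \<in> PSH_cb M A" and v: "v \<in> PSH_cb M A" shows "(\<lambda>x. max (u x) (v x)) \<in> PSH_cb M A"
proof (rule PSH_cbI)
  obtain B C where "\<And>x. x \<in> M \<Longrightarrow> \<bar>u x\<bar> \<le> B" "\<And>x. x \<in> M \<Longrightarrow> \<bar>v x\<bar> \<le> C"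
    using PSH_cb_bounded[OF u] PSH_cb_bounded[OF v] by metis
  then have "\<bar>max (u x) (v x)\<bar> \<le> max B C" if "x \<in> M" for x using that by (smt (verit))
  then show "bounded ((\<lambda>x. max (u x) (v x)) ` M)" unfolding bounded_iff by auto
  show "continuous_on M (\<lambda>x. max (u x) (v x))" by (intro continuous_intros PSH_cb_continuous[OF u] PSH_cb_continuous[OF v])
qed (intro locally_submean_max[OF _ _ open_M] PSH_cb_locally_submean PSH_cb_continuous u v)

lemma PSH_cb_exp:
  assumes u: "u \<in> PSH_cb M A" shows "(\<lambda>x. exp (u x)) \<in> PSH_cb M A"
proof (rule PSH_cbI)
  obtain B where B: "\<And>x. x \<in> M \<Longrightarrow> \<bar>u x\<bar> \<le> B" using PSH_cb_bounded[OF u] by metis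
  then show "bounded ((\<lambda>x. exp (u x)) ` M)" unfolding bounded_iff by (force intro!: exI[of _ "exp B"])
  show "continuous_on M (\<lambda>x. exp (u x))" by (intro continuous_intros PSH_cb_continuous[OF u])
qed (intro locally_submean_exp[OF _ open_M] PSH_cb_locally_submean PSH_cb_continuous u)

text \<open>On the open sets \<open>D\<close> and \<open>M - K\<close>, which cover \<open>M\<close>, the new function is \<open>max u \<rho>\<close> and \<open>u\<close>
  respectively. The set \<open>K\<close> is compact so that \<open>\<rho>\<close> is bounded where it matters.\<close>

lemma PSH_cb_glue:
  assumes u: "u \<in> PSH_cb M A" and D: "open D" "D \<subseteq> M" and K: "compact K" "K \<subseteq> D"
    and cont: "continuous_on D \<rho>" and sub: "\<And>p. p \<in> D \<Longrightarrow> locally_submean \<rho> p"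
    and less: "\<And>x. x \<in> D - K \<Longrightarrow> \<rho> x \<le> u x"
  shows "(\<lambda>x. if x \<in> D then max (u x) (\<rho> x) else u x) \<in> PSH_cb M A" (is "?G \<in> _")
proof (rule PSH_cbI)
  have oMK: "open (M - K)" using open_Diff[OF open_M compact_imp_closed[OF K(1)]] .
  have M: "M = D \<union> (M - K)" using D K by auto
  have cu: "continuous_on D u" "continuous_on (M - K) u"
    using PSH_cb_continuous[OF u] D continuous_on_subset by blast+
  have GD: "?G x = max (u x) (\<rho> x)" if "x \<in> D" for x using that by simp
  have GMK: "?G x = u x" if "x \<in> M - K" for x using that less[of x] by auto
  have cm: "continuous_on D (\<lambda>x. max (u x) (\<rho> x))" by (intro continuous_intros cu cont)
  have "continuous_on D ?G" by (rule continuous_on_eq[OF cm]) simp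
  moreover have "continuous_on (M - K) ?G" by (rule continuous_on_eq[OF cu(2)]) (use GMK in simp)
  ultimately show "continuous_on M ?G" using continuous_on_open_Un[OF D(1) oMK] M by metis
  obtain B where B: "\<And>x. x \<in> M \<Longrightarrow> \<bar>u x\<bar> \<le> B" using PSH_cb_bounded[OF u] by metis
  have "bounded (\<rho> ` K)"
    using K cont continuous_on_subset compact_continuous_image compact_imp_bounded by blast
  then obtain C where C: "\<And>x. x \<in> K \<Longrightarrow> \<bar>\<rho> x\<bar> \<le> C" unfolding bounded_iff by auto
  have "\<bar>?G x\<bar> \<le> max B C" if "x \<in> M" for x
  proof (cases "x \<in> K")
    case True
    then show ?thesis using B[OF that] C[OF True] by auto
  next
    case False
    then show ?thesis using B[OF that] GMK[of x] that by auto
  qed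
  then show "bounded (?G ` M)" unfolding bounded_iff real_norm_def by blast
  fix p assume p: "p \<in> M"
  show "locally_submean ?G p"
  proof (cases "p \<in> D")
    case True
    show ?thesis
      by (rule locally_submean_cong[OF locally_submean_max[OF PSH_cb_locally_submean[OF u p] sub[OF True] D(1) True cu(1) cont] D(1) True cm]) simp
  next
    case False
    then have pMK: "p \<in> M - K" using p K by auto
    show ?thesis
      by (rule locally_submean_cong[OF PSH_cb_locally_submean[OF u p] oMK pMK cu(2) GMK])
  qed
qed

end

section \<open>The functions \<open>|z|\<^sup>2\<close> and \<open>log |z|\<close>\<close>

definition hermitian :: "complex^'n \<Rightarrow> complex^'n \<Rightarrow> complex" where
  "hermitian e y = (\<Sum>j\<in>UNIV. y $ j * cnj (e $ j))"

lemma hermitian_smult: "hermitian e (c *s y) = c * hermitian e y"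
  by (simp add: hermitian_def sum_distrib_left mult.assoc)

lemma bounded_linear_hermitian: "bounded_linear (hermitian e)"
  unfolding linear_conv_bounded_linear[symmetric]
  by (rule linearI) (simp_all add: hermitian_def algebra_simps sum.distrib scaleR_sum_right)

lemma hermitian_self: "hermitian e e = of_real ((norm e)\<^sup>2)"
proof -
  have "(norm e)\<^sup>2 = (\<Sum>j\<in>UNIV. (norm (e $ j))\<^sup>2)"
    by (simp add: norm_vec_def L2_set_def sum_nonneg)
  then show ?thesis by (simp only: hermitian_def of_real_sum complex_norm_square)
qed

lemma norm_hermitian_le: "norm (hermitian e y) \<le> norm y * norm e"
proof -
  have "norm (hermitian e y) \<le> (\<Sum>j\<in>UNIV. \<bar>norm (y $ j)\<bar> * \<bar>norm (e $ j)\<bar>)"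
    unfolding hermitian_def by (rule order_trans[OF norm_sum]) (simp add: norm_mult)
  also have "\<dots> \<le> norm y * norm e" unfolding norm_vec_def by (rule L2_set_mult_ineq)
  finally show ?thesis .
qed

lemma complex_diff_on_hermitian_compose:
  assumes "f holomorphic_on T" "open T"
  shows "complex_diff_on (\<lambda>y. f (hermitian e (y - z))) {y. hermitian e (y - z) \<in> T}"
  unfolding complex_diff_on_def
proof
  fix y assume "y \<in> {y. hermitian e (y - z) \<in> T}"
  then have "(f has_derivative (*) (deriv f (hermitian e (y - z)))) (at (hermitian e (y - z)))"
    using holomorphic_derivI[OF assms] by (simp add: has_field_derivative_def)
  moreover have "((\<lambda>y. hermitian e (y - z)) has_derivative hermitian e) (at y)"
    by (auto intro!: derivative_eq_intros bounded_linear.has_derivative[OF bounded_linear_hermitian])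
  ultimately have "((\<lambda>y. f (hermitian e (y - z))) has_derivative (\<lambda>h. deriv f (hermitian e (y - z)) * hermitian e h)) (at y)"
    by (rule has_derivative_compose[rotated])
  then show "\<exists>D. ((\<lambda>y. f (hermitian e (y - z))) has_derivative D) (at y) \<and> (\<forall>c w. D (c *s w) = c * D w)"
    by (intro exI conjI, assumption) (simp add: hermitian_smult)
qed

lemma open_hermitian_preimage: "open T \<Longrightarrow> open {y. hermitian e (y - z) \<in> T}"
  using open_vimage[of T "\<lambda>y. hermitian e (y - z)"]
  by (simp add: vimage_def bounded_linear.continuous_on[OF bounded_linear_hermitian] continuous_on_diff)

lemma one_plus_less_exp:
  assumes "t \<noteq> (0::real)" shows "1 + t < exp t"
proof (cases "1 + t / 2 \<ge> 0")
  case True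
  have "exp t = (exp (t/2))\<^sup>2" by (simp add: exp_double[symmetric])
  moreover have "(1 + t/2)\<^sup>2 \<le> (exp (t/2))\<^sup>2"
    using True by (intro power_mono exp_ge_add_one_self) auto
  moreover have "(1 + t/2)\<^sup>2 = 1 + t + t\<^sup>2 / 4" by (simp add: power2_eq_square field_simps)
  ultimately show ?thesis using assms by (smt (verit) zero_less_power2 divide_pos_pos)
next
  case False
  then show ?thesis using exp_gt_zero[of t] by linarith
qed

context complex_mfd
begin

lemma continuous_on_chart: "(U, \<phi>) \<in> charts \<Longrightarrow> T \<subseteq> U \<Longrightarrow> continuous_on T \<phi>"
  using chartD(5) continuous_on_subset by blast

lemma chart_small_cball:
  assumes "(U, \<phi>) \<in> charts" "p \<in> U" "open N" "p \<in> N"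
  obtains r where "r > 0" "cball (\<phi> p) r \<subseteq> \<phi> ` (U \<inter> N)"
  using open_chart_image[OF assms(1,3)] assms(2,4) open_contains_cball by (metis IntI imageI)

lemma chart_cball_in:
  assumes "(U, \<phi>) \<in> charts" "x \<in> U" "\<phi> x \<in> \<phi> ` (U \<inter> N)" shows "x \<in> N"
  using assms chartD(4)[OF assms(1)] by (auto dest: inj_onD)

text \<open>The strict inequality on the sphere makes the set where \<open>u \<le> \<rho>\<close> a compact subset of the open
  ball.\<close>

lemma PSH_cb_glue_ball:
  assumes u: "u \<in> PSH_cb M A" and c: "(U, \<phi>) \<in> charts" and sub: "cball z r \<subseteq> \<phi> ` U"
    and cont: "continuous_on {x \<in> U. \<phi> x \<in> cball z r} \<rho>"
    and subm: "\<And>p. p \<in> U \<Longrightarrow> \<phi> p \<in> ball z r \<Longrightarrow> locally_submean \<rho> p"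
    and less: "\<And>x. x \<in> U \<Longrightarrow> \<phi> x \<in> sphere z r \<Longrightarrow> \<rho> x < u x"
  shows "(\<lambda>x. if x \<in> {x \<in> U. \<phi> x \<in> ball z r} then max (u x) (\<rho> x) else u x) \<in> PSH_cb M A"
proof (rule PSH_cb_glue[OF u])
  let ?D = "{x \<in> U. \<phi> x \<in> ball z r}" and ?C = "{x \<in> U. \<phi> x \<in> cball z r}"
  let ?K' = "{y \<in> cball z r. u (inv_into U \<phi> y) \<le> \<rho> (inv_into U \<phi> y)}"
  let ?K = "{x \<in> U. \<phi> x \<in> ?K'}"
  show "open ?D" by (rule open_chart_preimage[OF c open_ball])
  show "?D \<subseteq> M" using chartD(2)[OF c] by auto
  have ci: "continuous_on (cball z r) (inv_into U \<phi>)" using chartD(6)[OF c] sub continuous_on_subset by blast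
  have "closed ?K'"
  proof (rule continuous_on_closed_Collect_le)
    show "continuous_on (cball z r) (\<lambda>y. u (inv_into U \<phi> y))"
      by (rule continuous_on_compose2[OF PSH_cb_continuous[OF u] ci]) (use chart_inverse(3)[OF c] chartD(2)[OF c] sub in blast)
    show "continuous_on (cball z r) (\<lambda>y. \<rho> (inv_into U \<phi> y))"
      by (rule continuous_on_compose2[OF cont ci]) (use chart_inverse[OF c] sub in \<open>auto simp: subset_iff\<close>)
  qed simp
  then have "compact ?K'" by (rule compact_Int_closed[OF compact_cball, of _ z r, THEN iffD1[OF arg_cong[of _ _ compact], rotated]]) auto
  then show "compact ?K" by (rule compact_chart_preimage[OF c]) (use sub in auto)
  show "?K \<subseteq> ?D" using less chart_inverse(1)[OF c] by fastforce
  show "continuous_on ?D \<rho>" using cont by (rule continuous_on_subset) auto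
  show "\<rho> x \<le> u x" if "x \<in> ?D - ?K" for x using that chart_inverse(1)[OF c] by fastforce
qed (use subm in auto)

text \<open>With \<open>e = \<phi> p - z\<close>, the support is \<open>2 Re (hermitian e (y - z)) - |e|\<^sup>2\<close>, the real
  linearization of \<open>|y - z|\<^sup>2\<close> at \<open>\<phi> p\<close>.\<close>

lemma locally_submean_norm_squared:
  assumes c: "(U, \<phi>) \<in> charts" and p: "p \<in> U"
  shows "locally_submean (\<lambda>x. (norm (\<phi> x - z))\<^sup>2) p"
proof -
  define e where "e = \<phi> p - z"
  let ?g = "\<lambda>x. - (norm e)\<^sup>2 + Re ((\<lambda>\<zeta>. 2 * \<zeta>) (hermitian e (\<phi> x - z)))"
  note cont = continuous_on_chart[OF c order_refl]
  have ch: "continuous_on U (\<lambda>x. Re (2 * hermitian e (\<phi> x - z)))"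
    by (intro continuous_intros bounded_linear.continuous_on[OF bounded_linear_hermitian] cont)
  have "complex_diff_on (\<lambda>y. (\<lambda>\<zeta>. 2 * \<zeta>) (hermitian e (y - z))) {y. hermitian e (y - z) \<in> UNIV}"
    by (rule complex_diff_on_hermitian_compose) (auto intro!: holomorphic_intros)
  from locally_submean_Re_holomorphic[OF c p this]
  have "locally_submean (\<lambda>x. Re (2 * hermitian e (\<phi> x - z))) p" by simp
  then have "locally_submean ?g p"
    by (rule locally_submean_add[OF locally_submean_const _ chartD(1)[OF c] p continuous_on_const ch])
  then show ?thesis
  proof (rule locally_submean_lower_support[OF _ chartD(1)[OF c] p])
    show "?g x \<le> (norm (\<phi> x - z))\<^sup>2" for x
    proof -
      have "Re (hermitian e (\<phi> x - z)) \<le> norm (\<phi> x - z) * norm e"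
        using norm_hermitian_le complex_Re_le_cmod order_trans by blast
      moreover have "0 \<le> (norm (\<phi> x - z) - norm e)\<^sup>2" by simp
      ultimately show ?thesis by (simp add: power2_diff)
    qed
    show "(norm (\<phi> p - z))\<^sup>2 \<le> ?g p" by (simp add: e_def[symmetric] hermitian_self)
    show "continuous_on U ?g" by (intro continuous_on_add continuous_on_const ch)
    show "continuous_on U (\<lambda>x. (norm (\<phi> x - z))\<^sup>2)" by (intro continuous_intros cont)
  qed
qed

text \<open>With \<open>e = \<phi> p - z\<close>, the support is \<open>log |hermitian e (y - z)| - log |e|\<close>, which lies below
  \<open>log |y - z|\<close> by the Cauchy-Schwarz inequality and is the real part of a holomorphic logarithm
  near \<open>\<phi> p\<close>, where \<open>hermitian e (y - z)\<close> has positive real part.\<close>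

lemma locally_submean_ln_norm:
  assumes c: "(U, \<phi>) \<in> charts" and p: "p \<in> U" and ne: "\<phi> p \<noteq> z"
  shows "locally_submean (\<lambda>x. ln (norm (\<phi> x - z))) p"
proof -
  define e where "e = \<phi> p - z"
  have e: "e \<noteq> 0" using ne by (simp add: e_def)
  let ?T = "{\<zeta>. 0 < Re \<zeta>}"
  let ?W = "{y. hermitian e (y - z) \<in> ?T}"
  let ?N = "{x \<in> U. \<phi> x \<in> ?W}"
  have T: "open ?T" using open_halfspace_Re_gt[of 0] by simp
  have pW: "\<phi> p \<in> ?W" using e by (simp add: e_def[symmetric] hermitian_self)
  have N: "open ?N" "p \<in> ?N" using open_chart_preimage[OF c open_hermitian_preimage[OF T]] p pW by auto
  have nz: "hermitian e (\<phi> x - z) \<noteq> 0" if "x \<in> ?N" for x using that by force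
  have nz': "\<phi> x - z \<noteq> 0" if "x \<in> ?N" for x
    using nz[OF that] by (auto simp: hermitian_def)
  have cont: "continuous_on ?N \<phi>" by (rule continuous_on_chart[OF c]) auto
  have hol: "Ln holomorphic_on ?T" by (intro holomorphic_intros) (auto simp: complex_nonpos_Reals_iff)
  have "locally_submean (\<lambda>x. Re (Ln (hermitian e (\<phi> x - z)))) p"
    by (rule locally_submean_Re_holomorphic[OF c p complex_diff_on_hermitian_compose[OF hol T] open_hermitian_preimage[OF T] pW])
  moreover have ch: "continuous_on ?N (\<lambda>x. ln (norm (hermitian e (\<phi> x - z))))"
    using nz by (intro continuous_intros bounded_linear.continuous_on[OF bounded_linear_hermitian] cont) auto
  ultimately have "locally_submean (\<lambda>x. ln (norm (hermitian e (\<phi> x - z)))) p"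
  proof (elim locally_submean_cong[OF _ N])
    show "continuous_on ?N (\<lambda>x. Re (Ln (hermitian e (\<phi> x - z))))"
      using ch by (rule continuous_on_eq) (use nz in \<open>simp add: Re_Ln\<close>)
  qed (use nz in \<open>simp add: Re_Ln\<close>)
  then have "locally_submean (\<lambda>x. - ln (norm e) + ln (norm (hermitian e (\<phi> x - z)))) p"
    by (rule locally_submean_add[OF locally_submean_const _ N continuous_on_const ch])
  then show ?thesis
  proof (rule locally_submean_lower_support[OF _ N])
    show "- ln (norm e) + ln (norm (hermitian e (\<phi> x - z))) \<le> ln (norm (\<phi> x - z))" if "x \<in> ?N" for x
    proof -
      have "ln (norm (hermitian e (\<phi> x - z))) \<le> ln (norm (\<phi> x - z) * norm e)"
        using nz[OF that] norm_hermitian_le by (intro ln_mono) auto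
      then show ?thesis using nz'[OF that] e by (simp add: ln_mult)
    qed
    show "ln (norm (\<phi> p - z)) \<le> - ln (norm e) + ln (norm (hermitian e (\<phi> p - z)))"
      using e by (simp add: e_def[symmetric] hermitian_self ln_realpow norm_power)
    show "continuous_on ?N (\<lambda>x. - ln (norm e) + ln (norm (hermitian e (\<phi> x - z))))"
      by (intro continuous_on_add continuous_on_const ch)
    show "continuous_on ?N (\<lambda>x. ln (norm (\<phi> x - z)))"
      using nz' by (intro continuous_intros cont) auto
  qed
qed

lemma locally_submean_ln_truncated:
  assumes c: "(U, \<phi>) \<in> charts" and p: "p \<in> U" and "s > 0"
  shows "locally_submean (\<lambda>x. ln (max (norm (\<phi> x - z)) s)) p"
proof -
  have cont: "continuous_on U (\<lambda>x. ln (max (norm (\<phi> x - z)) s))"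
    using \<open>s > 0\<close> by (intro continuous_intros continuous_on_chart[OF c]) (auto simp: max_def)
  show ?thesis
  proof (cases "norm (\<phi> p - z) \<le> s")
    case True
    show ?thesis
      by (rule locally_submean_lower_support[OF locally_submean_const[of "ln s"] chartD(1)[OF c] p continuous_on_const cont])
        (use True \<open>s > 0\<close> in \<open>auto intro!: ln_mono simp: max_def\<close>)
  next
    case False
    let ?N = "{x \<in> U. \<phi> x \<in> - {z}}"
    have N: "open ?N" by (rule open_chart_preimage[OF c]) auto
    have nz: "\<phi> p \<noteq> z" using False \<open>s > 0\<close> by auto
    show ?thesis
    proof (rule locally_submean_lower_support[OF locally_submean_ln_norm[OF c p nz] N])
      show "continuous_on ?N (\<lambda>x. ln (norm (\<phi> x - z)))"
        by (intro continuous_intros continuous_on_chart[OF c]) auto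
      show "continuous_on ?N (\<lambda>x. ln (max (norm (\<phi> x - z)) s))"
        using cont by (rule continuous_on_subset) auto
    qed (use p nz False \<open>s > 0\<close> in \<open>auto intro!: ln_mono\<close>)
  qed
qed

lemma continuous_on_ln_truncated:
  assumes "(U, \<phi>) \<in> charts" "s > 0" "T \<subseteq> U"
  shows "continuous_on T (\<lambda>x. ln (max (norm (\<phi> x - z)) s))"
  using assms(2) by (intro continuous_intros continuous_on_chart[OF assms(1,3)]) (auto simp: max_def)

section \<open>Separation of points yields a strict sphere minimum\<close>

text \<open>Separation is a symmetric condition, whereas a maximum principle argument needs to know which
  of two values is larger. Comparing \<open>exp (f - f w0)\<close> with its tangent \<open>1 + (f - f w0)\<close> gives an
  inequality in a known direction wherever \<open>f \<noteq> f w0\<close>.\<close>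

lemma separation_from_compact:
  assumes sep: "separates_points M (PSH_cb M A)" and w0: "w0 \<in> M" and S: "compact S" "S \<subseteq> M" "w0 \<notin> S"
  obtains u v c where "u \<in> PSH_cb M A" "v \<in> PSH_cb M A" "c > 0" "u w0 = v w0" "\<forall>x\<in>S. v x + c \<le> u x"
proof -
  have "\<exists>f\<in>PSH_cb M A. f q \<noteq> f w0" if "q \<in> S" for q
    using sep w0 S that unfolding separates_points_def by (metis subsetD)
  then obtain f where f: "\<And>q. q \<in> S \<Longrightarrow> f q \<in> PSH_cb M A" "\<And>q. q \<in> S \<Longrightarrow> f q q \<noteq> f q w0" by metis
  define D where "D q = {x \<in> M. f q x \<in> - {f q w0}}" for q
  have "open (D q)" if "q \<in> S" for q
  proof -
    have "open (f q -` (- {f q w0}) \<inter> M)"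
      using continuous_on_open_vimage[OF open_M] PSH_cb_continuous[OF f(1)[OF that]] by (meson open_Compl closed_singleton)
    then show ?thesis by (simp add: D_def vimage_def Int_def conj_commute)
  qed
  moreover have "S \<subseteq> (\<Union>q\<in>S. D q)" using f(2) S(2) by (auto simp: D_def)
  ultimately obtain T where T: "T \<subseteq> S" "finite T" "S \<subseteq> (\<Union>q\<in>T. D q)"
    using compactE_image[OF S(1)] by metis
  define u where "u x = (\<Sum>q\<in>T. exp (f q x + (- f q w0)))" for x
  define v where "v x = (\<Sum>q\<in>T. 1 + (f q x + (- f q w0)))" for x
  have u: "u \<in> PSH_cb M A" unfolding u_def using T f by (intro PSH_cb_sum PSH_cb_exp PSH_cb_add PSH_cb_const) auto
  have v: "v \<in> PSH_cb M A" unfolding v_def using T f by (intro PSH_cb_sum PSH_cb_add PSH_cb_const) auto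
  have eq: "u w0 = v w0" by (simp add: u_def v_def)
  have pos: "v x < u x" if x: "x \<in> S" for x
  proof -
    obtain q where q: "q \<in> T" "f q x \<noteq> f q w0" using T(3) x by (auto simp: D_def)
    show ?thesis unfolding u_def v_def
      by (rule sum_strict_mono_ex1[OF T(2)]) (use q one_plus_less_exp[of "f q x + (- f q w0)"] exp_ge_add_one_self in auto)
  qed
  show ?thesis
  proof (cases "S = {}")
    case True
    then show ?thesis using that[OF u v, of 1] eq by auto
  next
    case False
    have "continuous_on S (\<lambda>x. u x - v x)"
      using PSH_cb_continuous[OF u] PSH_cb_continuous[OF v] S(2) by (intro continuous_intros) (auto intro: continuous_on_subset)
    then obtain y where y: "y \<in> S" "\<And>x. x \<in> S \<Longrightarrow> u y - v y \<le> u x - v x"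
      using continuous_attains_inf[OF S(1) False, of "\<lambda>x. u x - v x"] by blast
    have "\<forall>x\<in>S. v x + (u y - v y) \<le> u x" using y(2) by (metis add.commute le_diff_eq)
    moreover have "u y - v y > 0" using pos[OF y(1)] by simp
    ultimately show ?thesis using that[OF u v _ eq] by blast
  qed
qed

definition strict_sphere_minimum :: "('a \<Rightarrow> real) \<Rightarrow> 'a \<Rightarrow> ('a, 'n) chart \<Rightarrow> real \<Rightarrow> real \<Rightarrow> bool" where
  "strict_sphere_minimum w w0 = (\<lambda>(U, \<phi>) r m. w \<in> PSH_cb M A \<and> w w0 = 0 \<and> 0 < r \<and> 0 < m \<and>
    cball (\<phi> w0) r \<subseteq> \<phi> ` U \<and> (\<forall>x\<in>U. \<phi> x \<in> sphere (\<phi> w0) r \<longrightarrow> m \<le> w x))"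

text \<open>Let \<open>u\<close>, \<open>v\<close> and \<open>c\<close> be as in \<open>separation_from_compact\<close> for the sphere of radius \<open>r\<close>, and let
  \<open>r1 = t r\<close> be so small that \<open>v > v w0 - c/4\<close> on the ball of radius \<open>r1\<close>. The function
  \<open>\<rho> = v - v w0 + c/2 + \<delta> log (max |z - w0| (r t\<^sup>4) / r)\<close>, with \<open>\<delta>\<close> such that
  \<open>\<delta> log t = - c/8\<close>, equals \<open>v - v w0 + c/2 < u - u w0\<close> on the sphere of radius \<open>r\<close>, vanishes at
  \<open>w0\<close> since \<open>\<delta> log (t\<^sup>4) = - c/2\<close>, and is at least \<open>- c/4 + c/2 - c/8 = c/8\<close> on the sphere of
  radius \<open>r1\<close>. So \<open>u - u w0\<close> with \<open>\<rho>\<close> glued in is as desired.\<close>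

theorem separation_imp_strict_sphere_minimum:
  assumes sep: "separates_points M (PSH_cb M A)" and ch: "(U, \<phi>) \<in> charts" and w0: "w0 \<in> U"
  shows "\<exists>w r m. strict_sphere_minimum w w0 (U, \<phi>) r m"
proof -
  have w0M: "w0 \<in> M" using chartD(2)[OF ch] w0 by auto
  obtain r where r: "r > 0" "cball (\<phi> w0) r \<subseteq> \<phi> ` (U \<inter> UNIV)" using chart_small_cball[OF ch w0 open_UNIV] by auto
  let ?S = "{x \<in> U. \<phi> x \<in> sphere (\<phi> w0) r}"
  have sph: "sphere (\<phi> w0) r \<subseteq> \<phi> ` U" using r(2) sphere_cball by fastforce
  have cS: "compact ?S" by (rule compact_chart_preimage[OF ch compact_sphere sph])
  have SM: "?S \<subseteq> M" "w0 \<notin> ?S" using chartD(2)[OF ch] r(1) by auto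
  obtain u v c where u: "u \<in> PSH_cb M A" and v: "v \<in> PSH_cb M A" and "c > 0" and uv: "u w0 = v w0"
    and gap: "\<forall>x\<in>?S. v x + c \<le> u x"
    by (rule separation_from_compact[OF sep w0M cS SM])
  let ?N = "{x \<in> M. v w0 - c/4 < v x}"
  have "open (v -` {v w0 - c/4<..} \<inter> M)"
    using continuous_on_open_vimage[OF open_M] PSH_cb_continuous[OF v] open_greaterThan by blast
  moreover have "v -` {v w0 - c/4<..} \<inter> M = ?N" by auto
  ultimately have "open ?N" by simp
  moreover have "w0 \<in> ?N" using w0M \<open>c > 0\<close> by simp
  ultimately obtain r' where r': "r' > 0" "cball (\<phi> w0) r' \<subseteq> \<phi> ` (U \<inter> ?N)" using chart_small_cball[OF ch w0] by metis
  define r1 where "r1 = min r' (r/2)"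
  have r1: "0 < r1" "r1 < r" "r1 \<le> r'" using r' r by (auto simp: r1_def)
  have near: "v w0 - c/4 < v x" if "x \<in> U" "\<phi> x \<in> cball (\<phi> w0) r1" for x
  proof -
    have "\<phi> x \<in> \<phi> ` (U \<inter> ?N)" using r' r1 that(2) by auto
    then show ?thesis using chart_cball_in[OF ch that(1)] by blast
  qed
  define t where "t = r1 / r"
  have t: "0 < t" "t < 1" using r1 r by (auto simp: t_def)
  define \<delta> where "\<delta> = c / (8 * (- ln t))"
  have lt: "- ln t > 0" using t by simp
  have \<delta>: "\<delta> > 0" "\<delta> * ln t = - c / 8" using lt \<open>c > 0\<close> by (auto simp: \<delta>_def divide_simps)
  define \<rho> where "\<rho> x = (v x + (c/2 - v w0 - \<delta> * ln r)) + \<delta> * ln (max (norm (\<phi> x - \<phi> w0)) (r * t^4))" for x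
  have rt: "r * t^4 > 0" using r t by simp
  have t4: "r * t^4 \<le> r1"
  proof -
    have "t^4 \<le> t" using t power_decreasing[of 1 4 t] by simp
    then show ?thesis using r by (simp add: t_def field_simps)
  qed
  let ?u = "\<lambda>x. u x + - u w0"
  let ?G = "\<lambda>x. if x \<in> {x \<in> U. \<phi> x \<in> ball (\<phi> w0) r} then max (?u x) (\<rho> x) else ?u x"
  have cv: "continuous_on T v" if "T \<subseteq> U" for T
    using PSH_cb_continuous[OF v] chartD(2)[OF ch] that continuous_on_subset by blast
  have c\<rho>: "continuous_on T \<rho>" if "T \<subseteq> U" for T
    unfolding \<rho>_def by (intro continuous_on_add continuous_on_mult continuous_on_const cv that continuous_on_ln_truncated[OF ch rt])
  have G: "?G \<in> PSH_cb M A"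
  proof (rule PSH_cb_glue_ball[OF _ ch])
    show "?u \<in> PSH_cb M A" by (intro PSH_cb_add PSH_cb_const u)
    show "cball (\<phi> w0) r \<subseteq> \<phi> ` U" using r by simp
    show "continuous_on {x \<in> U. \<phi> x \<in> cball (\<phi> w0) r} \<rho>" by (rule c\<rho>) auto
    show "locally_submean \<rho> p" if p: "p \<in> U" for p
      unfolding \<rho>_def using p chartD(2)[OF ch] \<delta>(1)
      by (intro locally_submean_add[OF _ _ chartD(1)[OF ch] p] locally_submean_const PSH_cb_locally_submean[OF v]
          locally_submean_scale locally_submean_ln_truncated[OF ch p rt]
          continuous_on_add continuous_on_mult continuous_on_const cv continuous_on_ln_truncated[OF ch rt]) auto
    show "\<rho> x < ?u x" if "x \<in> U" "\<phi> x \<in> sphere (\<phi> w0) r" for x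
    proof -
      have "norm (\<phi> x - \<phi> w0) = r" using that(2) by (simp add: dist_norm norm_minus_commute)
      moreover have "max r (r * t^4) = r" using t4 r1 by simp
      ultimately have "\<rho> x = v x + c/2 - v w0" by (simp add: \<rho>_def)
      then show ?thesis using bspec[OF gap, of x] that uv \<open>c > 0\<close> by simp
    qed
  qed
  have "\<rho> w0 = 0"
  proof -
    have "ln (r * t^4) = ln r + 4 * ln t" using r t by (simp add: ln_mult ln_realpow)
    then have "\<rho> w0 = c/2 + 4 * (\<delta> * ln t)" using rt by (simp add: \<rho>_def max_def algebra_simps)
    then show ?thesis using \<delta>(2) by simp
  qed
  then have G0: "?G w0 = 0" using w0 r by simp
  have Gm: "c/8 \<le> ?G x" if x: "x \<in> U" "\<phi> x \<in> sphere (\<phi> w0) r1" for x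
  proof -
    have n: "norm (\<phi> x - \<phi> w0) = r1" using x(2) by (simp add: dist_norm norm_minus_commute)
    have "ln r1 = ln r + ln t" using r r1 t by (simp add: t_def ln_div)
    then have "\<rho> x = v x + c/2 - v w0 + \<delta> * ln t" using t4 by (simp add: \<rho>_def n algebra_simps)
    then have "c/8 \<le> \<rho> x" using near[of x] x \<delta>(2) by simp
    moreover have "x \<in> {x \<in> U. \<phi> x \<in> ball (\<phi> w0) r}" using x r1 by auto
    then have "?G x = max (?u x) (\<rho> x)" by (rule if_P)
    ultimately show ?thesis by linarith
  qed
  have c8: "0 < c/8" using \<open>c > 0\<close> by simp
  have "cball (\<phi> w0) r1 \<subseteq> \<phi> ` U" using r r1 by (force simp: subset_iff)
  then have "strict_sphere_minimum ?G w0 (U, \<phi>) r1 (c/8)"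
    unfolding strict_sphere_minimum_def split by (intro conjI ballI impI G G0 Gm r1(1) c8)
  then show ?thesis by blast
qed

end

section \<open>From a strict sphere minimum to strict plurisubharmonicity\<close>

lemma has_derivative_norm_squared_complex_diff:
  assumes "complex_diff_on f S" "z \<in> S"
  shows "((\<lambda>x. (norm (f x))\<^sup>2) has_derivative (\<lambda>v. 2 * Re (cnj (f z) * frechet_derivative f (at z) v))) (at z)"
proof -
  have D: "(f has_derivative frechet_derivative f (at z)) (at z)" by (rule complex_diff_on_frechet(1)[OF assms])
  have "((\<lambda>x. Re (cnj (f x) * f x)) has_derivative
      (\<lambda>v. Re (cnj (f z) * frechet_derivative f (at z) v + cnj (frechet_derivative f (at z) v) * f z))) (at z)"
    by (intro bounded_linear.has_derivative[OF bounded_linear_Re] has_derivative_mult D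
        bounded_linear.has_derivative[OF bounded_linear_cnj])
  moreover have "Re (cnj (f x) * f x) = (norm (f x))\<^sup>2" for x
    unfolding cmod_power2 by (simp add: power2_eq_square)
  ultimately show ?thesis by (simp add: algebra_simps)
qed

context complex_mfd
begin

text \<open>In another chart the function becomes \<open>k + \<epsilon> |T - z0|\<^sup>2\<close> with a transition map \<open>T\<close>. The
  second derivatives of \<open>T\<close> in the directions \<open>w\<close> and \<open>\<i> w\<close> cancel, so the Levi form is
  \<open>\<epsilon> |D T w|\<^sup>2\<close>, and \<open>D T\<close> is injective because \<open>T\<close> has a holomorphic inverse.\<close>

theorem smooth_strictly_psh_norm_squared:
  assumes d: "(V, \<psi>) \<in> charts" and N: "open N" "N \<subseteq> V" and "\<epsilon> > 0"
    and G: "\<And>x. x \<in> N \<Longrightarrow> G x = k + \<epsilon> * (norm (\<psi> x - z0))\<^sup>2"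
  shows "smooth_strictly_psh_on M A N G"
  unfolding smooth_strictly_psh_on_def
proof clarify
  fix U \<phi> assume c: "(U, \<phi>) \<in> charts"
  define S where "S = \<phi> ` (U \<inter> N)"
  have S: "open S" unfolding S_def by (rule open_chart_image[OF c N(1)])
  define T where "T y = \<psi> (inv_into U \<phi> y)" for y
  have hT: "holomorphic_map_on T S"
    unfolding T_def S_def by (rule holomorphic_map_on_subset[OF transition_holomorphic[OF c d]]) (use N in auto)
  define f where "f j y = T y $ j - z0 $ j" for j y
  have DT: "\<exists>D. (T has_derivative D) (at y) \<and> (\<forall>c w. D (c *s w) = c *s D w)" if "y \<in> S" for y
    using hT that by (auto simp: holomorphic_map_on_def)
  have fT: "(f j has_derivative (\<lambda>v. D v $ j)) (at y)" if "(T has_derivative D) (at y)" for D y j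
  proof -
    have "((\<lambda>y. T y $ j - z0 $ j) has_derivative (\<lambda>v. D v $ j - 0)) (at y)"
      by (intro has_derivative_diff bounded_linear.has_derivative[OF bounded_linear_vec_nth that] has_derivative_const)
    then show ?thesis by (simp add: f_def[abs_def])
  qed
  have f: "complex_diff_on (f j) S" for j
    unfolding complex_diff_on_def
  proof
    fix y assume "y \<in> S"
    then obtain D where D: "(T has_derivative D) (at y)" "\<And>c w. D (c *s w) = c *s D w" using DT by blast
    show "\<exists>D. (f j has_derivative D) (at y) \<and> (\<forall>c w. D (c *s w) = c * D w)"
      using fT[OF D(1), of j] D(2) by (intro exI[of _ "\<lambda>v. D v $ j"]) auto
  qed
  let ?D = "\<lambda>j y v. frechet_derivative (f j) (at y) v"
  let ?g = "\<lambda>y. G (inv_into U \<phi> y)" and ?h = "\<lambda>y. k + \<epsilon> * (\<Sum>j\<in>UNIV. (norm (f j y))\<^sup>2)"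
  have inN: "inv_into U \<phi> y \<in> U \<inter> N" if "y \<in> S" for y using that chart_inverse(1)[OF c] by (auto simp: S_def)
  have gh: "?g y = ?h y" if "y \<in> S" for y
  proof -
    have "(norm (T y - z0))\<^sup>2 = (\<Sum>j\<in>UNIV. (norm (f j y))\<^sup>2)"
      by (simp add: norm_vec_def L2_set_def sum_nonneg f_def)
    then show ?thesis using G inN[OF that] by (simp add: T_def)
  qed
  have "Ck_on n ?h S" for n
  proof -
    have "Ck_on n (\<lambda>y. (norm (f j y))\<^sup>2) S" for j
    proof -
      have "Ck_on n (\<lambda>y. Re (f j y) * Re (f j y) + Im (f j y) * Im (f j y)) S"
        by (intro Ck_on_add[OF S] Ck_on_mult[OF S] Ck_on_bounded_linear[OF S bounded_linear_Re]
            Ck_on_bounded_linear[OF S bounded_linear_Im] complex_diff_on_imp_smooth[OF S f])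
      then show ?thesis unfolding cmod_power2 by (simp add: power2_eq_square)
    qed
    then show ?thesis by (intro Ck_on_add[OF S] Ck_on_mult[OF S] Ck_on_sum[OF S] Ck_on_const)
  qed
  then have Ck: "Ck_on n ?g S" for n by (subst Ck_on_cong[OF S gh])
  then have "smooth_on ?g S" by (simp add: smooth_on_def)
  moreover have "0 < Re (levi_form ?g y w)" if y: "y \<in> S" and w: "w \<noteq> 0" for y w
  proof -
    have C2: "Ck_on (Suc (Suc 0)) ?g S" by (rule Ck)
    have h': "(?h has_derivative (\<lambda>v. \<epsilon> * (\<Sum>j\<in>UNIV. 2 * Re (cnj (f j y) * ?D j y v)))) (at y)" if "y \<in> S" for y
    proof -
      have "(?h has_derivative (\<lambda>v. 0 + \<epsilon> * (\<Sum>j\<in>UNIV. 2 * Re (cnj (f j y) * ?D j y v)))) (at y)"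
        by (intro has_derivative_add has_derivative_const has_derivative_mult_right has_derivative_sum
            has_derivative_norm_squared_complex_diff[OF f that])
      then show ?thesis by simp
    qed
    have g': "frechet_derivative ?g (at y) v = \<epsilon> * (\<Sum>j\<in>UNIV. 2 * Re (cnj (f j y) * ?D j y v))" if "y \<in> S" for y v
    proof -
      have "frechet_derivative ?g (at y) = frechet_derivative ?h (at y)"
        by (rule frechet_derivative_cong_open[OF S that]) (rule gh)
      also have "\<dots> = (\<lambda>v. \<epsilon> * (\<Sum>j\<in>UNIV. 2 * Re (cnj (f j y) * ?D j y v)))"
        by (rule frechet_derivative_at[OF h'[OF that], symmetric])
      finally show ?thesis by simp
    qed
    define D2 where "D2 j v w = frechet_derivative (\<lambda>x. ?D j x v) (at y) w" for j v w
    have D2: "((\<lambda>x. ?D j x v) has_derivative D2 j v) (at y)" "D2 j v (c *s w) = c * D2 j v w" for j v w c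
      using complex_diff_on_frechet[OF complex_diff_on_directional_derivative[OF f S] y] by (simp_all add: D2_def[abs_def])
    have g'': "second_derivative ?g y v w =
        \<epsilon> * (\<Sum>j\<in>UNIV. 2 * Re (cnj (f j y) * D2 j v w + cnj (?D j y w) * ?D j y v))" for v w
    proof -
      have "((\<lambda>x. \<epsilon> * (\<Sum>j\<in>UNIV. 2 * Re (cnj (f j x) * ?D j x v))) has_derivative
          (\<lambda>w. \<epsilon> * (\<Sum>j\<in>UNIV. 2 * Re (cnj (f j y) * D2 j v w + cnj (?D j y w) * ?D j y v)))) (at y)"
        by (intro has_derivative_mult_right has_derivative_sum bounded_linear.has_derivative[OF bounded_linear_Re]
            has_derivative_mult D2 bounded_linear.has_derivative[OF bounded_linear_cnj] complex_diff_on_frechet(1)[OF f y])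
      note D2v = frechet_derivative_at[OF this, symmetric]
      have "frechet_derivative (\<lambda>x. frechet_derivative ?g (at x) v) (at y) =
          frechet_derivative (\<lambda>x. \<epsilon> * (\<Sum>j\<in>UNIV. 2 * Re (cnj (f j x) * ?D j x v))) (at y)"
        by (rule frechet_derivative_cong_open[OF S y]) (rule g')
      then show ?thesis unfolding second_derivative_def D2v by simp
    qed
    have D2_i: "D2 j (\<i> *s v) w = \<i> * D2 j v w" for j v w
    proof -
      have "((\<lambda>x. ?D j x (\<i> *s v)) has_derivative (\<lambda>w. \<i> * D2 j v w)) (at y)"
        by (subst has_derivative_cong_open[OF S y complex_diff_on_frechet(2)[OF f]], assumption)
          (rule has_derivative_mult_right[OF D2(1)])
      from has_derivative_unique[OF D2(1) this] show ?thesis by metis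
    qed
    have "4 * Re (levi_form ?g y w) = second_derivative ?g y w w + second_derivative ?g y (\<i> *s w) (\<i> *s w)"
      by (rule levi_form_second_derivative[OF S y]) (use C2 y in auto)
    also have "\<dots> = \<epsilon> * (\<Sum>j\<in>UNIV. 4 * (norm (?D j y w))\<^sup>2)"
    proof -
      have "2 * Re (cnj (f j y) * D2 j w w + cnj (?D j y w) * ?D j y w) +
          2 * Re (cnj (f j y) * D2 j (\<i> *s w) (\<i> *s w) + cnj (?D j y (\<i> *s w)) * ?D j y (\<i> *s w)) =
          4 * (norm (?D j y w))\<^sup>2" for j
        unfolding D2_i D2(2) complex_diff_on_frechet(2)[OF f y] cmod_power2
        by (simp add: power2_eq_square algebra_simps)
      then show ?thesis
        unfolding g'' distrib_left[of \<epsilon>, symmetric] sum.distrib[symmetric] by simp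
    qed
    finally have levi: "Re (levi_form ?g y w) = \<epsilon> * (\<Sum>j\<in>UNIV. (norm (?D j y w))\<^sup>2)"
      by (simp add: sum_distrib_left[symmetric])
    have "\<exists>j. ?D j y w \<noteq> 0"
    proof (rule ccontr)
      assume none: "\<not> (\<exists>j. ?D j y w \<noteq> 0)"
      obtain D where D: "(T has_derivative D) (at y)" "\<And>c w. D (c *s w) = c *s D w" using DT[OF y] by blast
      have "D w $ j = 0" for j using none frechet_derivative_at[OF fT[OF D(1), of j]] by metis
      then have "D w = 0" by (simp add: vec_eq_iff)
      have "T y \<in> \<psi> ` (V \<inter> U)" using inN[OF y] N(2) by (auto simp: T_def)
      then obtain E where E: "((\<lambda>x. \<phi> (inv_into V \<psi> x)) has_derivative E) (at (T y))"
        using transition_holomorphic[OF d c] unfolding holomorphic_map_on_def by blast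
      have h1: "((\<lambda>x. \<phi> (inv_into V \<psi> (T x))) has_derivative (\<lambda>v. E (D v))) (at y)"
        by (rule has_derivative_compose[OF D(1) E])
      have h2: "\<phi> (inv_into V \<psi> (T x)) = x" if "x \<in> S" for x
        using inN[OF that] N(2) that chart_inverse(1)[OF d] chart_inverse(2)[OF c] by (auto simp: T_def S_def)
      have "((\<lambda>x. x) has_derivative (\<lambda>v. E (D v))) (at y)"
        by (rule has_derivative_transform_within_open[OF h1 S y h2])
      from has_derivative_unique[OF this has_derivative_ident] have "(\<lambda>v. E (D v)) = (\<lambda>v. v)" .
      then have "E (D w) = w" by metis
      then show False using \<open>D w = 0\<close> w linear_0[OF bounded_linear.linear[OF has_derivative_bounded_linear[OF E]]] by simp
    qed
    then have "0 < (\<Sum>j\<in>UNIV. (norm (?D j y w))\<^sup>2)" by (auto intro!: sum_pos2)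
    then show ?thesis unfolding levi using \<open>\<epsilon> > 0\<close> by simp
  qed
  ultimately show "smooth_on ?g (\<phi> ` (U \<inter> N)) \<and> (\<forall>z\<in>\<phi> ` (U \<inter> N). \<forall>w. w \<noteq> 0 \<longrightarrow> 0 < Re (levi_form ?g z w))"
    unfolding S_def by blast
qed

text \<open>The function \<open>m/4 + \<epsilon> |z - w0|\<^sup>2\<close> exceeds \<open>w\<close> at \<open>w0\<close>, so that it prevails in the maximum
  near \<open>w0\<close>, and with \<open>\<epsilon> r\<^sup>2 = m/4\<close> it is \<open>m/2 < w\<close> on the sphere.\<close>

theorem strict_sphere_minimum_imp_strictly_psh:
  assumes ch: "(U, \<phi>) \<in> charts" and w0: "w0 \<in> U" and peak: "strict_sphere_minimum w w0 (U, \<phi>) r m"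
  shows "\<exists>u\<in>PSH_cb M A. \<exists>N. open N \<and> w0 \<in> N \<and> N \<subseteq> M \<and> smooth_strictly_psh_on M A N u"
proof -
  have w: "w \<in> PSH_cb M A" "w w0 = 0" "0 < r" "0 < m" "cball (\<phi> w0) r \<subseteq> \<phi> ` U"
    "\<And>x. x \<in> U \<Longrightarrow> \<phi> x \<in> sphere (\<phi> w0) r \<Longrightarrow> m \<le> w x"
    using peak by (auto simp: strict_sphere_minimum_def)
  define \<epsilon> where "\<epsilon> = m / (4 * r\<^sup>2)"
  have \<epsilon>: "\<epsilon> > 0" "\<epsilon> * r\<^sup>2 = m / 4" using w by (auto simp: \<epsilon>_def)
  define \<rho> where "\<rho> x = m / 4 + \<epsilon> * (norm (\<phi> x - \<phi> w0))\<^sup>2" for x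
  let ?B = "{x \<in> U. \<phi> x \<in> ball (\<phi> w0) r}"
  let ?G = "\<lambda>x. if x \<in> ?B then max (w x) (\<rho> x) else w x"
  have c2: "continuous_on T (\<lambda>x. \<epsilon> * (norm (\<phi> x - \<phi> w0))\<^sup>2)" if "T \<subseteq> U" for T
    by (intro continuous_intros continuous_on_chart[OF ch that])
  have G: "?G \<in> PSH_cb M A"
  proof (rule PSH_cb_glue_ball[OF w(1) ch w(5)])
    show "continuous_on {x \<in> U. \<phi> x \<in> cball (\<phi> w0) r} \<rho>"
      unfolding \<rho>_def by (intro continuous_on_add continuous_on_const c2) auto
    show "locally_submean \<rho> p" if p: "p \<in> U" for p
      unfolding \<rho>_def using \<epsilon>(1)
      by (intro locally_submean_add[OF _ _ chartD(1)[OF ch] p] locally_submean_const locally_submean_scale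
          locally_submean_norm_squared[OF ch p] continuous_on_const c2) auto
    show "\<rho> x < w x" if "x \<in> U" "\<phi> x \<in> sphere (\<phi> w0) r" for x
    proof -
      have "norm (\<phi> x - \<phi> w0) = r" using that(2) by (simp add: dist_norm norm_minus_commute)
      then show ?thesis using w(6)[OF that] \<epsilon>(2) \<open>0 < m\<close> by (simp add: \<rho>_def)
    qed
  qed
  let ?N = "?B \<inter> (w -` {..<m/4} \<inter> M)"
  have "open (w -` {..<m/4} \<inter> M)"
    using continuous_on_open_vimage[OF open_M] PSH_cb_continuous[OF w(1)] open_lessThan by blast
  then have N: "open ?N" using open_chart_preimage[OF ch open_ball] by blast
  have "smooth_strictly_psh_on M A ?N ?G"
  proof (rule smooth_strictly_psh_norm_squared[OF ch N _ \<epsilon>(1)])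
    show "?G x = m/4 + \<epsilon> * (norm (\<phi> x - \<phi> w0))\<^sup>2" if "x \<in> ?N" for x
    proof -
      have "0 \<le> \<epsilon> * (norm (\<phi> x - \<phi> w0))\<^sup>2" using \<epsilon>(1) by simp
      then show ?thesis using that by (auto simp: \<rho>_def)
    qed
  qed auto
  moreover have "w0 \<in> ?N" "?N \<subseteq> M" using w0 w chartD(2)[OF ch] by auto
  ultimately show ?thesis using G N by blast
qed

section \<open>From a strict sphere minimum to logarithmic poles\<close>

lemma at_neq_bot:
  assumes "p \<in> M" shows "at p \<noteq> bot"
proof
  assume "at p = bot"
  then have "open {p}" by (simp add: at_eq_bot_iff)
  obtain U \<phi> where "(U, \<phi>) \<in> A" "p \<in> U" using chart_at[OF assms] .
  then have "open (\<phi> ` (U \<inter> {p}))" using open_chart_image[OF _ \<open>open {p}\<close>] atlas_subset_charts by blast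
  moreover have "\<phi> ` (U \<inter> {p}) = {\<phi> p}" using \<open>p \<in> U\<close> by auto
  ultimately show False using not_open_singleton by metis
qed

lemma eventually_chart_punctured:
  assumes c: "(U, \<phi>) \<in> charts" and p: "p \<in> U" and "0 < \<delta>"
  shows "\<forall>\<^sub>F x in at p. x \<in> U \<and> 0 < norm (\<phi> x - \<phi> p) \<and> norm (\<phi> x - \<phi> p) < \<delta>"
proof -
  let ?N = "{x \<in> U. \<phi> x \<in> ball (\<phi> p) \<delta>}"
  have "open ?N" "p \<in> ?N" using open_chart_preimage[OF c open_ball] p \<open>0 < \<delta>\<close> by auto
  then have "\<forall>\<^sub>F x in at p. x \<in> ?N" using eventually_at_topological by blast
  moreover have "\<forall>\<^sub>F x in at p. x \<noteq> p" using eventually_neq_at_within by blast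
  ultimately show ?thesis
  proof eventually_elim
    case (elim x)
    then have "\<phi> x \<noteq> \<phi> p" using p chartD(4)[OF c] by (auto dest: inj_onD)
    then show ?case using elim by (simp add: dist_norm norm_minus_commute)
  qed
qed

lemma tendsto_log_pole:
  assumes c: "(U, \<phi>) \<in> charts" and p: "p \<in> U"
  shows "((\<lambda>x. ereal (ln (norm (\<phi> x - \<phi> p)) + C)) \<longlongrightarrow> -\<infinity>) (at p)"
  unfolding tendsto_MInfty
proof
  fix R
  have "\<forall>\<^sub>F x in at p. x \<in> U \<and> 0 < norm (\<phi> x - \<phi> p) \<and> norm (\<phi> x - \<phi> p) < exp (R - C)"
    by (rule eventually_chart_punctured[OF c p]) simp
  then show "\<forall>\<^sub>F x in at p. ereal (ln (norm (\<phi> x - \<phi> p)) + C) < ereal R"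
  proof eventually_elim
    case (elim x)
    then have "ln (norm (\<phi> x - \<phi> p)) < ln (exp (R - C))" by (intro ln_less_cancel_iff[THEN iffD2]) auto
    then show ?case by simp
  qed
qed

text \<open>A multiple \<open>h\<close> of \<open>w\<close> minus a constant lies below \<open>log |z - w0|\<close> where \<open>s/2 < |z - w0| < s\<close> and
  above it for \<open>|z - w0| = r\<close>: as \<open>w < m/2\<close> on the ball of radius \<open>s\<close> while \<open>w \<ge> m\<close> on the sphere of
  radius \<open>r\<close>, a large multiple of \<open>w\<close> leaves a gap wider than \<open>log r - log (s/2)\<close>. The function
  with the pole is \<open>log |z - w0|\<close> inside and the maximum of the two outside. To stay
  within \<open>PSH_cb M A\<close>, the maximum \<open>G\<close> is formed with the logarithm truncated at radius
  \<open>s/2\<close>, which changes nothing in the region where \<open>G\<close> is used.\<close>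

theorem strict_sphere_minimum_imp_log_pole:
  assumes ch: "(U, \<phi>) \<in> charts" and w0: "w0 \<in> U" and peak: "strict_sphere_minimum w w0 (U, \<phi>) r m"
  shows "\<exists>v :: 'a \<Rightarrow> ereal. \<exists>C1 C2 :: real. (\<forall>x\<in>M. v x < 0) \<and> continuous_on M v \<and> psh_manifold M A v \<and>
    (\<forall>\<^sub>F z in at w0. ereal (ln (norm (\<phi> z - \<phi> w0)) + C1) < v z \<and> v z < ereal (ln (norm (\<phi> z - \<phi> w0)) + C2))"
proof -
  have w: "w \<in> PSH_cb M A" "w w0 = 0" "0 < r" "0 < m" "cball (\<phi> w0) r \<subseteq> \<phi> ` U"
    "\<And>x. x \<in> U \<Longrightarrow> \<phi> x \<in> sphere (\<phi> w0) r \<Longrightarrow> m \<le> w x"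
    using peak by (auto simp: strict_sphere_minimum_def)
  have w0M: "w0 \<in> M" using chartD(2)[OF ch] w0 by auto
  let ?n = "\<lambda>x. norm (\<phi> x - \<phi> w0)"
  let ?N = "w -` {..<m/2} \<inter> M"
  have "open ?N"
    using continuous_on_open_vimage[OF open_M] PSH_cb_continuous[OF w(1)] open_lessThan by blast
  moreover have "w0 \<in> ?N" using w0M w(2,4) by simp
  ultimately obtain r' where r': "r' > 0" "cball (\<phi> w0) r' \<subseteq> \<phi> ` (U \<inter> ?N)" using chart_small_cball[OF ch w0] by metis
  define s where "s = min r' (r/2)"
  have s: "0 < s" "s < r" "s \<le> r'" using r' w(3) by (auto simp: s_def)
  have near: "w x < m/2" if "x \<in> U" "?n x < s" for x
  proof -
    have "\<phi> x \<in> \<phi> ` (U \<inter> ?N)" using r' s that(2) by (auto simp: dist_norm norm_minus_commute)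
    then show ?thesis using chart_cball_in[OF ch that(1)] by blast
  qed
  define \<Lambda> where "\<Lambda> = 2 * (ln r - ln (s/2) + 2) / m"
  \<comment> \<open>The values of \<open>\<Lambda>\<close> and \<open>C\<close> make \<open>\<Lambda> m / 2 - C = log (s/2) - 1\<close> and \<open>\<Lambda> m - C = log r + 1\<close>.\<close>
  define C where "C = \<Lambda> * m / 2 - ln (s/2) + 1"
  have "ln (s/2) < ln r" using s by simp
  then have \<Lambda>: "\<Lambda> > 0" using w(4) by (simp add: \<Lambda>_def)
  have \<Lambda>m: "\<Lambda> * m = 2 * (ln r - ln (s/2) + 2)" using w(4) by (simp add: \<Lambda>_def)
  let ?h = "\<lambda>x. \<Lambda> * w x + - C"
  let ?\<rho> = "\<lambda>x. ln (max (?n x) (s/2))"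
  let ?G = "\<lambda>x. if x \<in> {x \<in> U. \<phi> x \<in> ball (\<phi> w0) r} then max (?h x) (?\<rho> x) else ?h x"
  have s2: "s/2 > 0" using s by simp
  have G: "?G \<in> PSH_cb M A"
  proof (rule PSH_cb_glue_ball[OF _ ch w(5)])
    show "?h \<in> PSH_cb M A" using \<Lambda> by (intro PSH_cb_add PSH_cb_scale PSH_cb_const w(1)) simp
    show "continuous_on {x \<in> U. \<phi> x \<in> cball (\<phi> w0) r} ?\<rho>" by (rule continuous_on_ln_truncated[OF ch s2]) auto
    show "locally_submean ?\<rho> p" if "p \<in> U" for p by (rule locally_submean_ln_truncated[OF ch that s2])
    show "?\<rho> x < ?h x" if "x \<in> U" "\<phi> x \<in> sphere (\<phi> w0) r" for x
    proof -
      have "?n x = r" using that(2) by (simp add: dist_norm norm_minus_commute)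
      then have "?\<rho> x = ln r" using s by (simp add: max_def)
      moreover have "\<Lambda> * m \<le> \<Lambda> * w x" using w(6)[OF that] \<Lambda> by simp
      moreover have "C = ln r - 2 * ln (s/2) + 3" unfolding C_def \<Lambda>m by (simp add: add_divide_distrib diff_divide_distrib)
      ultimately show ?thesis using \<Lambda>m by (simp add: algebra_simps)
    qed
  qed
  have Gln: "?G x = ln (?n x)" if "x \<in> U" "s/2 < ?n x" "?n x < s" for x
  proof -
    have "x \<in> {x \<in> U. \<phi> x \<in> ball (\<phi> w0) r}" using that s by (auto simp: dist_norm norm_minus_commute)
    then have "?G x = max (?h x) (?\<rho> x)" by (rule if_P)
    moreover have "\<Lambda> * w x < \<Lambda> * (m/2)" using near[OF that(1,3)] \<Lambda> by simp
    then have "?h x < ln (s/2)" by (simp add: C_def)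
    moreover have "ln (s/2) < ln (?n x)" using that(2) s2 by (intro ln_less_cancel_iff[THEN iffD2]) auto
    ultimately show ?thesis using that(2) by (simp add: max_def)
  qed
  obtain B0 where B0: "B0 > 0" "\<And>x. x \<in> M \<Longrightarrow> \<bar>?G x\<bar> \<le> B0" using PSH_cb_bounded[OF G] by blast
  define B where "B = B0 + \<bar>ln s\<bar> + 1"
  let ?D = "{x \<in> U. \<phi> x \<in> ball (\<phi> w0) s}" and ?E = "M - {x \<in> U. \<phi> x \<in> cball (\<phi> w0) (s/2)}"
  define v where "v x = (if x \<in> ?D then if x = w0 then -\<infinity> else ereal (ln (?n x) - B) else ereal (?G x - B))" for x
  have Dn: "x \<in> ?D \<longleftrightarrow> x \<in> U \<and> ?n x < s" for x by (auto simp: dist_norm norm_minus_commute)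
  have vD: "v x = ereal (ln (?n x) - B)" if "x \<in> ?D" "x \<noteq> w0" for x using that unfolding v_def by simp
  have vw0: "v w0 = -\<infinity>" using w0 s by (simp add: v_def)
  have vE: "v x = ereal (?G x - B)" if x: "x \<in> ?E" for x
  proof (cases "x \<in> ?D")
    case True
    then have "s/2 < ?n x" using x by (auto simp: dist_norm norm_minus_commute)
    moreover have "x \<noteq> w0" using x w0 s by auto
    ultimately show ?thesis using vD[OF True] Gln[of x] True unfolding Dn by simp
  next
    case False
    then show ?thesis by (simp only: v_def if_False)
  qed
  have nz: "?n x > 0" if "x \<in> U" "x \<noteq> w0" for x
    using that w0 chartD(4)[OF ch] by (auto dest: inj_onD)
  have openD: "open ?D" by (rule open_chart_preimage[OF ch open_ball])
  have "cball (\<phi> w0) (s/2) \<subseteq> \<phi> ` U" using w(5) s by (force simp: subset_iff)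
  then have "closed {x \<in> U. \<phi> x \<in> cball (\<phi> w0) (s/2)}"
    using compact_chart_preimage[OF ch compact_cball] compact_imp_closed by blast
  then have openE: "open ?E" using open_M by (rule open_Diff[rotated])
  have M_DE: "M = ?D \<union> ?E" using s chartD(2)[OF ch] by auto
  have contE: "continuous_on ?E v"
  proof (rule continuous_on_eq)
    show "continuous_on ?E (\<lambda>x. ereal (?G x - B))"
      by (intro continuous_on_ereal continuous_on_diff continuous_on_const continuous_on_subset[OF PSH_cb_continuous[OF G]]) auto
  qed (use vE in simp)
  have cont_ln: "continuous_on (?D - {w0}) (\<lambda>x. ereal (ln (?n x) - B))"
    using nz by (intro continuous_on_ereal continuous_intros continuous_on_chart[OF ch]) auto
  have contD: "continuous_on ?D v"
    unfolding continuous_on_eq_continuous_at[OF openD]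
  proof
    fix x assume x: "x \<in> ?D"
    show "isCont v x"
    proof (cases "x = w0")
      case True
      have "\<forall>\<^sub>F y in at w0. v y = ereal (ln (?n y) + (- B))"
      proof -
        have "\<forall>\<^sub>F y in at w0. y \<in> U \<and> 0 < ?n y \<and> ?n y < s" by (rule eventually_chart_punctured[OF ch w0 s(1)])
        then show ?thesis
        proof eventually_elim
          case (elim y)
          then have "y \<in> ?D" "y \<noteq> w0" by (auto simp: Dn[simplified])
          then show ?case using vD by simp
        qed
      qed
      then have "(v \<longlongrightarrow> -\<infinity>) (at w0)"
        by (rule tendsto_cong[THEN iffD2]) (rule tendsto_log_pole[OF ch w0])
      then show ?thesis using True vw0 by (simp add: isCont_def)
    next
      case False
      have o: "open (?D - {w0})" using openD by (rule open_Diff) simp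
      have "continuous_on (?D - {w0}) v" by (rule continuous_on_eq[OF cont_ln]) (use vD in auto)
      then show ?thesis using continuous_on_eq_continuous_at[OF o] x False by blast
    qed
  qed
  have contM: "continuous_on M v" using continuous_on_open_Un[OF openD openE contD contE] M_DE by simp
  have neg: "v x < 0" if x: "x \<in> M" for x
  proof (cases "x \<in> ?D")
    case True
    show ?thesis
    proof (cases "x = w0")
      case False
      have "?n x > 0" "?n x < s" using nz[of x] False True Dn[of x] by auto
      then have "ln (?n x) < ln s" by (rule ln_strict_mono[rotated])
      then have "ln (?n x) - B < 0" using B0(1) by (simp add: B_def)
      then show ?thesis using vD[OF True False] by simp
    qed (simp add: vw0)
  next
    case False
    then have "v x = ereal (?G x - B)" by (simp only: v_def if_False)
    moreover have "?G x - B < 0" using B0(2)[OF x] abs_ge_self[of "?G x"] unfolding B_def by linarith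
    ultimately show ?thesis by simp
  qed
  have psh: "psh_manifold M A v"
  proof (rule psh_manifoldI[OF contM])
    show "v x < \<infinity>" if "x \<in> M" for x using neg[OF that] by (rule less_trans) simp
    fix k p assume p: "p \<in> M"
    show "locally_submean (\<lambda>x. real_of_ereal (max (v x) (ereal (- real k)))) p"
    proof (cases "p \<in> ?D")
      case True
      \<comment> \<open>Truncating \<open>log |z - w0| - B\<close> at \<open>- k\<close> is truncating \<open>|z - w0|\<close> at \<open>exp (B - k)\<close>.\<close>
      define e where "e = exp (B - real k)"
      have e: "e > 0" "ln e = B - real k" by (auto simp: e_def)
      have cl: "continuous_on ?D (\<lambda>x. ln (max (?n x) e))" by (rule continuous_on_ln_truncated[OF ch e(1)]) auto
      have pU: "p \<in> U" using True by simp
      show ?thesis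
      proof (rule locally_submean_cong[OF _ openD True])
        show "locally_submean (\<lambda>x. ln (max (?n x) e) + - B) p"
          by (rule locally_submean_add[OF locally_submean_ln_truncated[OF ch pU e(1)] locally_submean_const openD True cl continuous_on_const])
        show "continuous_on ?D (\<lambda>x. ln (max (?n x) e) + - B)" by (intro continuous_on_add cl continuous_on_const)
        show "real_of_ereal (max (v x) (ereal (- real k))) = ln (max (?n x) e) + - B" if x: "x \<in> ?D" for x
        proof (cases "x = w0")
          case True
          then show ?thesis using e by (simp add: vw0 max_def)
        next
          case False
          have n: "?n x > 0" using nz False x by simp
          have "real_of_ereal (max (v x) (ereal (- real k))) = max (ln (?n x) - B) (- real k)"
            unfolding vD[OF x False] by (simp add: ereal_max[symmetric] del: ereal_max)
          also have "\<dots> = max (ln (?n x)) (ln e) + - B" unfolding e(2) by (simp add: max_def)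
          also have "max (ln (?n x)) (ln e) = ln (max (?n x) e)" using n e(1) by (simp add: max_def)
          finally show ?thesis .
        qed
      qed
    next
      case False
      then have pE: "p \<in> ?E" using p s by auto
      have GB: "(\<lambda>x. max (?G x + - B) (- real k)) \<in> PSH_cb M A"
        by (intro PSH_cb_max PSH_cb_add PSH_cb_const G)
      show ?thesis
      proof (rule locally_submean_cong[OF PSH_cb_locally_submean[OF GB p] openE pE])
        show "continuous_on ?E (\<lambda>x. max (?G x + - B) (- real k))"
          by (rule continuous_on_subset[OF PSH_cb_continuous[OF GB]]) auto
        show "real_of_ereal (max (v x) (ereal (- real k))) = max (?G x + - B) (- real k)" if x: "x \<in> ?E" for x
          unfolding vE[OF x] by (simp add: ereal_max[symmetric] del: ereal_max)
      qed
    qed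
  qed
  have "\<forall>\<^sub>F x in at w0. x \<in> U \<and> 0 < ?n x \<and> ?n x < s" by (rule eventually_chart_punctured[OF ch w0 s(1)])
  then have "\<forall>\<^sub>F x in at w0. ereal (ln (?n x) + (- B - 1)) < v x \<and> v x < ereal (ln (?n x) + (- B + 1))"
  proof eventually_elim
    case (elim x)
    then have "x \<in> ?D" "x \<noteq> w0" by (auto simp: Dn[simplified])
    then show ?case using vD by simp
  qed
  then show ?thesis using neg contM psh by blast
qed

section \<open>From logarithmic poles and from strict plurisubharmonicity to separation\<close>

lemma PSH_cb_truncation:
  assumes neg: "\<And>x. x \<in> M \<Longrightarrow> v x < 0" and cont: "continuous_on M v" and psh: "psh_manifold M A v" and "0 \<le> k"
  shows "(\<lambda>x. real_of_ereal (max (v x) (ereal (- k)))) \<in> PSH_cb M A"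
proof -
  let ?w = "\<lambda>x. real_of_ereal (max (v x) (ereal (- k)))"
  have w: "ereal (?w x) = max (v x) (ereal (- k))" if "x \<in> M" for x
    using neg[OF that] by (cases "v x") (auto simp: max_def)
  have contw: "continuous_on M ?w"
  proof -
    have "continuous_on M (\<lambda>x. ereal (?w x))"
      by (rule continuous_on_eq[of M "\<lambda>x. max (v x) (ereal (- k))"]) (auto intro!: continuous_intros cont simp: w)
    then show ?thesis by (simp add: continuous_on_def)
  qed
  have "\<bar>?w x\<bar> \<le> k" if "x \<in> M" for x
    using neg[OF that] \<open>0 \<le> k\<close> by (cases "v x") (auto simp: max_def)
  then have bdd: "bounded (?w ` M)" unfolding bounded_iff real_norm_def by blast
  have "psh_on (\<phi> ` U) (\<lambda>z. ereal (?w (inv_into U \<phi> z)))" if c: "(U, \<phi>) \<in> charts" for U \<phi>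
  proof -
    let ?i = "inv_into U \<phi>"
    have pv: "psh_on (\<phi> ` U) (\<lambda>z. v (?i z))" using psh c by (auto simp: psh_manifold_def)
    have inM: "?i z \<in> M" if "z \<in> \<phi> ` U" for z using chart_inverse(3)[OF c that] chartD(2)[OF c] by auto
    have ci: "continuous_on (\<phi> ` U) (\<lambda>z. ereal (?w (?i z)))"
      by (intro continuous_on_ereal continuous_on_compose2[OF contw chartD(6)[OF c]]) (use inM in auto)
    show ?thesis
      unfolding psh_on_def subharmonic_on_def
    proof (intro conjI allI impI ballI)
      show "usc_on (\<phi> ` U) (\<lambda>z. ereal (?w (?i z)))"
        by (rule continuous_on_imp_usc_on[OF ci])
      fix a b
      let ?S = "{\<zeta>. a + \<zeta> *s b \<in> \<phi> ` U}"
      have "continuous_on ?S (\<lambda>\<zeta>. ereal (?w (?i (a + \<zeta> *s b))))"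
        by (rule continuous_on_compose2[OF ci continuous_on_complex_line]) auto
      then show "usc_on ?S (\<lambda>\<zeta>. ereal (?w (?i (a + \<zeta> *s b))))"
        by (rule continuous_on_imp_usc_on)
      fix c r assume cr: "0 < r \<and> cball c r \<subseteq> ?S"
      let ?mean = "circle_mean (\<lambda>\<zeta>. ereal (?w (?i (a + \<zeta> *s b)))) c r"
      have circ: "?i (a + (c + of_real r * cis \<theta>) *s b) \<in> M" for \<theta>
      proof -
        have "c + of_real r * cis \<theta> \<in> cball c r" using cr by (simp add: dist_norm norm_mult)
        then have "c + of_real r * cis \<theta> \<in> ?S" using cr by blast
        then show ?thesis using inM by simp
      qed
      have "c \<in> ?S" using cr by (meson centre_in_cball less_imp_le subsetD)
      then have cM: "?i (a + c *s b) \<in> M" using inM by simp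
      have "v (?i (a + c *s b)) \<le> circle_mean (\<lambda>\<zeta>. v (?i (a + \<zeta> *s b))) c r"
        using pv cr unfolding psh_on_def subharmonic_on_def by blast
      also have "\<dots> \<le> ?mean" by (rule circle_mean_mono) (simp only: w[OF circ] max.cobounded1 max.cobounded2)
      finally have 1: "v (?i (a + c *s b)) \<le> ?mean" .
      have "ereal (- k) = circle_mean (\<lambda>_. ereal (- k)) c r"
        using cr by (subst circle_mean_eq_cmean) (auto intro: continuous_intros)
      also have "\<dots> \<le> ?mean" by (rule circle_mean_mono) (simp only: w[OF circ] max.cobounded1 max.cobounded2)
      finally show "ereal (?w (?i (a + c *s b))) \<le> ?mean" using 1 by (simp add: w[OF cM])
    qed simp_all
  qed
  then show ?thesis using contw bdd by (auto simp: PSH_cb_def psh_manifold_def)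
qed

text \<open>The bounds around the pole force \<open>v p = - \<infinity>\<close>. If \<open>v q > - \<infinity>\<close>, a truncation of \<open>v\<close> separates the
  points. Otherwise a truncation at a low level \<open>- k\<close> equals \<open>- k\<close> at both points but is larger
  than \<open>a = log r + C1\<close> on a sphere about \<open>p\<close> that leaves \<open>q\<close> outside; gluing in a constant just below
  \<open>a\<close> raises the value at \<open>p\<close> only.\<close>

theorem log_poles_imp_separation:
  assumes pole: "\<And>w0. w0 \<in> M \<Longrightarrow> \<exists>v :: 'a \<Rightarrow> ereal. \<exists>C1 C2 :: real.
      (\<forall>x\<in>M. v x < 0) \<and> continuous_on M v \<and> psh_manifold M A v \<and>
      (\<exists>(U, \<phi>)\<in>charts. w0 \<in> U \<and> (\<forall>\<^sub>F z in at w0.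
        ereal (ln (norm (\<phi> z - \<phi> w0)) + C1) < v z \<and> v z < ereal (ln (norm (\<phi> z - \<phi> w0)) + C2)))"
  shows "separates_points M (PSH_cb M A)"
  unfolding separates_points_def
proof (intro ballI impI)
  fix p q assume p: "p \<in> M" and q: "q \<in> M" and "p \<noteq> q"
  obtain v C1 C2 U \<phi> where neg: "\<forall>x\<in>M. v x < 0" and cont: "continuous_on M v" and psh: "psh_manifold M A v"
    and ch: "(U, \<phi>) \<in> charts" and pU: "p \<in> U"
    and ev: "\<forall>\<^sub>F z in at p. ereal (ln (norm (\<phi> z - \<phi> p)) + C1) < v z \<and> v z < ereal (ln (norm (\<phi> z - \<phi> p)) + C2)"
    using pole[OF p] by blast
  have trunc: "(\<lambda>x. real_of_ereal (max (v x) (ereal (- k)))) \<in> PSH_cb M A" if "0 \<le> k" for k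
    using PSH_cb_truncation[OF _ cont psh that] neg by blast
  have "(v \<longlongrightarrow> v p) (at p)"
    using cont p open_M by (metis at_within_open continuous_on_def)
  moreover have "(v \<longlongrightarrow> -\<infinity>) (at p)"
  proof (rule tendsto_sandwich[OF _ _ tendsto_const tendsto_log_pole[OF ch pU]])
    show "\<forall>\<^sub>F z in at p. v z \<le> ereal (ln (norm (\<phi> z - \<phi> p)) + C2)"
      using ev by eventually_elim auto
  qed simp
  ultimately have vp: "v p = -\<infinity>" using tendsto_unique at_neq_bot[OF p] by blast
  show "\<exists>u\<in>PSH_cb M A. u p \<noteq> u q"
  proof (cases "v q = -\<infinity>")
    case False
    then obtain a where a: "v q = ereal a" "a < 0" using bspec[OF neg q] by (cases "v q") auto
    let ?w = "\<lambda>x. real_of_ereal (max (v x) (ereal (- (1 - a))))"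
    have w: "?w \<in> PSH_cb M A" by (rule trunc) (use a(2) in simp)
    show ?thesis by (rule bexI[OF _ w]) (simp add: vp a max_def)
  next
    case True
    obtain N where N: "open N" "p \<in> N" "\<And>z. z \<in> N \<Longrightarrow> z \<noteq> p \<Longrightarrow> ereal (ln (norm (\<phi> z - \<phi> p)) + C1) < v z"
      using ev unfolding eventually_at_topological by blast
    have "open (N \<inter> - {q})" "p \<in> N \<inter> - {q}" using N \<open>p \<noteq> q\<close> by auto
    then obtain r where r: "r > 0" "cball (\<phi> p) r \<subseteq> \<phi> ` (U \<inter> (N \<inter> - {q}))"
      using chart_small_cball[OF ch pU] by metis
    define a where "a = ln r + C1"
    define k where "k = \<bar>a\<bar> + 1"
    let ?w = "\<lambda>x. real_of_ereal (max (v x) (ereal (- k)))"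
    let ?B = "{x \<in> U. \<phi> x \<in> ball (\<phi> p) r}"
    let ?G = "\<lambda>x. if x \<in> ?B then max (?w x) (a - 1/2) else ?w x"
    have w: "?w \<in> PSH_cb M A" by (rule trunc) (simp add: k_def)
    have G: "?G \<in> PSH_cb M A"
    proof (rule PSH_cb_glue_ball[OF w ch])
      show "cball (\<phi> p) r \<subseteq> \<phi> ` U" using r by blast
      show "a - 1/2 < ?w x" if x: "x \<in> U" "\<phi> x \<in> sphere (\<phi> p) r" for x
      proof -
        have "\<phi> x \<in> \<phi> ` (U \<inter> (N \<inter> - {q}))" using r x(2) by auto
        then have "x \<in> N" using chart_cball_in[OF ch x(1)] by blast
        moreover have "x \<noteq> p" using x(2) r(1) by auto
        moreover have "norm (\<phi> x - \<phi> p) = r" using x(2) by (simp add: dist_norm norm_minus_commute)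
        ultimately have "ereal a < v x" using N(3)[of x] by (simp add: a_def)
        moreover have "v x < 0" using neg x(1) chartD(2)[OF ch] by auto
        ultimately show ?thesis by (cases "v x") (auto simp: max_def k_def)
      qed
    qed (auto simp: locally_submean_const)
    have "q \<notin> ?B"
    proof
      assume "q \<in> ?B"
      then have "\<phi> q \<in> \<phi> ` (U \<inter> (N \<inter> - {q}))" "q \<in> U" using r(2) by auto
      then show False using chart_cball_in[OF ch] by blast
    qed
    then have "?G q = - k" using True by (simp only: if_False) (simp add: max_def)
    moreover have "?G p \<ge> a - 1/2" using pU r(1) by simp
    moreover have "- k < a - 1/2" by (simp add: k_def abs_if)
    ultimately have "?G p \<noteq> ?G q" by linarith
    then show ?thesis by (rule bexI[OF _ G])
  qed
qed

text \<open>If \<open>u p = u q\<close>, the pluriharmonic minorant of \<open>u\<close> at \<open>p\<close>, lifted by a small constant, is glued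
  in on a ball that does not contain \<open>q\<close>. This changes the value at \<open>p\<close> only.\<close>

theorem strictly_psh_imp_separation:
  assumes strict: "\<And>w0. w0 \<in> M \<Longrightarrow> \<exists>u\<in>PSH_cb M A. \<exists>N. open N \<and> w0 \<in> N \<and> N \<subseteq> M \<and> smooth_strictly_psh_on M A N u"
  shows "separates_points M (PSH_cb M A)"
  unfolding separates_points_def
proof (intro ballI impI)
  fix p q assume p: "p \<in> M" and q: "q \<in> M" and "p \<noteq> q"
  obtain u N where u: "u \<in> PSH_cb M A" and N: "open N" "p \<in> N" and sN: "smooth_strictly_psh_on M A N u"
    using strict[OF p] by blast
  show "\<exists>u\<in>PSH_cb M A. u p \<noteq> u q"
  proof (cases "u p = u q")
    case False
    then show ?thesis using u by blast
  next
    case True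
    obtain U \<phi> where "(U, \<phi>) \<in> A" and pU: "p \<in> U" using chart_at[OF p] .
    then have ch: "(U, \<phi>) \<in> charts" using atlas_subset_charts by blast
    let ?g = "\<lambda>z. u (inv_into U \<phi> z)"
    have g: "smooth_on ?g (\<phi> ` (U \<inter> N))" "\<And>w. w \<noteq> 0 \<Longrightarrow> 0 < Re (levi_form ?g (\<phi> p) w)"
      using sN ch pU N(2) by (auto simp: smooth_strictly_psh_on_def)
    have \<phi>p: "\<phi> p \<in> \<phi> ` (U \<inter> N)" using pU N by auto
    obtain P \<epsilon> r where P: "complex_diff_on P UNIV" "P (\<phi> p) = 0" and "\<epsilon> > 0" "r > 0"
      and minorant: "\<forall>h. norm h < r \<longrightarrow> ?g (\<phi> p) + Re (P (\<phi> p + h)) + \<epsilon> * (norm h)\<^sup>2 \<le> ?g (\<phi> p + h)"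
      by (rule strictly_psh_pluriharmonic_minorant[OF open_chart_image[OF ch N(1)] \<phi>p g])
    obtain r' where r': "r' > 0" "cball (\<phi> p) r' \<subseteq> \<phi> ` (U \<inter> - {q})"
      using chart_small_cball[OF ch pU, of "- {q}"] \<open>p \<noteq> q\<close> by auto
    define s where "s = min r' (r/2)"
    have s: "0 < s" "s < r" "s \<le> r'" using r' \<open>r > 0\<close> by (auto simp: s_def)
    define \<rho> where "\<rho> x = (u p + \<epsilon> * s\<^sup>2 / 2) + Re (P (\<phi> x))" for x
    let ?B = "{x \<in> U. \<phi> x \<in> ball (\<phi> p) s}"
    let ?G = "\<lambda>x. if x \<in> ?B then max (u x) (\<rho> x) else u x"
    have cP: "continuous_on T (\<lambda>x. Re (P (\<phi> x)))" if "T \<subseteq> U" for T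
      by (intro continuous_on_Re continuous_on_compose2[OF complex_diff_on_imp_continuous_on[OF P(1)] continuous_on_chart[OF ch that]]) auto
    have s_sub: "cball (\<phi> p) s \<subseteq> \<phi> ` (U \<inter> - {q})" using r' s by (auto simp: subset_iff)
    have G: "?G \<in> PSH_cb M A"
    proof (rule PSH_cb_glue_ball[OF u ch])
      show "cball (\<phi> p) s \<subseteq> \<phi> ` U" using s_sub by blast
      show "continuous_on {x \<in> U. \<phi> x \<in> cball (\<phi> p) s} \<rho>"
        unfolding \<rho>_def by (intro continuous_on_add continuous_on_const cP) auto
      show "locally_submean \<rho> y" if y: "y \<in> U" for y
        unfolding \<rho>_def
        by (intro locally_submean_add[OF _ _ chartD(1)[OF ch] y] locally_submean_const continuous_on_const cP order_refl
            locally_submean_Re_holomorphic[OF ch y P(1) open_UNIV UNIV_I])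
      show "\<rho> x < u x" if x: "x \<in> U" "\<phi> x \<in> sphere (\<phi> p) s" for x
      proof -
        have n: "norm (\<phi> x - \<phi> p) = s" using x(2) by (simp add: dist_norm norm_minus_commute)
        have "u p + Re (P (\<phi> x)) + \<epsilon> * s\<^sup>2 \<le> u x"
          using spec[OF minorant, of "\<phi> x - \<phi> p"] n s chart_inverse(1)[OF ch] x(1) pU by simp
        moreover have "\<epsilon> * s\<^sup>2 > 0" using \<open>\<epsilon> > 0\<close> s by simp
        ultimately show ?thesis by (simp add: \<rho>_def)
      qed
    qed
    have "q \<notin> ?B"
    proof
      assume "q \<in> ?B"
      then have "\<phi> q \<in> \<phi> ` (U \<inter> - {q})" "q \<in> U" using s_sub by auto
      then show False using chart_cball_in[OF ch] by blast
    qed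
    then have "?G q = u p" using True by (simp only: if_False)
    moreover have "?G p > u p" using pU s \<open>\<epsilon> > 0\<close> P(2) by (simp add: \<rho>_def)
    ultimately have "?G p \<noteq> ?G q" by linarith
    then show ?thesis by (rule bexI[OF _ G])
  qed
qed

end

theorem theoremI:
  fixes M :: "'a::{t2_space, second_countable_topology} set"
    and A :: "('a, 'n::finite) chart set"
  assumes "complex_manifold M A"
  defines "cond1 \<equiv> separates_points M (PSH_cb M A)"
    and "cond2 \<equiv> \<forall>w0\<in>M. \<exists>u\<in>PSH_cb M A. \<exists>N. open N \<and> w0 \<in> N \<and> N \<subseteq> M \<and>
                     smooth_strictly_psh_on M A N u"
    and "cond3 \<equiv> \<forall>w0\<in>M. \<exists>v :: 'a \<Rightarrow> ereal. \<exists>C1 C2 :: real.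
                     (\<forall>x\<in>M. v x < 0) \<and> continuous_on M v \<and> psh_manifold M A v \<and>
                     (\<exists>(U, \<phi>)\<in>holomorphic_charts M A. w0 \<in> U \<and>
                       (\<forall>\<^sub>F z in at w0.
                          ereal (ln (norm (\<phi> z - \<phi> w0)) + C1) < v z \<and>
                          v z < ereal (ln (norm (\<phi> z - \<phi> w0)) + C2)))"
  shows "(cond1 \<longleftrightarrow> cond2) \<and> (cond2 \<longleftrightarrow> cond3)"
proof -
  interpret complex_mfd M A by unfold_locales (rule assms(1))
  have minimum: "\<exists>U \<phi> w r m. (U, \<phi>) \<in> charts \<and> w0 \<in> U \<and> strict_sphere_minimum w w0 (U, \<phi>) r m"
    if cond1 "w0 \<in> M" for w0
  proof -
    obtain U \<phi> where c: "(U, \<phi>) \<in> A" "w0 \<in> U" using chart_at[OF \<open>w0 \<in> M\<close>] .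
    then have "(U, \<phi>) \<in> charts" using atlas_subset_charts by blast
    then show ?thesis
      using separation_imp_strict_sphere_minimum[OF that(1)[unfolded cond1_def] _ c(2)] c(2) by blast
  qed
  have "cond2" if c1: cond1
    unfolding cond2_def
  proof
    fix w0 assume "w0 \<in> M"
    then obtain U \<phi> w r m where "(U, \<phi>) \<in> charts" "w0 \<in> U" "strict_sphere_minimum w w0 (U, \<phi>) r m"
      using minimum[OF c1] by blast
    then show "\<exists>u\<in>PSH_cb M A. \<exists>N. open N \<and> w0 \<in> N \<and> N \<subseteq> M \<and> smooth_strictly_psh_on M A N u"
      by (rule strict_sphere_minimum_imp_strictly_psh)
  qed
  moreover have "cond3" if c1: cond1
    unfolding cond3_def
  proof
    fix w0 assume "w0 \<in> M"
    then obtain U \<phi> w r m where c: "(U, \<phi>) \<in> charts" "w0 \<in> U" and w: "strict_sphere_minimum w w0 (U, \<phi>) r m"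
      using minimum[OF c1] by blast
    from strict_sphere_minimum_imp_log_pole[OF c w] c
    show "\<exists>v :: 'a \<Rightarrow> ereal. \<exists>C1 C2 :: real. (\<forall>x\<in>M. v x < 0) \<and> continuous_on M v \<and> psh_manifold M A v \<and>
        (\<exists>(U, \<phi>)\<in>charts. w0 \<in> U \<and> (\<forall>\<^sub>F z in at w0.
          ereal (ln (norm (\<phi> z - \<phi> w0)) + C1) < v z \<and> v z < ereal (ln (norm (\<phi> z - \<phi> w0)) + C2)))"
      by blast
  qed
  moreover have "cond1" if cond2
    unfolding cond1_def by (rule strictly_psh_imp_separation) (rule bspec[OF that[unfolded cond2_def]])
  moreover have "cond1" if cond3
    unfolding cond1_def by (rule log_poles_imp_separation) (rule bspec[OF that[unfolded cond3_def]])
  ultimately show ?thesis by blast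
qed

end
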